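(* Let $K$ be an infinite field, $n\geq 2$, $S=K[x_1,\ldots,x_n]$, and $\mathbf d:1=d_0\mid d_1\mid\cdots\mid d_s$ a $\mathbf d$-sequence. Let $2\leq i_1<i_2<\cdots<i_r=n$, let $\alpha_1,\ldots,\alpha_r$ be positive integers with $\mathbf d$-decompositions $\alpha_q=\sum_{j=0}^s\alpha_{qj}d_j$, let $u=\prod_{q=1}^rx_{i_q}^{\alpha_q}$, and let $I=\langle u\rangle_{\mathbf d}$ be the principal $\mathbf d$-fixed ideal generated by $u$. Let $s_q=\max\{j:\alpha_{qj}\neq 0\}$, $d_{qt}=\sum_{e=1}^q\sum_{j=t}^{s_e}\alpha_{ej}d_j$ (the inner sum being empty if $t>s_e$), and $D_q=d_{q s_q}+(i_q-1)(d_{s_q}-1)$ for $1\leq q\leq r$. Then $$\operatorname{reg}(I)=\max_{1\leq q\leq r}D_q.$$ In particular, if $I=\langle x_n^{\alpha}\rangle_{\mathbf d}$ and $\alpha=\sum_{t=0}^s\alpha_td_t$ (the $\mathbf d$-decomposition) with $\alpha_s\neq 0$, then $\operatorname{reg}(I)=\alpha_sd_s+(n-1)(d_s-1)$.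
   Context: A $\mathbf d$-sequence is a strictly increasing sequence of positive integers $1=d_0\mid d_1\mid\cdots\mid d_s$, each dividing the next. Every $a\in\mathbb N$ has a unique $\mathbf d$-decomposition $a=\sum_{t=0}^s a_td_t$ with integers $a_t\geq 0$ and $a_t<d_{t+1}/d_t$ for $0\leq t<s$; write $a\leq_{\mathbf d}b$ if $a_t\leq b_t$ for all $t$ in the $\mathbf d$-decompositions. A monomial ideal $I\subset S$ is $\mathbf d$-fixed if for every monomial $v\in I$, all $1\leq j<i\leq n$ and every $t\leq_{\mathbf d}\nu_i(v)$ ($\nu_i(v)$ the exponent of $x_i$ in $v$), one has $v\,x_j^t/x_i^t\in I$. $\langle u\rangle_{\mathbf d}$ is the smallest $\mathbf d$-fixed ideal containing the monomial $u$. $\operatorname{reg}(I)=\max\{j-i:\beta_{ij}(I)\neq 0\}$ is the Castelnuovo-Mumford regularity. *)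

theory Defs
  imports "HOL-Library.Poly_Mapping" "HOL-Algebra.Ideal"
begin

section \<open>\<open>\<^bold>d\<close>-sequences and \<open>\<^bold>d\<close>-decompositions\<close>

definition d_sequence :: "(nat \<Rightarrow> nat) \<Rightarrow> nat \<Rightarrow> bool" where
  "d_sequence d s \<longleftrightarrow> d 0 = 1 \<and> (\<forall>t<s. d t < d (Suc t) \<and> d t dvd d (Suc t))"

definition d_decomposition :: "(nat \<Rightarrow> nat) \<Rightarrow> nat \<Rightarrow> nat \<Rightarrow> (nat \<Rightarrow> nat) \<Rightarrow> bool" where
  "d_decomposition d s a c \<longleftrightarrow>
     a = (\<Sum>t\<le>s. c t * d t) \<and> (\<forall>t<s. c t < d (Suc t) div d t) \<and> (\<forall>t>s. c t = 0)"

lemma d_sequence_pos: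
  assumes "d_sequence d s" "t \<le> s"
  shows "0 < d t"
proof (cases t)
  case 0
  then show ?thesis using assms by (simp add: d_sequence_def)
next
  case (Suc k)
  then have "d k < d (Suc k)" using assms by (simp add: d_sequence_def)
  then show ?thesis using Suc by simp
qed

lemma d_sequence_dvd:
  assumes "d_sequence d s" "j \<le> s" "t \<le> j"
  shows "d t dvd d j"
  using \<open>t \<le> j\<close> \<open>j \<le> s\<close>
proof (induction j rule: dec_induct)
  case (step j)
  then have "d j dvd d (Suc j)" using assms(1) by (simp add: d_sequence_def)
  with step show ?case by (meson Suc_leD dvd_trans)
qed simp

lemma d_decomposition_mod:
  assumes d: "d_sequence d s" and c: "d_decomposition d s a c" and t: "t \<le> s"
  shows "a mod d t = (\<Sum>j<t. c j * d j)"
proof -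
  have less: "(\<Sum>j<t. c j * d j) < d t" if "t \<le> s" for t
    using that
  proof (induction t)
    case 0
    then show ?case using d by (simp add: d_sequence_def)
  next
    case (Suc t)
    have dv: "d t dvd d (Suc t)" using d Suc.prems by (simp add: d_sequence_def)
    have "c t < d (Suc t) div d t" using c Suc.prems by (simp add: d_decomposition_def)
    then have "(c t + 1) * d t \<le> d (Suc t) div d t * d t" by (intro mult_le_mono1) simp
    also have "\<dots> = d (Suc t)" using dv by simp
    finally have "c t * d t + d t \<le> d (Suc t)" by (simp add: algebra_simps)
    moreover have "(\<Sum>j<t. c j * d j) < d t" using Suc by simp
    ultimately show ?case by simp
  qed
  have "{..s} = {..<t} \<union> {t..s}" using t by auto
  then have "(\<Sum>j\<le>s. c j * d j) = (\<Sum>j<t. c j * d j) + (\<Sum>j=t..s. c j * d j)"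
    by (simp add: sum.union_disjoint ivl_disj_int)
  moreover have "d t dvd (\<Sum>j=t..s. c j * d j)"
    by (rule dvd_sum) (simp add: d_sequence_dvd[OF d])
  ultimately have "a mod d t = (\<Sum>j<t. c j * d j) mod d t"
    using c by (auto simp: d_decomposition_def elim!: dvdE)
  then show ?thesis using less[OF t] by simp
qed

lemma d_decomposition_unique:
  assumes d: "d_sequence d s"
  shows "\<exists>!c. d_decomposition d s a c"
proof -
  define c where "c t = (if t < s then a div d t mod (d (Suc t) div d t)
                         else if t = s then a div d s else 0)" for t
  have part: "(\<Sum>j<t. c j * d j) = a mod d t" if "t \<le> s" for t
    using that
  proof (induction t)
    case 0
    then show ?case using d by (simp add: d_sequence_def)
  next
    case (Suc t)
    have "d t dvd d (Suc t)" using d Suc.prems by (simp add: d_sequence_def)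
    then have "a mod d (Suc t) = a mod (d t * (d (Suc t) div d t))" by simp
    also have "\<dots> = d t * (a div d t mod (d (Suc t) div d t)) + a mod d t"
      by (rule mod_mult2_eq)
    finally show ?case using Suc by (simp add: c_def mult.commute)
  qed
  have "(\<Sum>j\<le>s. c j * d j) = (\<Sum>j<s. c j * d j) + c s * d s"
    by (simp add: lessThan_Suc_atMost[symmetric])
  also have "\<dots> = a mod d s + a div d s * d s" by (simp add: part) (simp add: c_def)
  finally have "(\<Sum>j\<le>s. c j * d j) = a" by simp
  moreover have "c t < d (Suc t) div d t" if "t < s" for t
  proof -
    have "d t dvd d (Suc t)" "0 < d (Suc t)"
      using d that d_sequence_pos[OF d, of "Suc t"] by (auto simp: d_sequence_def)
    then have "0 < d (Suc t) div d t" by (auto elim: dvdE)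
    then show ?thesis using that by (simp add: c_def)
  qed
  ultimately have ex: "d_decomposition d s a c" by (simp add: d_decomposition_def c_def)
  have "c' = c" if c': "d_decomposition d s a c'" for c'
  proof
    fix t
    consider "t < s" | "t = s" | "t > s" by linarith
    then show "c' t = c t"
    proof cases
      case 1
      have "(\<Sum>j<Suc t. c' j * d j) = (\<Sum>j<Suc t. c j * d j)"
           "(\<Sum>j<t. c' j * d j) = (\<Sum>j<t. c j * d j)"
        using 1 d_decomposition_mod[OF d c', of "Suc t"] part[of "Suc t"]
          d_decomposition_mod[OF d c', of t] part[of t]
        by (simp_all del: sum.lessThan_Suc)
      then have "c' t * d t = c t * d t" unfolding sum.lessThan_Suc by linarith
      then show ?thesis using d_sequence_pos[OF d, of t] 1 by auto
    next
      case 2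
      have "(\<Sum>j<s. c' j * d j) = (\<Sum>j<s. c j * d j)"
        using d_decomposition_mod[OF d c', of s] part[of s] by simp
      moreover have "(\<Sum>j\<le>s. c' j * d j) = (\<Sum>j\<le>s. c j * d j)"
        using ex c' by (simp add: d_decomposition_def)
      ultimately have "c' s * d s = c s * d s"
        by (simp add: lessThan_Suc_atMost[symmetric])
      then show ?thesis using d_sequence_pos[OF d, of s] 2 by auto
    next
      case 3
      then show ?thesis using ex c' by (simp add: d_decomposition_def)
    qed
  qed
  with ex show ?thesis by blast
qed

definition d_coeff :: "(nat \<Rightarrow> nat) \<Rightarrow> nat \<Rightarrow> nat \<Rightarrow> nat \<Rightarrow> nat" where
  "d_coeff d s a = (THE c. d_decomposition d s a c)"

definition d_le :: "(nat \<Rightarrow> nat) \<Rightarrow> nat \<Rightarrow> nat \<Rightarrow> nat \<Rightarrow> bool" where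
  "d_le d s a b \<longleftrightarrow> (\<forall>t\<le>s. d_coeff d s a t \<le> d_coeff d s b t)"


section \<open>The polynomial ring and monomial ideals\<close>

text \<open>
  An exponent vector is a finitely supported function on the indices of the variables; the
  polynomials in \<open>x\<^sub>1, \<dots>, x\<^sub>n\<close> are those whose exponent vectors are supported in \<open>{1..n}\<close>.
\<close>

type_synonym expo = "nat \<Rightarrow>\<^sub>0 nat"
type_synonym 'k mpoly = "(nat \<Rightarrow>\<^sub>0 nat) \<Rightarrow>\<^sub>0 'k"

definition expos :: "nat \<Rightarrow> expo set" where
  "expos n = {m. Poly_Mapping.keys m \<subseteq> {1..n}}"

definition poly_ring :: "nat \<Rightarrow> 'k::field mpoly ring" where
  "poly_ring n = \<lparr>carrier = {p. Poly_Mapping.keys p \<subseteq> expos n},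
     monoid.mult = (*), one = 1, zero = 0, add = (+)\<rparr>"

lemma cring_poly_ring: "cring (poly_ring n :: 'k::field mpoly ring)"
proof -
  let ?R = "poly_ring n :: 'k mpoly ring"
  have add: "Poly_Mapping.keys (p + q) \<subseteq> expos n"
    if "Poly_Mapping.keys p \<subseteq> expos n" "Poly_Mapping.keys q \<subseteq> expos n" for p q :: "'k mpoly"
    using Poly_Mapping.keys_add[of p q] that by blast
  have mult: "Poly_Mapping.keys (p * q) \<subseteq> expos n"
    if "Poly_Mapping.keys p \<subseteq> expos n" "Poly_Mapping.keys q \<subseteq> expos n" for p q :: "'k mpoly"
  proof -
    have "a + b \<in> expos n" if "a \<in> expos n" "b \<in> expos n" for a b :: expo
      using Poly_Mapping.keys_add[of a b] that by (auto simp: expos_def)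
    then show ?thesis using Poly_Mapping.keys_mult[of p q] that by blast
  qed
  have uminus: "Poly_Mapping.keys (- p) = Poly_Mapping.keys p" for p :: "'k mpoly"
    by (auto simp: in_keys_iff)
  show ?thesis
  proof (rule cringI)
    show "abelian_group ?R"
    proof (rule abelian_groupI)
      fix p assume "p \<in> carrier ?R"
      then have "- p \<in> carrier ?R" "- p \<oplus>\<^bsub>?R\<^esub> p = \<zero>\<^bsub>?R\<^esub>"
        by (simp_all add: poly_ring_def uminus)
      then show "\<exists>q\<in>carrier ?R. q \<oplus>\<^bsub>?R\<^esub> p = \<zero>\<^bsub>?R\<^esub>" by blast
    qed (simp_all add: poly_ring_def add add_ac)
    show "Group.comm_monoid ?R"
      by (rule comm_monoidI) (use mult in \<open>auto simp: poly_ring_def mult_ac expos_def\<close>)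
  qed (simp add: poly_ring_def distrib_right)
qed

definition monomial :: "expo \<Rightarrow> 'k::field mpoly" where
  "monomial m = Poly_Mapping.single m 1"

definition monomial_ideal :: "nat \<Rightarrow> 'k::field mpoly set \<Rightarrow> bool" where
  "monomial_ideal n I \<longleftrightarrow> (\<exists>M \<subseteq> expos n. I = genideal (poly_ring n) (monomial ` M))"


section \<open>\<open>\<^bold>d\<close>-fixed ideals\<close>

text \<open>
  Subtraction of exponent vectors is truncated, but \<open>d_le d s t (Poly_Mapping.lookup v i)\<close> implies
  \<open>t \<le> Poly_Mapping.lookup v i\<close>, so below it is the division by \<open>x\<^sub>i\<^sup>t\<close>.
\<close>

lemma d_le_imp_le:
  assumes d: "d_sequence d s" and le: "d_le d s a b"
  shows "a \<le> b"
proof -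
  have *: "x = (\<Sum>t\<le>s. d_coeff d s x t * d t)" for x
    using theI'[OF d_decomposition_unique[OF d, of x]]
    by (simp add: d_decomposition_def d_coeff_def)
  have "(\<Sum>t\<le>s. d_coeff d s a t * d t) \<le> (\<Sum>t\<le>s. d_coeff d s b t * d t)"
    by (rule sum_mono) (use le in \<open>simp add: d_le_def\<close>)
  then show ?thesis using *[of a] *[of b] by simp
qed

definition d_fixed :: "nat \<Rightarrow> (nat \<Rightarrow> nat) \<Rightarrow> nat \<Rightarrow> 'k::field mpoly set \<Rightarrow> bool" where
  "d_fixed n d s I \<longleftrightarrow> monomial_ideal n I \<and>
     (\<forall>v\<in>expos n. monomial v \<in> I \<longrightarrow>
       (\<forall>i j t. 1 \<le> j \<and> j < i \<and> i \<le> n \<and> d_le d s t (Poly_Mapping.lookup v i) \<longrightarrow>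
          monomial (v - Poly_Mapping.single i t + Poly_Mapping.single j t) \<in> I))"

definition principal_d_fixed :: "nat \<Rightarrow> (nat \<Rightarrow> nat) \<Rightarrow> nat \<Rightarrow> expo \<Rightarrow> 'k::field mpoly set" where
  "principal_d_fixed n d s u = \<Inter> {I. d_fixed n d s I \<and> monomial u \<in> I}"


section \<open>Minimal graded free resolutions, graded Betti numbers, regularity\<close>

definition total_degree :: "expo \<Rightarrow> nat" where
  "total_degree m = (\<Sum>i\<in>Poly_Mapping.keys m. Poly_Mapping.lookup m i)"

definition free_module :: "nat \<Rightarrow> nat \<Rightarrow> (nat \<Rightarrow> 'k::field mpoly) set" where
  "free_module n r = {v. (\<forall>k<r. v k \<in> carrier (poly_ring n)) \<and> (\<forall>k\<ge>r. v k = 0)}"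

definition mat_apply ::
    "nat \<Rightarrow> nat \<Rightarrow> (nat \<Rightarrow> nat \<Rightarrow> 'k::field mpoly) \<Rightarrow> (nat \<Rightarrow> 'k mpoly) \<Rightarrow> nat \<Rightarrow> 'k mpoly" where
  "mat_apply r c A v = (\<lambda>k. if k < r then \<Sum>l<c. A k l * v l else 0)"

text \<open>
  The resolution is \<open>\<cdots> \<rightarrow> F\<^sub>2 \<rightarrow> F\<^sub>1 \<rightarrow> F\<^sub>0 \<rightarrow> I \<rightarrow> 0\<close>, where \<open>F\<^sub>i\<close> is free of rank \<open>rk i\<close> and its
  \<open>k\<close>-th basis element (\<open>k < rk i\<close>) has degree \<open>sh i k\<close>. The augmentation sends the \<open>l\<close>-th basis
  element of \<open>F\<^sub>0\<close> to \<open>g l\<close>, and the map \<open>F\<^sub>i\<^sub>+\<^sub>1 \<rightarrow> F\<^sub>i\<close> has the matrix \<open>A i\<close>. The conditions on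
  \<open>g\<close> and \<open>A\<close> say that all maps preserve degrees, and the condition on the constant term (the
  coefficient at the exponent vector \<open>0\<close>) of \<open>A i k l\<close> says that the image of \<open>F\<^sub>i\<^sub>+\<^sub>1\<close> lies in
  \<open>(x\<^sub>1, \<dots>, x\<^sub>n) F\<^sub>i\<close>. As \<open>I\<close> is an ideal of the polynomial ring, minimality forces all degrees to
  be nonnegative, so natural numbers suffice for them.
\<close>

definition minimal_graded_free_resolution ::
    "nat \<Rightarrow> 'k::field mpoly set \<Rightarrow> (nat \<Rightarrow> nat) \<Rightarrow> (nat \<Rightarrow> nat \<Rightarrow> nat) \<Rightarrow>
     (nat \<Rightarrow> 'k mpoly) \<Rightarrow> (nat \<Rightarrow> nat \<Rightarrow> nat \<Rightarrow> 'k mpoly) \<Rightarrow> bool" where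
  "minimal_graded_free_resolution n I rk sh g A \<longleftrightarrow>
     (\<forall>l<rk 0. g l \<in> carrier (poly_ring n) \<and>
        (\<forall>m\<in>Poly_Mapping.keys (g l). total_degree m = sh 0 l)) \<and>
     (\<forall>i. \<forall>k<rk i. \<forall>l<rk (Suc i).
        A i k l \<in> carrier (poly_ring n) \<and>
        (\<forall>m\<in>Poly_Mapping.keys (A i k l). sh i k + total_degree m = sh (Suc i) l) \<and>
        Poly_Mapping.lookup (A i k l) 0 = 0) \<and>
     (\<lambda>v. \<Sum>l<rk 0. g l * v l) ` free_module n (rk 0) = I \<and>
     {v \<in> free_module n (rk 0). (\<Sum>l<rk 0. g l * v l) = 0} =
       mat_apply (rk 0) (rk 1) (A 0) ` free_module n (rk 1) \<and>
     (\<forall>i. {v \<in> free_module n (rk (Suc i)). mat_apply (rk i) (rk (Suc i)) (A i) v = (\<lambda>_. 0)} =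
       mat_apply (rk (Suc i)) (rk (Suc (Suc i))) (A (Suc i)) ` free_module n (rk (Suc (Suc i))))"

text \<open>
  The graded Betti number \<open>\<beta>\<^sub>i\<^sub>j(I)\<close> is the number of basis elements of degree \<open>j\<close> in \<open>F\<^sub>i\<close>; it does
  not depend on the minimal graded free resolution.
\<close>

definition betti :: "nat \<Rightarrow> 'k::field mpoly set \<Rightarrow> nat \<Rightarrow> nat \<Rightarrow> nat" where
  "betti n I i j = (SOME b. \<exists>rk sh g A.
     minimal_graded_free_resolution n I rk sh g A \<and> b = card {k. k < rk i \<and> sh i k = j})"

definition regularity :: "nat \<Rightarrow> 'k::field mpoly set \<Rightarrow> int" where
  "regularity n I = Max {int j - int i | i j. betti n I i j \<noteq> 0}"


section \<open>The numbers \<open>s\<^sub>q\<close>, \<open>d\<^sub>q\<^sub>t\<close> and \<open>D\<^sub>q\<close>\<close>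

definition top_index :: "(nat \<Rightarrow> nat) \<Rightarrow> nat \<Rightarrow> nat \<Rightarrow> nat" where
  "top_index d s a = Max {j. j \<le> s \<and> d_coeff d s a j \<noteq> 0}"

definition tail_sum :: "(nat \<Rightarrow> nat) \<Rightarrow> nat \<Rightarrow> (nat \<Rightarrow> nat) \<Rightarrow> nat \<Rightarrow> nat \<Rightarrow> nat" where
  "tail_sum d s \<alpha> q t = (\<Sum>e=1..q. \<Sum>j=t..top_index d s (\<alpha> e). d_coeff d s (\<alpha> e) j * d j)"

definition D_num :: "(nat \<Rightarrow> nat) \<Rightarrow> nat \<Rightarrow> (nat \<Rightarrow> nat) \<Rightarrow> (nat \<Rightarrow> nat) \<Rightarrow> nat \<Rightarrow> nat" where
  "D_num d s i \<alpha> q =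
     tail_sum d s \<alpha> q (top_index d s (\<alpha> q)) + (i q - 1) * (d (top_index d s (\<alpha> q)) - 1)"

end

theory Submission
  imports Defs "HOL-Library.Function_Algebras" "HOL.Vector_Spaces"
begin

text \<open>
  For a monomial ideal \<open>I\<close> let \<open>m(v)\<close> be the index of the last variable of a monomial \<open>v\<close>. If every
  monomial \<open>v \<in> I\<close> of degree above \<open>R\<close> satisfies \<open>v / x\<^sub>m\<^sub>(\<^sub>v\<^sub>) \<in> I\<close>, then the Koszul complex of \<open>I\<close> is a
  cone in all relevant multidegrees, with apex the last variable, so \<open>reg I \<le> R\<close>. If some \<open>v \<in> I\<close> of
  degree \<open>R\<close> violates the condition, then \<open>v / x\<^sub>m\<^sub>(\<^sub>v\<^sub>)\<close> is a socle monomial and yields a nonzero Koszul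
  class, so \<open>reg I = R\<close>. Minimal resolutions are compared with Koszul homology by dimension shifting
  along the syzygy modules, and the resulting bound on generator degrees also gives their existence.

  A monomial \<open>v\<close> lies in \<open>\<langle>u\<rangle>\<^sub>d\<close> iff \<open>\<Sum>\<^sub>l \<lfloor>u\<^sub>l\<rfloor>\<^sub>J\<^sub>(\<^sub>l\<^sub>) \<le> \<Sum>\<^sub>l \<lfloor>v\<^sub>l\<rfloor>\<^sub>J\<^sub>(\<^sub>l\<^sub>)\<close> for all monotone level functions
  \<open>J\<close>, where \<open>\<lfloor>x\<rfloor>\<^sub>J\<close> is the largest multiple of \<open>d\<^sub>J\<close> that is at most \<open>x\<close>. With this Hall type criterion
  the largest degree of a monomial violating the condition is computed to be \<open>max D\<^sub>q\<close>.
\<close>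

text \<open>Only the vanishing of Betti numbers enters the regularity, so homology spaces are never
  formed; all statements are about exactness at a homological degree and a coefficient degree. The
  shape of D_q comes from rounding. At level t an exponent can carry up to d_t - 1 that rounding to
  multiples of d_t does not see. A monomial of the ideal that leaves it when divided by its last
  variable x_k may carry this surplus in each of the k - 1 earlier variables but not in x_k, while
  its visible part has to match the rounded exponents of u. This gives a rounded sum plus (k -
  1)(d_t - 1). Since i_1 >= 2, the variable x_1 has room for surplus but nothing to match, and this
  makes the number grow with t; hence only the top level s_q counts for each q. Level functions are
  monotone because moves go to smaller indices, where the rounding is finer: the rounded sum of a
  monomial cannot drop under a move.\<close>

abbreviation lookup :: "('a \<Rightarrow>\<^sub>0 'b::zero) \<Rightarrow> 'a \<Rightarrow> 'b" where
  "lookup \<equiv> Poly_Mapping.lookup"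

abbreviation keys :: "('a \<Rightarrow>\<^sub>0 'b::zero) \<Rightarrow> 'a set" where
  "keys \<equiv> Poly_Mapping.keys"


section \<open>Koszul complexes\<close>

text \<open>Counting the elements above i, not below, makes the sign of a largest index trivial.
  That index is the one used by the contracting homotopy.\<close>

definition signed :: "nat \<Rightarrow> nat set \<Rightarrow> 'v::ab_group_add \<Rightarrow> 'v" where
  "signed i T v = (if even (card {t\<in>T. i < t}) then v else - v)"

text \<open>The coefficient at e_T of the Koszul boundary. A chain is stored as its coefficient
  function on index sets, and \<open>X i\<close> plays the multiplication by x_i, so that one
  definition serves all modules.\<close>

definition koszul :: "(nat \<Rightarrow> 'v \<Rightarrow> 'v) \<Rightarrow> nat \<Rightarrow> (nat set \<Rightarrow> 'v) \<Rightarrow> nat set \<Rightarrow> 'v::ab_group_add" where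
  "koszul X n z T = (\<Sum>i\<in>{1..n} - T. signed i T (X i (z (insert i T))))"

definition kchains :: "nat \<Rightarrow> nat \<Rightarrow> 'v set \<Rightarrow> (nat set \<Rightarrow> 'v::ab_group_add) set" where
  "kchains n p A = {z. \<forall>T. if T \<subseteq> {1..n} \<and> card T = p then z T \<in> A else z T = 0}"

text \<open>The parameter e is the degree of the coefficients, without the degree p of the exterior
  part. Failure at (p, e) therefore corresponds to a nonzero Betti number with i = p and j = p + e,
  and e is the quantity whose maximum is the regularity.\<close>

definition koszul_exact ::
    "(nat \<Rightarrow> 'v::ab_group_add \<Rightarrow> 'v) \<Rightarrow> nat \<Rightarrow> (int \<Rightarrow> 'v set) \<Rightarrow> nat \<Rightarrow> int \<Rightarrow> bool" where
  "koszul_exact X n G p e \<longleftrightarrow>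
     (\<forall>z\<in>kchains n p (G e). (\<forall>T. koszul X n z T = 0) \<longrightarrow>
        (\<exists>y\<in>kchains n (Suc p) (G (e - 1)). koszul X n y = z))"

lemma signed_0 [simp]: "signed i T 0 = 0"
  by (simp add: signed_def)

lemma signed_add: "signed i T (v + w) = signed i T v + signed i T w"
  by (simp add: signed_def)

lemma signed_diff: "signed i T (v - w) = signed i T v - signed i T w"
  by (simp add: signed_def)

lemma signed_sum: "signed i T (sum f A) = (\<Sum>a\<in>A. signed i T (f a))"
  by (simp add: signed_def sum_negf)

lemma signed_insert_less:
  assumes "finite T" "j \<notin> T" "i < j"
  shows "signed i (insert j T) v = - signed i T v"
proof -
  have "{t \<in> insert j T. i < t} = insert j {t \<in> T. i < t}" using assms by auto
  then show ?thesis using assms by (simp add: signed_def)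
qed

lemma signed_insert_ge:
  assumes "j \<le> i"
  shows "signed i (insert j T) v = signed i T v"
proof -
  have "{t \<in> insert j T. i < t} = {t \<in> T. i < t}" using assms by auto
  then show ?thesis by (simp add: signed_def)
qed

lemma signed_top:
  assumes "\<And>t. t \<in> T \<Longrightarrow> t \<le> i"
  shows "signed i T v = v"
proof -
  have "{t \<in> T. i < t} = {}" using assms by fastforce
  then show ?thesis by (simp only: signed_def card.empty even_zero if_True)
qed

lemma chains_memD: "z \<in> kchains n p A \<Longrightarrow> T \<subseteq> {1..n} \<Longrightarrow> card T = p \<Longrightarrow> z T \<in> A"
  unfolding kchains_def by auto

lemma chains_zeroD: "z \<in> kchains n p A \<Longrightarrow> \<not> (T \<subseteq> {1..n} \<and> card T = p) \<Longrightarrow> z T = 0"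
  unfolding kchains_def by (auto split: if_splits)

lemma chains_mem: "z \<in> kchains n p A \<Longrightarrow> 0 \<in> A \<Longrightarrow> z T \<in> A"
  unfolding kchains_def by (cases "T \<subseteq> {1..n} \<and> card T = p") (auto dest: spec[of _ T])

lemma chainsI:
  assumes "\<And>T. T \<subseteq> {1..n} \<Longrightarrow> card T = p \<Longrightarrow> z T \<in> A"
    and "\<And>T. \<not> (T \<subseteq> {1..n} \<and> card T = p) \<Longrightarrow> z T = 0"
  shows "z \<in> kchains n p A"
  using assms unfolding kchains_def by auto

lemma chains_mono: "A \<subseteq> B \<Longrightarrow> kchains n p A \<subseteq> kchains n p B"
  unfolding kchains_def by (auto split: if_splits)

lemma chains_lift:
  assumes "w \<in> kchains n p (f ` A)" and "f 0 = 0"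
  shows "\<exists>z\<in>kchains n p A. w = (\<lambda>T. f (z T))"
proof -
  define z where "z T = (if T \<subseteq> {1..n} \<and> card T = p then (SOME a. a \<in> A \<and> f a = w T) else 0)" for T
  have z: "z T \<in> A \<and> f (z T) = w T" if "T \<subseteq> {1..n}" "card T = p" for T
  proof -
    have "\<exists>a. a \<in> A \<and> f a = w T" using chains_memD[OF assms(1) that] by force
    then show ?thesis using that someI_ex[of "\<lambda>a. a \<in> A \<and> f a = w T"] by (simp add: z_def)
  qed
  have "z \<in> kchains n p A" using z by (intro chainsI) (auto simp: z_def)
  moreover have "w = (\<lambda>T. f (z T))"
  proof
    fix T
    show "w T = f (z T)"
    proof (cases "T \<subseteq> {1..n} \<and> card T = p")
      case True then show ?thesis using z by simp
    next
      case False
      then show ?thesis using chains_zeroD[OF assms(1) False] assms(2) by (auto simp: z_def)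
    qed
  qed
  ultimately show ?thesis by blast
qed

section \<open>Koszul complexes of commuting operators\<close>

locale koszul_ops =
  fixes X :: "nat \<Rightarrow> 'v::ab_group_add \<Rightarrow> 'v"
  assumes X_add: "X i (v + w) = X i v + X i w"
    and X_comm: "X i (X j v) = X j (X i v)"
begin

lemma X_0 [simp]: "X i 0 = 0"
  using X_add[of i 0 0] by simp

lemma X_uminus: "X i (- v) = - X i v"
  using X_add[of i v "- v"] by (simp add: eq_neg_iff_add_eq_0 add.commute)

lemma X_diff: "X i (v - w) = X i v - X i w"
  using X_add[of i v "- w"] by (simp add: X_uminus)

lemma X_sum: "X i (sum f A) = (\<Sum>a\<in>A. X i (f a))"
  by (induction A rule: infinite_finite_induct) (simp_all add: X_add)

lemma X_signed: "X i (signed j T v) = signed j T (X i v)"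
  by (simp add: signed_def X_uminus)

lemma koszul_zero: "koszul X n (\<lambda>T. 0) = (\<lambda>T. 0)"
  by (simp add: koszul_def fun_eq_iff)

lemma koszul_diff: "koszul X n (\<lambda>T. y T - z T) = (\<lambda>T. koszul X n y T - koszul X n z T)"
  by (simp add: koszul_def fun_eq_iff X_diff signed_diff sum_subtractf)

lemma koszul_add: "koszul X n (\<lambda>T. y T + z T) T = koszul X n y T + koszul X n z T"
  by (simp add: koszul_def X_add signed_add sum.distrib)

lemma koszul_outside:
  assumes "z \<in> kchains n p A" "\<not> (T \<subseteq> {1..n} \<and> Suc (card T) = p)"
  shows "koszul X n z T = 0"
proof -
  have "z (insert i T) = 0" if "i \<in> {1..n} - T" for i
  proof (rule chains_zeroD[OF assms(1)])
    show "\<not> (insert i T \<subseteq> {1..n} \<and> card (insert i T) = p)"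
      using assms(2) that finite_subset[of T "{1..n}"] by auto
  qed
  then show ?thesis by (simp add: koszul_def)
qed

text \<open>At p = 0 every chain is a cycle, so exactness means that degree e is generated from
  degree e - 1: there is no minimal generator of degree e.\<close>

lemma koszul_exact_0_iff:
  assumes "0 \<in> G e"
  shows "koszul_exact X n G 0 e \<longleftrightarrow> (\<forall>v\<in>G e. \<exists>y\<in>kchains n 1 (G (e - 1)). koszul X n y {} = v)"
proof
  assume ex: "koszul_exact X n G 0 e"
  show "\<forall>v\<in>G e. \<exists>y\<in>kchains n 1 (G (e - 1)). koszul X n y {} = v"
  proof
    fix v assume "v \<in> G e"
    let ?z = "\<lambda>T :: nat set. if T = {} then v else 0"
    have "?z \<in> kchains n 0 (G e)"
      using \<open>v \<in> G e\<close> finite_subset[of _ "{1..n}"] by (intro chainsI) auto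
    moreover have "\<forall>T. koszul X n ?z T = 0" by (simp add: koszul_def)
    ultimately obtain y where y: "y \<in> kchains n 1 (G (e - 1))" "koszul X n y = ?z"
      using ex unfolding koszul_exact_def by auto
    have "koszul X n y {} = v" by (simp add: y(2))
    with y(1) show "\<exists>y\<in>kchains n 1 (G (e - 1)). koszul X n y {} = v" by blast
  qed
next
  assume ex: "\<forall>v\<in>G e. \<exists>y\<in>kchains n 1 (G (e - 1)). koszul X n y {} = v"
  show "koszul_exact X n G 0 e" unfolding koszul_exact_def
  proof (intro ballI impI)
    fix z assume z: "z \<in> kchains n 0 (G e)"
    obtain y where y: "y \<in> kchains n 1 (G (e - 1))" "koszul X n y {} = z {}"
      using ex chains_mem[OF z assms, of "{}"] by blast
    have "koszul X n y T = z T" for T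
    proof (cases "T = {}")
      case False
      then have no: "\<not> (T \<subseteq> {1..n} \<and> card T = 0)" using finite_subset[of T "{1..n}"] by auto
      then show ?thesis using koszul_outside[OF y(1), of T] chains_zeroD[OF z no] by auto
    qed (use y in simp)
    then show "\<exists>y\<in>kchains n (Suc 0) (G (e - 1)). koszul X n y = z" using y(1) by auto
  qed
qed

text \<open>The terms for \<open>(i, j)\<close> and \<open>(j, i)\<close> cancel. In characteristic 2 antisymmetry alone does not
  give this, hence the splitting into \<open>i < j\<close> and \<open>j < i\<close>.\<close>

lemma koszul_koszul:
  assumes "z \<in> kchains n p A"
  shows "koszul X n (koszul X n z) T = 0"
proof (cases "finite T")
  case False
  have "koszul X n z (insert i T) = 0" for i
    by (rule koszul_outside[OF assms]) (use False finite_subset[of T "{1..n}"] in auto)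
  then show ?thesis by (simp add: koszul_def[of _ _ "koszul X n z"])
next
  case True
  let ?C = "{1..n} - T"
  define f where "f i j = signed i T (signed j (insert i T) (X i (X j (z (insert j (insert i T))))))" for i j
  have anti: "f j i = - f i j" if "i \<in> ?C" "j \<in> ?C" "i < j" for i j
    using that True
    by (simp add: f_def signed_insert_less signed_insert_ge X_comm[of i j] insert_commute[of i j])
      (simp add: signed_def)
  have "koszul X n (koszul X n z) T = (\<Sum>i\<in>?C. \<Sum>j\<in>{1..n} - insert i T. f i j)"
    unfolding koszul_def by (simp add: X_sum X_signed signed_sum f_def)
  also have "\<dots> = (\<Sum>i\<in>?C. (\<Sum>j\<in>{j\<in>?C. i < j}. f i j) + (\<Sum>j\<in>{j\<in>?C. j < i}. f i j))"
  proof (rule sum.cong[OF refl])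
    fix i assume "i \<in> ?C"
    have eq: "{1..n} - insert i T = {j\<in>?C. i < j} \<union> {j\<in>?C. j < i}" by auto
    show "(\<Sum>j\<in>{1..n} - insert i T. f i j) = (\<Sum>j\<in>{j\<in>?C. i < j}. f i j) + (\<Sum>j\<in>{j\<in>?C. j < i}. f i j)"
      unfolding eq by (rule sum.union_disjoint) auto
  qed
  also have "\<dots> = (\<Sum>i\<in>?C. \<Sum>j\<in>{j\<in>?C. i < j}. f i j) + (\<Sum>i\<in>?C. \<Sum>j\<in>{j\<in>?C. j < i}. f i j)"
    by (rule sum.distrib)
  also have "(\<Sum>i\<in>?C. \<Sum>j\<in>{j\<in>?C. j < i}. f i j) = (\<Sum>j\<in>?C. \<Sum>i\<in>{i\<in>?C. j < i}. f i j)"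
    by (rule sum.swap_restrict) auto
  also have "\<dots> = (\<Sum>j\<in>?C. \<Sum>i\<in>{i\<in>?C. j < i}. - f j i)"
    by (intro sum.cong refl) (use anti in auto)
  finally show ?thesis by (simp add: sum_negf)
qed

lemma koszul_chain:
  assumes z: "z \<in> kchains n (Suc p) A" and "0 \<in> B"
    and B: "\<And>v w. v \<in> B \<Longrightarrow> w \<in> B \<Longrightarrow> v + w \<in> B" "\<And>v. v \<in> B \<Longrightarrow> - v \<in> B"
    and XB: "\<And>i v. i \<in> {1..n} \<Longrightarrow> v \<in> A \<Longrightarrow> X i v \<in> B"
  shows "koszul X n z \<in> kchains n p B"
proof (rule chainsI)
  fix T assume T: "T \<subseteq> {1..n}" "card T = p"
  have sum: "sum g C \<in> B" if "\<And>c. c \<in> C \<Longrightarrow> g c \<in> B" for g :: "nat \<Rightarrow> 'v" and C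
    using that by (induction C rule: infinite_finite_induct) (auto simp: \<open>0 \<in> B\<close> B)
  have "finite T" using T(1) finite_subset by blast
  show "koszul X n z T \<in> B" unfolding koszul_def
  proof (rule sum)
    fix i assume i: "i \<in> {1..n} - T"
    then have "z (insert i T) \<in> A" using T \<open>finite T\<close> by (intro chains_memD[OF z]) auto
    then have "X i (z (insert i T)) \<in> B" using XB i by simp
    then show "signed i T (X i (z (insert i T))) \<in> B" by (simp add: signed_def B)
  qed
qed (use koszul_outside[OF z] in auto)

end

locale koszul_graded = koszul_ops X for X :: "nat \<Rightarrow> 'v::ab_group_add \<Rightarrow> 'v" +
  fixes n :: nat and G :: "int \<Rightarrow> 'v set"
  assumes G_0 [simp]: "0 \<in> G e"
    and G_add: "v \<in> G e \<Longrightarrow> w \<in> G e \<Longrightarrow> v + w \<in> G e"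
    and G_uminus: "v \<in> G e \<Longrightarrow> - v \<in> G e"
    and G_X: "i \<in> {1..n} \<Longrightarrow> v \<in> G e \<Longrightarrow> X i v \<in> G (e + 1)"
begin

lemma G_diff: "v \<in> G e \<Longrightarrow> w \<in> G e \<Longrightarrow> v - w \<in> G e"
  using G_add[of v e "- w"] G_uminus by simp

lemma koszul_chains: "z \<in> kchains n (Suc p) (G e) \<Longrightarrow> koszul X n z \<in> kchains n p (G (e + 1))"
  by (rule koszul_chain) (auto intro: G_add G_uminus G_X)

lemma chains_diff:
  "y \<in> kchains n p (G e) \<Longrightarrow> z \<in> kchains n p (G e) \<Longrightarrow> (\<lambda>T. y T - z T) \<in> kchains n p (G e)"
  using G_diff unfolding kchains_def by (auto split: if_splits)

end

section \<open>Minimal covers and dimension shifting\<close>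

locale koszul_hom =
  X: koszul_ops X + Y: koszul_ops Y
  for X :: "nat \<Rightarrow> 'v::ab_group_add \<Rightarrow> 'v" and Y :: "nat \<Rightarrow> 'w::ab_group_add \<Rightarrow> 'w" +
  fixes f :: "'v \<Rightarrow> 'w"
  assumes f_add: "f (v + w) = f v + f w"
    and f_X: "f (X i v) = Y i (f v)"
begin

lemma f_0 [simp]: "f 0 = 0"
  using f_add[of 0 0] by simp

lemma f_uminus: "f (- v) = - f v"
  using f_add[of v "- v"] by (simp add: eq_neg_iff_add_eq_0 add.commute)

lemma f_diff: "f (v - w) = f v - f w"
  using f_add[of v "- w"] by (simp add: f_uminus)

lemma f_sum: "f (sum g A) = (\<Sum>a\<in>A. f (g a))"
  by (induction A rule: infinite_finite_induct) (simp_all add: f_add)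

lemma f_signed: "f (signed i T v) = signed i T (f v)"
  by (simp add: signed_def f_uminus)

lemma f_koszul: "f (koszul X n z T) = koszul Y n (\<lambda>T. f (z T)) T"
  by (simp add: koszul_def f_sum f_signed f_X)

end

text \<open>An abstract minimal free cover of G by F. \<open>F_exact\<close> is what freeness
  contributes, the vanishing of higher Koszul homology, and \<open>ker_minimal\<close> says that the
  kernel lies in (x_1, ..., x_n) F.\<close>

locale koszul_cover =
  koszul_hom X Y f + F: koszul_graded X n F + G: koszul_graded Y n G
  for X :: "nat \<Rightarrow> 'v::ab_group_add \<Rightarrow> 'v" and Y :: "nat \<Rightarrow> 'w::ab_group_add \<Rightarrow> 'w" and f n F G +
  assumes f_onto: "f ` F e = G e"
    and F_exact: "koszul_exact X n F (Suc p) e"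
    and ker_minimal: "v \<in> F e \<Longrightarrow> f v = 0 \<Longrightarrow> \<exists>y\<in>kchains n 1 (F (e - 1)). koszul X n y {} = v"
begin

abbreviation ker :: "int \<Rightarrow> 'v set" where
  "ker e \<equiv> {v \<in> F e. f v = 0}"

lemma f_chains: "z \<in> kchains n p (F e) \<Longrightarrow> (\<lambda>T. f (z T)) \<in> kchains n p (G e)"
  using f_onto[of e] unfolding kchains_def by (auto split: if_splits)

lemma ker_chainsI: "z \<in> kchains n p (F e) \<Longrightarrow> (\<And>T. f (z T) = 0) \<Longrightarrow> z \<in> kchains n p (ker e)"
  unfolding kchains_def by (auto split: if_splits)

lemma ker_chainsD: "z \<in> kchains n p (ker e) \<Longrightarrow> z \<in> kchains n p (F e) \<and> f (z T) = 0"
  using chains_mono[of "ker e" "F e"] chains_mem[of z n p "ker e" T] by auto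

text \<open>The connecting isomorphism between the Koszul homology of the quotient and of the kernel.\<close>

lemma exact_ker:
  assumes "koszul_exact Y n G (Suc p) e"
  shows "koszul_exact X n ker p (e + 1)"
  unfolding koszul_exact_def
proof (intro ballI impI)
  fix z assume z: "z \<in> kchains n p (ker (e + 1))" and cyc: "\<forall>T. koszul X n z T = 0"
  have zF: "z \<in> kchains n p (F (e + 1))" using ker_chainsD z by blast
  \<comment> \<open>For p > 0 this is acyclicity of F. For p = 0, where F does have homology,
    minimality of the cover takes its place.\<close>
  have "\<exists>y\<in>kchains n (Suc p) (F e). koszul X n y = z"
  proof (cases p)
    case (Suc k)
    then show ?thesis using F_exact[of k "e + 1"] zF cyc by (auto simp: koszul_exact_def)
  next
    case 0
    have "z {} \<in> F (e + 1)" "f (z {}) = 0" using ker_chainsD[OF z, of "{}"] chains_mem[of z n p _ "{}"] by auto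
    then obtain y where y: "y \<in> kchains n 1 (F e)" "koszul X n y {} = z {}"
      using ker_minimal[of "z {}" "e + 1"] by auto
    have "koszul X n y T = z T" for T
    proof (cases "T = {}")
      case False
      then have no: "\<not> (T \<subseteq> {1..n} \<and> card T = 0)" using finite_subset[of T "{1..n}"] by auto
      then show ?thesis using X.koszul_outside[OF y(1), of T] chains_zeroD[OF z, of T] 0 by auto
    qed (use y in simp)
    then show ?thesis using y 0 by auto
  qed
  then obtain y where y: "y \<in> kchains n (Suc p) (F e)" "koszul X n y = z" by blast
  have "\<forall>T. koszul Y n (\<lambda>T. f (y T)) T = 0"
    using f_koszul[of n y] y(2) ker_chainsD[OF z] by simp
  then obtain w where w: "w \<in> kchains n (Suc (Suc p)) (G (e - 1))" "koszul Y n w = (\<lambda>T. f (y T))"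
    using assms f_chains[OF y(1)] unfolding koszul_exact_def by blast
  obtain u where u: "u \<in> kchains n (Suc (Suc p)) (F (e - 1))" "w = (\<lambda>T. f (u T))"
    using chains_lift[of w n "Suc (Suc p)" f "F (e - 1)"] w(1) f_onto by auto
  have ku: "koszul X n u \<in> kchains n (Suc p) (F e)" using F.koszul_chains[OF u(1)] by simp
  \<comment> \<open>Subtracting the boundary of the lift u moves y into the kernel without changing
    its own boundary z.\<close>
  let ?y = "\<lambda>T. y T - koszul X n u T"
  have "?y \<in> kchains n (Suc p) (ker e)"
  proof (rule ker_chainsI)
    show "?y \<in> kchains n (Suc p) (F e)" by (rule F.chains_diff[OF y(1) ku])
    show "f (?y T) = 0" for T using w(2) u(2) by (simp add: f_diff f_koszul)
  qed
  moreover have "koszul X n ?y = z"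
    using y(2) X.koszul_koszul[OF u(1)] by (simp add: X.koszul_diff)
  ultimately show "\<exists>y\<in>kchains n (Suc p) (ker (e + 1 - 1)). koszul X n y = z" by auto
qed

text \<open>The same diagram chase backwards: the boundary of a lift of z is a cycle in the kernel;
  filling it there corrects the lift to a cycle of F, which is a boundary by acyclicity.\<close>

lemma exact_quotient:
  assumes "koszul_exact X n ker p (e + 1)"
  shows "koszul_exact Y n G (Suc p) e"
  unfolding koszul_exact_def
proof (intro ballI impI)
  fix z assume z: "z \<in> kchains n (Suc p) (G e)" and cyc: "\<forall>T. koszul Y n z T = 0"
  obtain y where y: "y \<in> kchains n (Suc p) (F e)" "z = (\<lambda>T. f (y T))"
    using chains_lift[of z n "Suc p" f "F e"] z f_onto by auto
  have "koszul X n y \<in> kchains n p (ker (e + 1))"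
    using F.koszul_chains[OF y(1)] cyc y(2) by (intro ker_chainsI) (auto simp: f_koszul)
  then obtain y' where y': "y' \<in> kchains n (Suc p) (ker e)" "koszul X n y' = koszul X n y"
    using assms X.koszul_koszul[OF y(1)] unfolding koszul_exact_def by force
  let ?y = "\<lambda>T. y T - y' T"
  have "?y \<in> kchains n (Suc p) (F e)" using ker_chainsD[OF y'(1)] y(1) by (intro F.chains_diff) auto
  moreover have "\<forall>T. koszul X n ?y T = 0" using y'(2) by (simp add: X.koszul_diff)
  ultimately obtain w where w: "w \<in> kchains n (Suc (Suc p)) (F (e - 1))" "koszul X n w = ?y"
    using F_exact[of p e] unfolding koszul_exact_def by blast
  have "koszul Y n (\<lambda>T. f (w T)) = z"
    using w(2) ker_chainsD[OF y'(1)] y(2) by (auto simp: fun_eq_iff f_koszul[symmetric] f_diff)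
  then show "\<exists>y\<in>kchains n (Suc (Suc p)) (G (e - 1)). koszul Y n y = z"
    using f_chains[OF w(1)] by blast
qed

text \<open>As the kernel lies in (x_1, ..., x_n) F, the spaces of minimal generators of F and G
  agree, so the generator degrees of G can be read off from F.\<close>

lemma exact_0_iff:
  "koszul_exact Y n G 0 e \<longleftrightarrow> (\<forall>v\<in>F e. \<exists>y\<in>kchains n 1 (F (e - 1)). koszul X n y {} = v)"
  unfolding Y.koszul_exact_0_iff[OF G.G_0]
proof (intro iffI ballI)
  fix v assume ex: "\<forall>z\<in>G e. \<exists>y\<in>kchains n 1 (G (e - 1)). koszul Y n y {} = z" and v: "v \<in> F e"
  have "f v \<in> G e" using v f_onto by blast
  then obtain y where y: "y \<in> kchains n 1 (G (e - 1))" "koszul Y n y {} = f v" using ex by blast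
  obtain w where w: "w \<in> kchains n 1 (F (e - 1))" "y = (\<lambda>T. f (w T))"
    using chains_lift[of y n 1 f "F (e - 1)"] y(1) f_onto by auto
  have "koszul X n w \<in> kchains n 0 (F e)" using F.koszul_chains[of w 0 "e - 1"] w(1) by simp
  then have kw: "koszul X n w {} \<in> F e" by (rule chains_mem) simp
  have "f (v - koszul X n w {}) = 0" using y(2) w(2) by (simp add: f_diff f_koszul)
  then obtain y' where y': "y' \<in> kchains n 1 (F (e - 1))" "koszul X n y' {} = v - koszul X n w {}"
    using ker_minimal F.G_diff[OF v kw] by blast
  have "(\<lambda>T. w T + y' T) \<in> kchains n 1 (F (e - 1))"
    using w(1) y'(1) F.G_add unfolding kchains_def by (auto split: if_splits)
  moreover have "koszul X n (\<lambda>T. w T + y' T) {} = v" using y'(2) by (simp add: X.koszul_add)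
  ultimately show "\<exists>y\<in>kchains n 1 (F (e - 1)). koszul X n y {} = v" by blast
next
  fix z assume ex: "\<forall>v\<in>F e. \<exists>y\<in>kchains n 1 (F (e - 1)). koszul X n y {} = v" and "z \<in> G e"
  then obtain v where "v \<in> F e" "f v = z" using f_onto[of e] by (metis imageE)
  then obtain y where "y \<in> kchains n 1 (F (e - 1))" "koszul X n y {} = v" using ex by blast
  then show "\<exists>y\<in>kchains n 1 (G (e - 1)). koszul Y n y {} = z"
    using f_koszul[of n y "{}"] f_chains \<open>f v = z\<close> by auto
qed

text \<open>This is Tor_p(ker f) = Tor_(p+1)(G) in a fixed internal degree, since p + (e + 1) = (p +
  1) + e.\<close>

lemma exact_ker_iff: "koszul_exact X n ker p (e + 1) \<longleftrightarrow> koszul_exact Y n G (Suc p) e"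
  using exact_ker exact_quotient by blast

end


section \<open>Graded free modules\<close>

abbreviation ev :: "nat \<Rightarrow> expo" where
  "ev i \<equiv> Poly_Mapping.single i (Suc 0)"

lemma lookup_single_times:
  fixes p :: "'k::field mpoly"
  shows "lookup (Poly_Mapping.single a c * p) (a + b) = c * lookup p b"
proof -
  have "lookup (Poly_Mapping.single a c * p) (a + b)
      = Sum_any (\<lambda>l. (c when a = l) * Sum_any (\<lambda>q. lookup p q when a + b = l + q))"
    by (simp add: lookup_mult lookup_single)
  also have "\<dots> = Sum_any (\<lambda>l. c * Sum_any (\<lambda>q. lookup p q when a + b = l + q) when a = l)"
    by (simp add: when_mult)
  also have "\<dots> = c * lookup p b" by simp
  finally show ?thesis .
qed

lemma lookup_single_times_not:
  fixes p :: "'k::field mpoly"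
  assumes "\<And>b. v \<noteq> a + b"
  shows "lookup (Poly_Mapping.single a c * p) v = 0"
proof -
  have "lookup (Poly_Mapping.single a c * p) v
      = Sum_any (\<lambda>l. (c when a = l) * Sum_any (\<lambda>q. lookup p q when v = l + q))"
    by (simp add: lookup_mult lookup_single)
  also have "\<dots> = Sum_any (\<lambda>l. c * Sum_any (\<lambda>q. lookup p q when v = l + q) when a = l)"
    by (simp add: when_mult)
  also have "\<dots> = 0" using assms by simp
  finally show ?thesis .
qed

lemma expo_split: "0 < lookup v i \<Longrightarrow> ev i + (v - ev i) = v"
  by (rule poly_mapping_eqI) (auto simp: lookup_add lookup_minus lookup_single when_def)

lemma lookup_var_times:
  fixes p :: "'k::field mpoly"
  shows "lookup (monomial (ev i) * p) v = (if 0 < lookup v i then lookup p (v - ev i) else 0)"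
proof (cases "0 < lookup v i")
  case True
  then show ?thesis using lookup_single_times[of "ev i" 1 p "v - ev i"] expo_split[OF True]
    by (simp add: monomial_def)
next
  case False
  have "v \<noteq> ev i + b" for b using False by (auto simp: lookup_add)
  then show ?thesis using False lookup_single_times_not[of v "ev i" 1 p] by (simp add: monomial_def)
qed

lemma total_degree_eq:
  assumes "finite A" "keys m \<subseteq> A"
  shows "total_degree m = (\<Sum>i\<in>A. lookup m i)"
  unfolding total_degree_def using assms by (intro sum.mono_neutral_left) (auto simp: in_keys_iff)

lemma total_degree_add: "total_degree (a + b) = total_degree a + total_degree b"
proof -
  let ?A = "keys a \<union> keys b"
  have "total_degree (a + b) = (\<Sum>i\<in>?A. lookup (a + b) i)"
    using keys_add[of a b] by (intro total_degree_eq) auto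
  also have "\<dots> = (\<Sum>i\<in>?A. lookup a i) + (\<Sum>i\<in>?A. lookup b i)"
    by (simp add: lookup_add sum.distrib)
  finally show ?thesis using total_degree_eq[of ?A a] total_degree_eq[of ?A b] by simp
qed

lemma total_degree_ev [simp]: "total_degree (ev i) = 1"
  by (simp add: total_degree_def)

lemma total_degree_0 [simp]: "total_degree 0 = 0"
  by (simp add: total_degree_def)

lemma total_degree_eq_0_iff: "total_degree m = 0 \<longleftrightarrow> m = 0"
  by (auto simp: total_degree_def in_keys_iff intro: poly_mapping_eqI)

lemma expos_add: "a \<in> expos n \<Longrightarrow> b \<in> expos n \<Longrightarrow> a + b \<in> expos n"
  using keys_add[of a b] by (auto simp: expos_def)

lemma ev_expos: "i \<in> {1..n} \<Longrightarrow> ev i \<in> expos n"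
  by (simp add: expos_def)

definition poly_carrier :: "nat \<Rightarrow> 'k::field mpoly set" where
  "poly_carrier n = {p. keys p \<subseteq> expos n}"

lemma carrier_poly_ring: "carrier (poly_ring n) = poly_carrier n"
  by (simp add: poly_ring_def poly_carrier_def)

lemma poly_carrierI: "(\<And>m. lookup p m \<noteq> 0 \<Longrightarrow> m \<in> expos n) \<Longrightarrow> p \<in> poly_carrier n"
  by (auto simp: poly_carrier_def in_keys_iff)

lemma poly_carrierD: "p \<in> poly_carrier n \<Longrightarrow> m \<in> keys p \<Longrightarrow> m \<in> expos n"
  by (auto simp: poly_carrier_def)

lemma poly_carrier_mult: "p \<in> poly_carrier n \<Longrightarrow> q \<in> poly_carrier n \<Longrightarrow> p * q \<in> poly_carrier n"
  using keys_mult[of p q] unfolding poly_carrier_def by (fastforce intro: expos_add)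

section \<open>Homogeneous vectors of graded free modules\<close>

definition smul :: "'k::field mpoly \<Rightarrow> (nat \<Rightarrow> 'k mpoly) \<Rightarrow> nat \<Rightarrow> 'k mpoly" where
  "smul p v = (\<lambda>k. p * v k)"

abbreviation xv :: "nat \<Rightarrow> (nat \<Rightarrow> 'k::field mpoly) \<Rightarrow> nat \<Rightarrow> 'k mpoly" where
  "xv i \<equiv> smul (monomial (ev i))"

interpretation xv: koszul_ops "xv :: nat \<Rightarrow> (nat \<Rightarrow> 'k::field mpoly) \<Rightarrow> nat \<Rightarrow> 'k mpoly"
  by standard (simp_all add: smul_def fun_eq_iff distrib_left mult.left_commute)

definition homog :: "nat \<Rightarrow> nat \<Rightarrow> (nat \<Rightarrow> nat) \<Rightarrow> int \<Rightarrow> (nat \<Rightarrow> 'k::field mpoly) set" where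
  "homog n r sh e = {v \<in> free_module n r. \<forall>k<r. \<forall>m\<in>keys (v k). int (sh k + total_degree m) = e}"

lemma homogI:
  assumes "\<And>k m. k < r \<Longrightarrow> lookup (v k) m \<noteq> 0 \<Longrightarrow> m \<in> expos n \<and> int (sh k + total_degree m) = e"
    and "\<And>k. r \<le> k \<Longrightarrow> v k = 0"
  shows "v \<in> homog n r sh e"
  using assms by (fastforce simp: homog_def free_module_def carrier_poly_ring poly_carrier_def in_keys_iff)

lemma homogD:
  assumes "v \<in> homog n r sh e" "lookup (v k) m \<noteq> 0"
  shows "k < r" "m \<in> expos n" "int (sh k + total_degree m) = e"
proof -
  show k: "k < r" using assms by (cases "k < r") (auto simp: homog_def free_module_def)
  have "m \<in> keys (v k)" using assms(2) by (simp add: in_keys_iff)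
  then show "m \<in> expos n" "int (sh k + total_degree m) = e"
    using assms(1) k by (auto simp: homog_def free_module_def carrier_poly_ring poly_carrier_def)
qed

lemma homog_outside: "v \<in> homog n r sh e \<Longrightarrow> r \<le> k \<Longrightarrow> v k = 0"
  by (simp add: homog_def free_module_def)

lemma homog_xv:
  assumes "i \<in> {1..n}" "v \<in> homog n r sh e"
  shows "xv i v \<in> homog n r sh (e + 1)"
proof (rule homogI)
  fix k m assume "lookup (xv i v k) m \<noteq> 0"
  then have m: "0 < lookup m i" "lookup (v k) (m - ev i) \<noteq> 0"
    by (auto simp: smul_def lookup_var_times split: if_splits)
  note h = homogD[OF assms(2) m(2)]
  have "ev i + (m - ev i) = m" by (rule expo_split[OF m(1)])
  then show "m \<in> expos n \<and> int (sh k + total_degree m) = e + 1"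
    using h expos_add[OF ev_expos[OF assms(1)] h(2)] total_degree_add[of "ev i" "m - ev i"] by auto
qed (simp add: smul_def homog_outside[OF assms(2)])

lemma homog_add:
  assumes "v \<in> homog n r sh e" "w \<in> homog n r sh e"
  shows "v + w \<in> homog n r sh e"
proof (rule homogI)
  fix k m assume "lookup ((v + w) k) m \<noteq> 0"
  then have "lookup (v k) m \<noteq> 0 \<or> lookup (w k) m \<noteq> 0" by (auto simp: lookup_add)
  then show "m \<in> expos n \<and> int (sh k + total_degree m) = e"
    using homogD(2,3)[OF assms(1), of k m] homogD(2,3)[OF assms(2), of k m] by auto
qed (simp add: homog_outside[OF assms(1)] homog_outside[OF assms(2)])

lemma homog_uminus:
  assumes "v \<in> homog n r sh e"
  shows "- v \<in> homog n r sh e"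
proof (rule homogI)
  fix k m assume "lookup ((- v) k) m \<noteq> 0"
  then have "lookup (v k) m \<noteq> 0" by auto
  then show "m \<in> expos n \<and> int (sh k + total_degree m) = e"
    using homogD(2,3)[OF assms, of k m] by auto
qed (simp add: homog_outside[OF assms(1)])

lemma homog_0: "0 \<in> homog n r sh e"
  by (rule homogI) auto

interpretation homog: koszul_graded xv n "homog n r sh" for n r sh
  by standard (auto intro: homog_0 homog_add homog_uminus homog_xv)

lemma lookup_signed: "lookup (signed i T p) m = signed i T (lookup p m)"
  by (simp add: signed_def)

lemma signed_apply: "signed i T v k = signed i T (v k)"
  by (simp add: signed_def)

lemma sum_apply: "(\<Sum>i\<in>A. f i) k = (\<Sum>i\<in>A. f i k)"
  for f :: "'a \<Rightarrow> 'b \<Rightarrow> 'c::comm_monoid_add"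
  by (induction A rule: infinite_finite_induct) simp_all

section \<open>The contracting homotopy of the Koszul complex\<close>

lemma lookup_koszul:
  "lookup (koszul xv n z T k) m =
    (\<Sum>i\<in>{1..n} - T. signed i T (if 0 < lookup m i then lookup (z (insert i T) k) (m - ev i) else 0))"
  by (simp add: koszul_def sum_apply signed_apply lookup_sum lookup_signed smul_def lookup_var_times)

text \<open>Divides by x_i exactly those monomials of p whose last variable is x_i, and drops all
  others.\<close>

definition pdiv :: "nat \<Rightarrow> 'k::field mpoly \<Rightarrow> 'k mpoly" where
  "pdiv i p = Abs_poly_mapping (\<lambda>m. if keys m \<subseteq> {..i} then lookup p (m + ev i) else 0)"

lemma lookup_pdiv: "lookup (pdiv i p) m = (if keys m \<subseteq> {..i} then lookup p (m + ev i) else 0)"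
proof -
  have "finite ((\<lambda>m. m + ev i) -` keys p)" by (rule finite_vimageI) (auto simp: inj_on_def)
  then have "finite {m. (if keys m \<subseteq> {..i} then lookup p (m + ev i) else 0) \<noteq> 0}"
    by (rule finite_subset[rotated]) (auto simp: in_keys_iff)
  then show ?thesis by (simp add: pdiv_def)
qed

text \<open>The contracting homotopy of the Koszul complex: in the multidegree of \<open>x\<^sup>m e\<^sub>T\<close> it divides by
  the last variable occurring in \<open>x\<^sup>m\<close> or \<open>T\<close> and adds it to \<open>T\<close>.\<close>

definition contraction ::
    "nat \<Rightarrow> nat \<Rightarrow> (nat set \<Rightarrow> nat \<Rightarrow> 'k::field mpoly) \<Rightarrow> nat set \<Rightarrow> nat \<Rightarrow> 'k mpoly" where
  "contraction n p z T = (if T \<subseteq> {1..n} \<and> card T = Suc p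
     then (\<lambda>k. pdiv (Max T) (z (T - {Max T}) k)) else 0)"

text \<open>Let M be the last index in the multidegree of x^m e_T. If M is not in T, only the
  summand of M survives in the boundary and returns the coefficient of z. If M is in T, the
  remaining summands are those of the cycle condition at T without M, which gives the coefficient as
  well. The excluded case T = {}, m = 0 is the one where M does not exist.\<close>

lemma lookup_koszul_contraction:
  fixes z :: "nat set \<Rightarrow> nat \<Rightarrow> 'k::field mpoly"
  assumes T: "T \<subseteq> {1..n}" "card T = p" and m: "m \<in> expos n" and ne: "T \<noteq> {} \<or> m \<noteq> 0"
    and cyc: "\<And>T. koszul xv n z T = 0"
  shows "lookup (koszul xv n (contraction n p z) T k) m = lookup (z T k) m"
proof -
  have fin: "finite T" using T(1) finite_subset by blast
  let ?t = "\<lambda>i. if 0 < lookup m i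
    then lookup (pdiv (Max (insert i T)) (z (insert i T - {Max (insert i T)}) k)) (m - ev i) else 0"
  let ?S = "keys m \<union> T"
  define M where "M = Max ?S"
  have S: "finite ?S" "?S \<noteq> {}" using fin ne by auto
  have M_in: "M \<in> ?S" unfolding M_def using Max_in[OF S] .
  have M_ge: "x \<le> M" if "x \<in> ?S" for x unfolding M_def using Max_ge[OF S(1) that] .
  have M_n: "M \<in> {1..n}" using M_in T m by (auto simp: expos_def)
  have keys_sub: "keys (m - ev i) \<subseteq> keys m" for i
    by (auto simp: in_keys_iff lookup_minus)
  have contr: "contraction n p z (insert i T) = (\<lambda>k. pdiv (Max (insert i T)) (z (insert i T - {Max (insert i T)}) k))"
    if "i \<in> {1..n} - T" for i
    using that T fin by (auto simp: contraction_def)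
  have L: "lookup (koszul xv n (contraction n p z) T k) m =
    (\<Sum>i\<in>{1..n} - T. signed i T (?t i))"
    unfolding lookup_koszul by (intro sum.cong refl) (simp add: contr)
  show ?thesis
  proof (cases "M \<in> T")
    case False
    then have Mk: "M \<in> keys m" using M_in by simp
    have MT: "Max (insert M T) = M" using fin M_ge by (intro Max_eqI) auto
    have "(\<Sum>i\<in>{1..n} - T. signed i T (?t i))
      = (\<Sum>i\<in>{1..n} - T. if i = M then lookup (z T k) m else 0)"
    proof (rule sum.cong[OF refl])
      fix i assume i: "i \<in> {1..n} - T"
      show "signed i T (?t i)
        = (if i = M then lookup (z T k) m else 0)"
      proof (cases "i = M")
        case True
        have pos: "0 < lookup m M" using Mk by (simp add: in_keys_iff)
        have "insert M T - {M} = T" using False by auto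
        moreover have "keys (m - ev M) \<subseteq> {..M}" using keys_sub[of M] M_ge by auto
        moreover have "m - ev M + ev M = m" using expo_split[OF pos] by (simp add: add.commute)
        ultimately show ?thesis
          unfolding True MT using pos M_ge by (simp add: lookup_pdiv signed_top)
      next
        case iM: False
        \<comment> \<open>After division by x_i the monomial still contains x_M, which lies beyond
          \<open>Max (insert i T)\<close>; \<open>pdiv\<close> discards such monomials.\<close>
        have "lookup (pdiv (Max (insert i T)) q) (m - ev i) = 0" if "0 < lookup m i" for q :: "'k mpoly"
        proof -
          have "i \<in> keys m" using that by (simp add: in_keys_iff)
          then have "Max (insert i T) \<in> insert i T - {M}" using Max_in[of "insert i T"] fin iM False by auto
          then have "Max (insert i T) < M" using M_ge \<open>i \<in> keys m\<close> by (auto simp: less_le)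
          moreover have "M \<in> keys (m - ev i)" using Mk iM by (simp add: in_keys_iff lookup_minus lookup_single)
          ultimately show ?thesis by (auto simp: lookup_pdiv)
        qed
        then show ?thesis using iM by simp
      qed
    qed
    also have "\<dots> = lookup (z T k) m" using M_n False by simp
    finally show ?thesis using L by simp
  next
    case True
    let ?T = "T - {M}" and ?m = "m + ev M"
    have T_eq: "insert M ?T = T" using True by auto
    have C: "{1..n} - ?T = insert M ({1..n} - T)" using M_n True by auto
    \<comment> \<open>The cycle condition in the same multidegree, with x_M shifted from T into the
      monomial, is solved for the coefficient of z at T.\<close>
    have "0 = lookup (koszul xv n z ?T k) ?m" by (simp add: cyc)
    also have "\<dots> = signed M ?T (lookup (z T k) m) + (\<Sum>i\<in>{1..n} - T. signed i ?T
        (if 0 < lookup ?m i then lookup (z (insert i ?T) k) (?m - ev i) else 0))"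
      unfolding lookup_koszul C using True by (simp add: insert_absorb[OF True] lookup_add)
    also have "signed M ?T (lookup (z T k) m) = lookup (z T k) m"
      using M_ge by (intro signed_top) auto
    also have "(\<Sum>i\<in>{1..n} - T. signed i ?T
        (if 0 < lookup ?m i then lookup (z (insert i ?T) k) (?m - ev i) else 0))
      = (\<Sum>i\<in>{1..n} - T. - signed i T (?t i))"
    proof (rule sum.cong[OF refl])
      fix i assume i: "i \<in> {1..n} - T"
      then have iM: "i \<noteq> M" using True by auto
      then have lk: "lookup ?m i = lookup m i" by (simp add: lookup_add lookup_single)
      show "signed i ?T (if 0 < lookup ?m i then lookup (z (insert i ?T) k) (?m - ev i) else 0)
        = - signed i T (?t i)"
      proof (cases "0 < lookup m i")
        case pos: True
        then have "i \<in> keys m" by (simp add: in_keys_iff)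
        then have "i < M" using M_ge iM by (auto simp: less_le)
        have MT: "Max (insert i T) = M" using fin True \<open>i < M\<close> M_ge by (intro Max_eqI) auto
        have "insert i T - {M} = insert i ?T" using iM by auto
        moreover have "keys (m - ev i) \<subseteq> {..M}" using keys_sub[of i] M_ge by auto
        moreover have "m - ev i + ev M = ?m - ev i"
          using pos iM by (intro poly_mapping_eqI) (auto simp: lookup_add lookup_minus lookup_single when_def)
        moreover have "signed i T x = - signed i ?T x" for x :: 'k
          using signed_insert_less[of ?T M i x] fin \<open>i < M\<close> unfolding T_eq by simp
        ultimately show ?thesis unfolding lk MT using pos by (simp add: lookup_pdiv)
      qed (unfold lk, simp)
    qed
    finally show ?thesis using L by (simp add: sum_negf)
  qed
qed

definition homog_in :: "nat \<Rightarrow> nat \<Rightarrow> (nat \<Rightarrow> nat) \<Rightarrow> (nat \<Rightarrow> expo set) \<Rightarrow> int \<Rightarrow> (nat \<Rightarrow> 'k::field mpoly) set" where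
  "homog_in n r sh Q e = {v \<in> homog n r sh e. \<forall>k<r. keys (v k) \<subseteq> Q k}"

text \<open>The contraction divides a monomial of degree e by its last variable, so it respects
  \<open>Q\<close> once \<open>Q\<close> is stable under this division in that one degree.
  \<open>Q0\<close> keeps away from the case T = {}, m = 0, where the contraction fails.\<close>

lemma homog_in_exact:
  assumes Q: "\<And>k m. k < r \<Longrightarrow> m \<in> Q k \<Longrightarrow> m \<in> expos n \<Longrightarrow> int (sh k + total_degree m) = e \<Longrightarrow> m \<noteq> 0
      \<Longrightarrow> m - ev (Max (keys m)) \<in> Q k"
    and Q0: "0 < p \<or> (\<forall>k<r. 0 \<in> Q k \<longrightarrow> int (sh k) \<noteq> e)"
  shows "koszul_exact xv n (homog_in n r sh Q :: int \<Rightarrow> (nat \<Rightarrow> 'k::field mpoly) set) p e"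
  unfolding koszul_exact_def
proof (intro ballI impI)
  fix z :: "nat set \<Rightarrow> nat \<Rightarrow> 'k mpoly"
  assume z: "z \<in> kchains n p (homog_in n r sh Q e)" and cyc: "\<forall>T. koszul xv n z T = 0"
  have zh: "z \<in> kchains n p (homog n r sh e)"
    using z chains_mono[of "homog_in n r sh Q e" "homog n r sh e" n p] by (auto simp: homog_in_def)
  have zQ: "m \<in> Q k" if "lookup (z T k) m \<noteq> 0" for T k m
  proof -
    have "z T \<in> homog n r sh e" by (rule chains_mem[OF zh homog_0])
    then have "k < r" using homogD(1) that by blast
    moreover have "z T \<in> homog_in n r sh Q e"
      by (rule chains_mem[OF z]) (simp add: homog_in_def homog_0)
    moreover have "m \<in> keys (z T k)" using that by (simp add: in_keys_iff)
    ultimately show ?thesis by (auto simp: homog_in_def)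
  qed
  let ?y = "contraction n p z"
  have y: "?y T \<in> homog_in n r sh Q (e - 1)" if T: "T \<subseteq> {1..n}" "card T = Suc p" for T
  proof -
    let ?M = "Max T" let ?z = "z (T - {?M})"
    have fin: "finite T" "T \<noteq> {}" using T finite_subset by auto
    then have "?M \<in> T" by (rule Max_in)
    then have M: "?M \<in> {1..n}" using T(1) by blast
    have zh': "?z \<in> homog n r sh e" by (rule chains_mem[OF zh homog_0])
    have *: "k < r \<and> m \<in> expos n \<and> m \<in> Q k \<and> int (sh k + total_degree m) = e - 1"
      if "lookup (?y T k) m \<noteq> 0" for k m
    proof -
      have m: "keys m \<subseteq> {..?M}" "lookup (?z k) (m + ev ?M) \<noteq> 0"
        using that T by (auto simp: contraction_def lookup_pdiv split: if_splits)
      note h = homogD[OF zh' m(2)]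
      have "keys (m + ev ?M) = insert ?M (keys m)" by (auto simp: in_keys_iff lookup_add lookup_single when_def split: if_splits)
      then have "Max (keys (m + ev ?M)) = ?M" using m(1) by (simp only:) (intro Max_eqI, auto)
      moreover have "m + ev ?M \<noteq> 0"
      proof
        assume "m + ev ?M = 0"
        then have "lookup (m + ev ?M) ?M = 0" by simp
        then show False by (simp add: lookup_add)
      qed
      ultimately have "m \<in> Q k" using Q[OF h(1) zQ[OF m(2)] h(2,3)] by simp
      moreover have "keys m \<subseteq> keys (m + ev ?M)" by (auto simp: in_keys_iff lookup_add)
      ultimately show ?thesis using h by (auto simp: expos_def total_degree_add)
    qed
    have "?y T \<in> homog n r sh (e - 1)"
    proof (rule homogI)
      fix k assume "r \<le> k"
      then have "?z k = 0" by (rule homog_outside[OF zh'])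
      then show "?y T k = 0" using T by (intro poly_mapping_eqI) (simp add: contraction_def lookup_pdiv)
    qed (use * in auto)
    then show ?thesis using * by (auto simp: homog_in_def in_keys_iff)
  qed
  have yc: "?y \<in> kchains n (Suc p) (homog_in n r sh Q (e - 1))"
  proof (rule chainsI)
    fix T assume "\<not> (T \<subseteq> {1..n} \<and> card T = Suc p)"
    then show "?y T = 0" unfolding contraction_def by (simp only: if_False)
  qed (rule y)
  then have yh: "?y \<in> kchains n (Suc p) (homog n r sh (e - 1))"
    using chains_mono[of "homog_in n r sh Q (e - 1)" "homog n r sh (e - 1)" n "Suc p"] by (auto simp: homog_in_def)
  have ky: "koszul xv n ?y \<in> kchains n p (homog n r sh e)" using homog.koszul_chains[OF yh] by simp
  have "koszul xv n ?y T k = z T k" for T k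
  proof (cases "T \<subseteq> {1..n} \<and> card T = p")
    case True
    show ?thesis
    proof (rule poly_mapping_eqI)
      fix m
      show "lookup (koszul xv n ?y T k) m = lookup (z T k) m"
      proof (cases "m \<in> expos n")
        case m: True
        show ?thesis
        proof (cases "T \<noteq> {} \<or> m \<noteq> 0")
          case ne: True
          show ?thesis by (rule lookup_koszul_contraction[OF _ _ m ne]) (use True cyc in auto)
        next
          case False
          then have "p = 0" using True by simp
          have "lookup (z T k) m = 0"
          proof (rule ccontr)
            assume nz: "lookup (z T k) m \<noteq> 0"
            note h = homogD[OF chains_mem[OF zh homog_0] nz]
            show False using Q0 \<open>p = 0\<close> h zQ[OF nz] False by auto
          qed
          then show ?thesis using False by (simp add: lookup_koszul)
        qed
      next
        case False
        then show ?thesis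
          using homogD(2)[OF chains_mem[OF zh homog_0]] homogD(2)[OF chains_mem[OF ky homog_0]] by metis
      qed
    qed
  next
    case False
    then show ?thesis using chains_zeroD[OF zh False] chains_zeroD[OF ky False] by simp
  qed
  then have "koszul xv n ?y = z" by (simp add: fun_eq_iff)
  then show "\<exists>y\<in>kchains n (Suc p) (homog_in n r sh Q (e - 1)). koszul xv n y = z" using yc by blast
qed

lemma homog_exact:
  "koszul_exact xv n (homog n r sh :: int \<Rightarrow> (nat \<Rightarrow> 'k::field mpoly) set) (Suc p) e"
proof -
  have "homog_in n r sh (\<lambda>_. UNIV) = (homog n r sh :: int \<Rightarrow> (nat \<Rightarrow> 'k mpoly) set)"
    by (simp add: homog_in_def fun_eq_iff)
  moreover have "koszul_exact xv n (homog_in n r sh (\<lambda>_. UNIV) :: int \<Rightarrow> (nat \<Rightarrow> 'k mpoly) set) (Suc p) e"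
    by (rule homog_in_exact) auto
  ultimately show ?thesis by (simp only:)
qed

lemma homog_maximal_ideal:
  assumes v: "v \<in> homog n r sh e" and v0: "\<And>k. k < r \<Longrightarrow> lookup (v k) 0 = 0"
  shows "\<exists>y\<in>kchains n 1 (homog n r sh (e - 1)). koszul xv n y {} = v"
proof -
  \<comment> \<open>Emptying the components whose basis element has degree e removes exactly the
    constants of degree e. As v has no constant terms, it survives, and exactness at p = 0 becomes
    available.\<close>
  define Q where "Q k = (if int (sh k) = e then {} else UNIV :: expo set)" for k
  define z where "z T = (if T = {} then v else 0)" for T :: "nat set"
  have "keys (v k) \<subseteq> Q k" if "k < r" for k
  proof (rule subsetI, rule ccontr)
    fix m assume m: "m \<in> keys (v k)" "m \<notin> Q k"
    then have "int (sh k) = e" by (auto simp: Q_def split: if_splits)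
    then have "total_degree m = 0" using homogD(3)[OF v, of k m] m by (auto simp: in_keys_iff)
    then show False using m v0[OF that] by (auto simp: total_degree_eq_0_iff in_keys_iff)
  qed
  then have "z \<in> kchains n 0 (homog_in n r sh Q e)"
    using v finite_subset[of _ "{1..n}"] by (intro chainsI) (auto simp: z_def homog_in_def)
  moreover have "koszul xv n z T = 0" for T
    by (simp add: koszul_def z_def)
  moreover have "koszul_exact xv n (homog_in n r sh Q :: int \<Rightarrow> (nat \<Rightarrow> 'a mpoly) set) 0 e"
    by (rule homog_in_exact) (auto simp: Q_def split: if_splits)
  ultimately obtain y where y: "y \<in> kchains n 1 (homog_in n r sh Q (e - 1))" "koszul xv n y = z"
    unfolding koszul_exact_def by auto
  have "y \<in> kchains n 1 (homog n r sh (e - 1))"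
    using y(1) chains_mono[of "homog_in n r sh Q (e - 1)" "homog n r sh (e - 1)" n 1] by (auto simp: homog_in_def)
  moreover have "koszul xv n y {} = v" using y(2) by (simp add: z_def)
  ultimately show ?thesis by blast
qed

section \<open>Homogeneous components and graded submodules\<close>

lemma smul_apply: "smul p v k = p * v k"
  by (simp add: smul_def)

lemma smul_0 [simp]: "smul p 0 = 0"
  by (simp add: smul_def fun_eq_iff)

lemma poly_carrier_0: "0 \<in> poly_carrier n"
  by (simp add: poly_carrier_def)

lemma poly_carrier_add: "p \<in> poly_carrier n \<Longrightarrow> q \<in> poly_carrier n \<Longrightarrow> p + q \<in> poly_carrier n"
  using keys_add[of p q] by (auto simp: poly_carrier_def)

lemma poly_carrier_uminus: "p \<in> poly_carrier n \<Longrightarrow> - p \<in> poly_carrier n"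
  by (auto simp: poly_carrier_def subset_iff in_keys_iff)

lemma poly_carrier_sum: "(\<And>i. i \<in> A \<Longrightarrow> f i \<in> poly_carrier n) \<Longrightarrow> sum f A \<in> poly_carrier n"
  by (induction A rule: infinite_finite_induct) (auto intro: poly_carrier_add poly_carrier_0)

lemma poly_carrier_single: "m \<in> expos n \<Longrightarrow> Poly_Mapping.single m c \<in> poly_carrier n"
  by (auto simp: poly_carrier_def)

lemma zero_expos: "0 \<in> expos n"
  by (simp add: expos_def)

lemma free_moduleI:
  "(\<And>k. k < r \<Longrightarrow> v k \<in> poly_carrier n) \<Longrightarrow> (\<And>k. r \<le> k \<Longrightarrow> v k = 0) \<Longrightarrow> v \<in> free_module n r"
  by (simp add: free_module_def carrier_poly_ring)

lemma free_moduleD: "v \<in> free_module n r \<Longrightarrow> v k \<in> poly_carrier n"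
  by (cases "k < r") (auto simp: free_module_def carrier_poly_ring poly_carrier_0)

lemma free_module_outside: "v \<in> free_module n r \<Longrightarrow> r \<le> k \<Longrightarrow> v k = 0"
  by (simp add: free_module_def)

lemma free_module_0: "0 \<in> free_module n r"
  by (rule free_moduleI) (auto simp: poly_carrier_0)

lemma free_module_add: "v \<in> free_module n r \<Longrightarrow> w \<in> free_module n r \<Longrightarrow> v + w \<in> free_module n r"
  by (rule free_moduleI) (auto intro: poly_carrier_add free_moduleD simp: free_module_outside)

lemma free_module_smul: "p \<in> poly_carrier n \<Longrightarrow> v \<in> free_module n r \<Longrightarrow> smul p v \<in> free_module n r"
  by (rule free_moduleI) (auto intro: poly_carrier_mult free_moduleD simp: free_module_outside smul_apply)

lemma homog_free_module: "v \<in> homog n r sh e \<Longrightarrow> v \<in> free_module n r"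
  by (simp add: homog_def)

definition restrict_poly :: "expo set \<Rightarrow> 'k::field mpoly \<Rightarrow> 'k mpoly" where
  "restrict_poly S p = Abs_poly_mapping (\<lambda>m. lookup p m when m \<in> S)"

lemma lookup_restrict_poly: "lookup (restrict_poly S p) m = (lookup p m when m \<in> S)"
proof -
  have "finite {m. (lookup p m when m \<in> S) \<noteq> 0}"
    by (rule finite_subset[of _ "keys p"]) (auto simp: in_keys_iff)
  then show ?thesis by (simp add: restrict_poly_def)
qed

definition hcomp :: "(nat \<Rightarrow> nat) \<Rightarrow> int \<Rightarrow> (nat \<Rightarrow> 'k::field mpoly) \<Rightarrow> nat \<Rightarrow> 'k mpoly" where
  "hcomp sh e v = (\<lambda>k. restrict_poly {m. int (sh k + total_degree m) = e} (v k))"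

lemma lookup_hcomp: "lookup (hcomp sh e v k) m = (lookup (v k) m when int (sh k + total_degree m) = e)"
  by (simp add: hcomp_def lookup_restrict_poly)

lemma hcomp_homog:
  assumes "v \<in> free_module n r"
  shows "hcomp sh e v \<in> homog n r sh e"
proof (rule homogI)
  fix k m assume "lookup (hcomp sh e v k) m \<noteq> 0"
  then have "m \<in> keys (v k)" "int (sh k + total_degree m) = e"
    by (auto simp: lookup_hcomp in_keys_iff when_def split: if_splits)
  then show "m \<in> expos n \<and> int (sh k + total_degree m) = e"
    using poly_carrierD[OF free_moduleD[OF assms, of k]] by auto
next
  fix k assume "r \<le> k"
  then show "hcomp sh e v k = 0" using free_module_outside[OF assms]
    by (intro poly_mapping_eqI) (simp add: lookup_hcomp)
qed

lemma hcomp_add: "hcomp sh e (v + w) = hcomp sh e v + hcomp sh e w"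
  by (intro ext poly_mapping_eqI) (simp add: lookup_hcomp lookup_add when_add_distrib)

lemma hcomp_0 [simp]: "hcomp sh e 0 = 0"
  by (intro ext poly_mapping_eqI) (simp add: lookup_hcomp)

lemma hcomp_sum: "hcomp sh e (sum f A) = (\<Sum>a\<in>A. hcomp sh e (f a))"
proof (induction A rule: infinite_finite_induct)
  case (insert x B)
  show ?case unfolding sum.insert[OF insert.hyps] hcomp_add insert.IH ..
qed (simp_all only: sum.infinite sum.empty hcomp_0 not_False_eq_True simp_thms)

lemma hcomp_of_homog:
  assumes "v \<in> homog n r sh e"
  shows "hcomp sh e' v = (if e' = e then v else 0)"
proof (intro ext poly_mapping_eqI)
  fix k m
  show "lookup (hcomp sh e' v k) m = lookup ((if e' = e then v else 0) k) m"
    using homogD(3)[OF assms, of k m] by (cases "lookup (v k) m = 0") (auto simp: lookup_hcomp)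
qed

lemma hcomp_decompose:
  assumes "v \<in> free_module n r"
  obtains E where "finite E" "v = (\<Sum>e\<in>E. hcomp sh e v)"
proof -
  define E where "E = (\<Union>k\<in>{..<r}. (\<lambda>m. int (sh k + total_degree m)) ` keys (v k))"
  have fin: "finite E" by (simp add: E_def)
  have "v = (\<Sum>e\<in>E. hcomp sh e v)"
  proof (intro ext poly_mapping_eqI)
    fix k m
    have "lookup ((\<Sum>e\<in>E. hcomp sh e v) k) m
        = (\<Sum>e\<in>E. if e = int (sh k + total_degree m) then lookup (v k) m else 0)"
      by (auto simp: sum_apply lookup_sum lookup_hcomp when_def intro!: sum.cong)
    also have "\<dots> = (if int (sh k + total_degree m) \<in> E then lookup (v k) m else 0)"
      using fin by simp
    also have "\<dots> = lookup (v k) m"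
    proof (cases "lookup (v k) m = 0")
      case False
      then have "k < r" using free_module_outside[OF assms, of k] by (cases "k < r") auto
      moreover have "m \<in> keys (v k)" using False by (simp add: in_keys_iff)
      ultimately have "int (sh k + total_degree m) \<in> E" by (auto simp: E_def)
      then show ?thesis by simp
    qed simp
    finally show "lookup (v k) m = lookup ((\<Sum>e\<in>E. hcomp sh e v) k) m" by simp
  qed
  then show ?thesis using that fin by blast
qed

definition graded_submodule :: "nat \<Rightarrow> nat \<Rightarrow> (nat \<Rightarrow> nat) \<Rightarrow> (nat \<Rightarrow> 'k::field mpoly) set \<Rightarrow> bool" where
  "graded_submodule n r sh Z \<longleftrightarrow> Z \<subseteq> free_module n r \<and> 0 \<in> Z \<and>
     (\<forall>v\<in>Z. \<forall>w\<in>Z. v + w \<in> Z) \<and> (\<forall>p\<in>poly_carrier n. \<forall>v\<in>Z. smul p v \<in> Z) \<and>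
     (\<forall>v\<in>Z. \<forall>e. hcomp sh e v \<in> Z)"

context
  fixes n r :: nat and sh :: "nat \<Rightarrow> nat" and Z :: "(nat \<Rightarrow> 'k::field mpoly) set"
  assumes Z: "graded_submodule n r sh Z"
begin

lemma gs_free: "v \<in> Z \<Longrightarrow> v \<in> free_module n r"
  and gs_0: "0 \<in> Z"
  and gs_add: "v \<in> Z \<Longrightarrow> w \<in> Z \<Longrightarrow> v + w \<in> Z"
  and gs_smul: "p \<in> poly_carrier n \<Longrightarrow> v \<in> Z \<Longrightarrow> smul p v \<in> Z"
  and gs_hcomp: "v \<in> Z \<Longrightarrow> hcomp sh e v \<in> Z"
  using Z by (auto simp: graded_submodule_def)

lemma gs_uminus: "v \<in> Z \<Longrightarrow> - v \<in> Z"
proof -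
  assume "v \<in> Z"
  have "(- 1 :: 'k mpoly) \<in> poly_carrier n" 
    by (intro poly_carrier_uminus poly_carrierI) (auto simp: lookup_one zero_expos when_def split: if_splits)
  moreover have "smul (- 1) v = - v" by (simp add: smul_def fun_eq_iff)
  ultimately show ?thesis using gs_smul \<open>v \<in> Z\<close> by metis
qed

lemma gs_sum: "(\<And>i. i \<in> A \<Longrightarrow> f i \<in> Z) \<Longrightarrow> sum f A \<in> Z"
  by (induction A rule: infinite_finite_induct) (auto intro: gs_0 gs_add)

lemma gs_xv:
  assumes "i \<in> {1..n}" "v \<in> Z"
  shows "xv i v \<in> Z"
  using gs_smul[OF poly_carrier_single[OF ev_expos[OF assms(1)]] assms(2)] by (simp add: monomial_def)

lemma gs_koszul_graded: "koszul_graded xv n (\<lambda>e. Z \<inter> homog n r sh e)"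
  by standard (auto intro: gs_0 gs_add gs_uminus gs_xv homog_0 homog_add homog_uminus homog_xv)

end

section \<open>Homogeneous matrices as minimal covers\<close>

definition hmatrix :: "nat \<Rightarrow> nat \<Rightarrow> (nat \<Rightarrow> nat) \<Rightarrow> nat \<Rightarrow> (nat \<Rightarrow> nat) \<Rightarrow> (nat \<Rightarrow> nat \<Rightarrow> 'k::field mpoly) \<Rightarrow> bool" where
  "hmatrix n r sh c sh' A \<longleftrightarrow> (\<forall>k<r. \<forall>l<c. A k l \<in> poly_carrier n \<and>
     (\<forall>m\<in>keys (A k l). sh k + total_degree m = sh' l))"

interpretation mat: koszul_hom xv xv "mat_apply r c A" for r c A
  by standard (simp_all add: mat_apply_def smul_def fun_eq_iff sum.distrib distrib_left
      sum_distrib_left mult.left_commute)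

lemma mat_apply_smul: "mat_apply r c A (smul p v) = smul p (mat_apply r c A v)"
  by (simp add: mat_apply_def smul_def fun_eq_iff sum_distrib_left mult.left_commute)

definition unit_vec :: "nat \<Rightarrow> nat \<Rightarrow> 'k::field mpoly" where
  "unit_vec l = (\<lambda>k. if k = l then 1 else 0)"

lemma unit_vec_homog: "l < c \<Longrightarrow> unit_vec l \<in> homog n c sh (int (sh l))"
  by (rule homogI) (auto simp: unit_vec_def lookup_one zero_expos when_def split: if_splits)

lemma mat_apply_unit_vec: "l < c \<Longrightarrow> mat_apply r c A (unit_vec l) = (\<lambda>k. if k < r then A k l else 0)"
  by (simp add: mat_apply_def unit_vec_def fun_eq_iff if_distrib cong: if_cong)

lemma lookup_mult_0:
  fixes p q :: "'k::field mpoly"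
  assumes "lookup p 0 = 0"
  shows "lookup (p * q) 0 = 0"
proof (rule ccontr)
  assume "lookup (p * q) 0 \<noteq> 0"
  then have "0 \<in> keys (p * q)" by (simp add: in_keys_iff)
  then obtain a b where ab: "a \<in> keys p" "0 = a + b" using keys_mult[of p q] by blast
  have "lookup a i = 0" for i
  proof -
    have "lookup a i + lookup b i = lookup (a + b) i" by (simp add: lookup_add)
    then show ?thesis using ab(2) by simp
  qed
  then have "a = 0" by (intro poly_mapping_eqI) simp
  then show False using ab(1) assms by (simp add: in_keys_iff)
qed

context
  fixes n r :: nat and sh :: "nat \<Rightarrow> nat" and c :: nat and sh' :: "nat \<Rightarrow> nat"
    and A :: "nat \<Rightarrow> nat \<Rightarrow> 'k::field mpoly"
  assumes A: "hmatrix n r sh c sh' A"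
begin

abbreviation (input) "mapA \<equiv> mat_apply r c A"

lemma mat_free: "v \<in> free_module n c \<Longrightarrow> mapA v \<in> free_module n r"
proof (rule free_moduleI)
  fix k assume v: "v \<in> free_module n c" and "k < r"
  then show "mapA v k \<in> poly_carrier n"
    using A free_moduleD[OF v]
    by (auto simp: mat_apply_def hmatrix_def intro!: poly_carrier_sum poly_carrier_mult)
qed (simp add: mat_apply_def)

lemma mat_homog:
  assumes v: "v \<in> homog n c sh' e"
  shows "mapA v \<in> homog n r sh e"
proof (rule homogI)
  fix k m assume k: "k < r" and nz: "lookup (mapA v k) m \<noteq> 0"
  then have "(\<Sum>l<c. lookup (A k l * v l) m) \<noteq> 0" by (simp add: mat_apply_def lookup_sum)
  then obtain l where l: "l < c" "lookup (A k l * v l) m \<noteq> 0"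
    by (auto elim: sum.not_neutral_contains_not_neutral)
  then have "m \<in> keys (A k l * v l)" by (simp add: in_keys_iff)
  then obtain a b where ab: "m = a + b" "a \<in> keys (A k l)" "b \<in> keys (v l)"
    using keys_mult[of "A k l" "v l"] by blast
  have "sh k + total_degree a = sh' l" "a \<in> expos n"
    using A k l(1) ab(2) by (auto simp: hmatrix_def dest: poly_carrierD)
  moreover have "b \<in> expos n" "int (sh' l + total_degree b) = e"
    using homogD[OF v, of l b] ab(3) by (auto simp: in_keys_iff)
  ultimately show "m \<in> expos n \<and> int (sh k + total_degree m) = e"
    using ab(1) by (auto simp: total_degree_add expos_add)
qed (simp add: mat_apply_def)

lemma mat_hcomp:
  assumes v: "v \<in> free_module n c"
  shows "mapA (hcomp sh' e v) = hcomp sh e (mapA v)"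
proof -
  obtain E where E: "finite E" "v = (\<Sum>e\<in>E. hcomp sh' e v)" using hcomp_decompose[OF v] .
  have "hcomp sh e (mapA v) = hcomp sh e (\<Sum>e'\<in>E. mapA (hcomp sh' e' v))"
    by (rule arg_cong[OF trans[OF arg_cong[OF E(2), of mapA] mat.f_sum]])
  also have "\<dots> = (\<Sum>e'\<in>E. if e = e' then mapA (hcomp sh' e' v) else 0)"
    unfolding hcomp_sum by (intro sum.cong refl hcomp_of_homog[OF mat_homog[OF hcomp_homog[OF v]]])
  also have "\<dots> = (\<Sum>e'\<in>E. mapA (if e = e' then hcomp sh' e' v else 0))"
    by (intro sum.cong refl) auto
  also have "\<dots> = mapA (\<Sum>e'\<in>E. if e = e' then hcomp sh' e' v else 0)"
    by (simp add: mat.f_sum)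
  also have "(\<Sum>e'\<in>E. if e = e' then hcomp sh' e' v else 0) = (\<Sum>e'\<in>E. hcomp sh' e (hcomp sh' e' v))"
    by (intro sum.cong refl hcomp_of_homog[OF hcomp_homog[OF v], symmetric])
  also have "\<dots> = hcomp sh' e v"
    by (rule trans[OF arg_cong[OF E(2), of "hcomp sh' e"] hcomp_sum, symmetric])
  finally show ?thesis by simp
qed

lemma mat_image_gs: "graded_submodule n r sh (mapA ` free_module n c)"
  unfolding graded_submodule_def
proof (intro conjI ballI allI)
  show "mapA ` free_module n c \<subseteq> free_module n r" using mat_free by blast
  show "0 \<in> mapA ` free_module n c" by (rule image_eqI[OF _ free_module_0]) simp
  fix v assume "v \<in> mapA ` free_module n c"
  then obtain x where x: "x \<in> free_module n c" "v = mapA x" by blast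
  show "v + w \<in> mapA ` free_module n c" if w: "w \<in> mapA ` free_module n c" for w
  proof -
    obtain y where "y \<in> free_module n c" "w = mapA y" using w by blast
    then show ?thesis using x by (intro image_eqI[of _ _ "x + y"]) (auto simp: mat.f_add free_module_add)
  qed
  show "smul p v \<in> mapA ` free_module n c" if "p \<in> poly_carrier n" for p
    using x that by (intro image_eqI[of _ _ "smul p x"]) (auto simp: mat_apply_smul free_module_smul)
  show "hcomp sh e v \<in> mapA ` free_module n c" for e
    using x mat_hcomp[OF x(1), of e] homog_free_module[OF hcomp_homog[OF x(1)]]
    by (intro image_eqI[of _ _ "hcomp sh' e x"]) auto
qed

lemma mat_kernel_gs: "graded_submodule n c sh' {v \<in> free_module n c. mapA v = 0}"
  unfolding graded_submodule_def
proof (intro conjI ballI allI)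
  show "{v \<in> free_module n c. mapA v = 0} \<subseteq> free_module n c" by blast
  show "0 \<in> {v \<in> free_module n c. mapA v = 0}" using free_module_0[of n c] by simp
  fix v assume v: "v \<in> {v \<in> free_module n c. mapA v = 0}"
  show "v + w \<in> {v \<in> free_module n c. mapA v = 0}" if "w \<in> {v \<in> free_module n c. mapA v = 0}" for w
    using v that free_module_add[of v n c w] mat.f_add[of r c A v w] by simp
  show "smul p v \<in> {v \<in> free_module n c. mapA v = 0}" if "p \<in> poly_carrier n" for p
    using v free_module_smul[OF that, of v c] mat_apply_smul[of r c A p v] by simp
  show "hcomp sh' e v \<in> {v \<in> free_module n c. mapA v = 0}" for e
    using v mat_hcomp[of v e] hcomp_homog[of v n c sh' e] homog_free_module by auto
qed

lemma mat_image_homog: "mapA ` homog n c sh' e = mapA ` free_module n c \<inter> homog n r sh e"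
proof
  show "mapA ` homog n c sh' e \<subseteq> mapA ` free_module n c \<inter> homog n r sh e"
    using mat_homog homog_free_module by blast
  show "mapA ` free_module n c \<inter> homog n r sh e \<subseteq> mapA ` homog n c sh' e"
  proof
    fix z assume z: "z \<in> mapA ` free_module n c \<inter> homog n r sh e"
    then obtain x where x: "x \<in> free_module n c" "z = mapA x" by blast
    then have "z = mapA (hcomp sh' e x)" using z mat_hcomp[OF x(1), of e] hcomp_of_homog[of z n r sh e e] by auto
    then show "z \<in> mapA ` homog n c sh' e" using hcomp_homog[OF x(1)] by blast
  qed
qed

context
  assumes minimal: "\<forall>v\<in>free_module n c. mapA v = 0 \<longrightarrow> (\<forall>l<c. lookup (v l) 0 = 0)"
begin

lemma mat_koszul_cover:
  "koszul_cover xv xv mapA n (homog n c sh') (\<lambda>e. mapA ` free_module n c \<inter> homog n r sh e)"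
proof -
  have G: "koszul_graded xv n (\<lambda>e. mapA ` free_module n c \<inter> homog n r sh e)"
    by (rule gs_koszul_graded[OF mat_image_gs])
  show ?thesis
  proof (rule koszul_cover.intro[OF mat.koszul_hom_axioms homog.koszul_graded_axioms G koszul_cover_axioms.intro])
    show "mapA ` homog n c sh' e = mapA ` free_module n c \<inter> homog n r sh e" for e by (rule mat_image_homog)
    show "koszul_exact xv n (homog n c sh' :: int \<Rightarrow> (nat \<Rightarrow> 'k mpoly) set) (Suc p) e" for p e
      by (rule homog_exact)
    show "\<exists>y\<in>kchains n 1 (homog n c sh' (e - 1)). koszul xv n y {} = v"
      if "v \<in> homog n c sh' e" "mapA v = 0" for v e
      using minimal homog_free_module[OF that(1)] that(2) by (intro homog_maximal_ideal[OF that(1)]) blast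
  qed
qed

lemma exact_shift:
  "koszul_exact xv n (\<lambda>e. {v \<in> free_module n c. mapA v = 0} \<inter> homog n c sh' e) p (e + 1)
   \<longleftrightarrow> koszul_exact xv n (\<lambda>e. mapA ` free_module n c \<inter> homog n r sh e) (Suc p) e"
proof -
  interpret koszul_cover xv xv mapA n "homog n c sh'" "\<lambda>e. mapA ` free_module n c \<inter> homog n r sh e"
    by (rule mat_koszul_cover)
  have "(\<lambda>e. {v \<in> free_module n c. mapA v = 0} \<inter> homog n c sh' e) = ker"
    by (auto simp: fun_eq_iff homog_def)
  then show ?thesis using exact_ker_iff[of p e] by simp
qed

text \<open>A unit vector of degree e has a constant term and so is no combination of multiples of
  the variables. Conversely, a vector of degree e can have a constant term only in a component whose
  basis element has degree e.\<close>

lemma exact_0_degrees: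
  "koszul_exact xv n (\<lambda>e. mapA ` free_module n c \<inter> homog n r sh e) 0 e \<longleftrightarrow> \<not> (\<exists>l<c. int (sh' l) = e)"
proof -
  interpret koszul_cover xv xv mapA n "homog n c sh'" "\<lambda>e. mapA ` free_module n c \<inter> homog n r sh e"
    by (rule mat_koszul_cover)
  show ?thesis unfolding exact_0_iff
  proof
    assume ex: "\<forall>v\<in>homog n c sh' e :: (nat \<Rightarrow> 'k mpoly) set. \<exists>y\<in>kchains n 1 (homog n c sh' (e - 1)). koszul xv n y {} = v"
    show "\<not> (\<exists>l<c. int (sh' l) = e)"
    proof
      assume "\<exists>l<c. int (sh' l) = e"
      then obtain l where l: "l < c" "int (sh' l) = e" by blast
      have "(unit_vec l :: nat \<Rightarrow> 'k mpoly) \<in> homog n c sh' e"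
        using unit_vec_homog[OF l(1), of n sh'] l(2) by simp
      then obtain y where y: "koszul xv n y {} = (unit_vec l :: nat \<Rightarrow> 'k mpoly)"
        using ex by blast
      have "lookup (koszul xv n y {} l) 0 = 0" by (simp add: lookup_koszul)
      then show False unfolding y by (simp add: unit_vec_def)
    qed
  next
    assume no: "\<not> (\<exists>l<c. int (sh' l) = e)"
    show "\<forall>v\<in>homog n c sh' e :: (nat \<Rightarrow> 'k mpoly) set. \<exists>y\<in>kchains n 1 (homog n c sh' (e - 1)). koszul xv n y {} = v"
    proof
      fix v :: "nat \<Rightarrow> 'k mpoly" assume v: "v \<in> homog n c sh' e"
      show "\<exists>y\<in>kchains n 1 (homog n c sh' (e - 1)). koszul xv n y {} = v"
        using no homogD[OF v] by (intro homog_maximal_ideal[OF v]) (metis add.right_neutral total_degree_0)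
    qed
  qed
qed

end

end


section \<open>Koszul homology of monomial ideals\<close>

definition up_closed :: "nat \<Rightarrow> expo set \<Rightarrow> bool" where
  "up_closed n P \<longleftrightarrow> P \<subseteq> expos n \<and> (\<forall>m\<in>P. \<forall>m'\<in>expos n. m + m' \<in> P)"

text \<open>The ideal spanned by the monomials in P, placed in component 0 of the free module of
  rank 1 so that the theory of graded submodules applies to it.\<close>

definition ideal_vecs :: "nat \<Rightarrow> expo set \<Rightarrow> (nat \<Rightarrow> 'k::field mpoly) set" where
  "ideal_vecs n P = {v \<in> free_module n 1. keys (v 0) \<subseteq> P}"

abbreviation ideal_part :: "nat \<Rightarrow> expo set \<Rightarrow> int \<Rightarrow> (nat \<Rightarrow> 'k::field mpoly) set" where
  "ideal_part n P e \<equiv> ideal_vecs n P \<inter> homog n 1 (\<lambda>_. 0) e"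

lemma ideal_part_homog_in: "ideal_part n P = homog_in n 1 (\<lambda>_. 0) (\<lambda>_. P)"
  by (auto simp: fun_eq_iff ideal_vecs_def homog_in_def homog_def)

lemma ideal_vecs_gs:
  assumes "up_closed n P"
  shows "graded_submodule n 1 (\<lambda>_. 0) (ideal_vecs n P)"
  unfolding graded_submodule_def
proof (intro conjI ballI allI)
  show "ideal_vecs n P \<subseteq> free_module n 1" "0 \<in> ideal_vecs n P"
    using free_module_0 by (auto simp: ideal_vecs_def)
  fix v assume v: "v \<in> ideal_vecs n P"
  show "v + w \<in> ideal_vecs n P" if "w \<in> ideal_vecs n P" for w
    using v that free_module_add[of v n 1 w] keys_add[of "v 0" "w 0"] by (auto simp: ideal_vecs_def)
  show "hcomp (\<lambda>_. 0) e v \<in> ideal_vecs n P" for e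
    using v homog_free_module[OF hcomp_homog[of v n 1 "\<lambda>_. 0" e]]
    by (auto simp: ideal_vecs_def in_keys_iff lookup_hcomp when_def subset_iff split: if_splits)
  show "smul p v \<in> ideal_vecs n P" if p: "p \<in> poly_carrier n" for p
  proof -
    have "keys (p * v 0) \<subseteq> P"
    proof
      fix m assume "m \<in> keys (p * v 0)"
      then obtain a b where ab: "m = a + b" "a \<in> keys p" "b \<in> keys (v 0)"
        using keys_mult[of p "v 0"] by blast
      then have "b + a \<in> P" using assms v poly_carrierD[OF p ab(2)] by (auto simp: up_closed_def ideal_vecs_def)
      then show "m \<in> P" using ab(1) by (simp add: add.commute)
    qed
    then show ?thesis using v free_module_smul[OF p, of v 1] by (auto simp: ideal_vecs_def smul_apply)
  qed
qed

lemma ideal_exact_above: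
  assumes "\<And>m. m \<in> P \<Longrightarrow> R < total_degree m \<Longrightarrow> m - ev (Max (keys m)) \<in> P" and "int R < e"
  shows "koszul_exact xv n (ideal_part n P :: int \<Rightarrow> (nat \<Rightarrow> 'k::field mpoly) set) p e"
  unfolding ideal_part_homog_in
  by (rule homog_in_exact) (use assms in auto)

lemma homog_negative:
  assumes "v \<in> homog n r sh e" "e < 0"
  shows "v = 0"
proof (intro ext poly_mapping_eqI)
  fix k m
  show "lookup (v k) m = lookup (0 k) m"
    using homogD(3)[OF assms(1), of k m] assms(2) by (cases "lookup (v k) m = 0") auto
qed

lemma ideal_part_negative:
  assumes "e < 0"
  shows "ideal_part n P e = {0 :: nat \<Rightarrow> 'k::field mpoly}"
proof -
  have "0 \<in> ideal_vecs n P" using free_module_0 by (simp add: ideal_vecs_def)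
  then show ?thesis using homog_0 homog_negative[OF _ assms] by blast
qed

text \<open>Bounds j - i from below, which makes the set whose maximum is the regularity
  finite.\<close>

lemma ideal_exact_negative:
  assumes "e < 0"
  shows "koszul_exact xv n (ideal_part n P :: int \<Rightarrow> (nat \<Rightarrow> 'k::field mpoly) set) p e"
  unfolding koszul_exact_def
proof (intro ballI impI)
  fix z :: "nat set \<Rightarrow> nat \<Rightarrow> 'k mpoly" assume z: "z \<in> kchains n p (ideal_part n P e)"
  have "z = (\<lambda>T. 0)" using z chains_mem[OF z] unfolding ideal_part_negative[OF assms] by auto
  moreover have "(\<lambda>T. 0) \<in> kchains n (Suc p) (ideal_part n P (e - 1) :: (nat \<Rightarrow> 'k mpoly) set)"
    by (rule chainsI) (use ideal_part_negative[of "e - 1" n P] assms in auto)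
  moreover have "koszul xv n (\<lambda>T. 0 :: nat \<Rightarrow> 'k mpoly) = (\<lambda>T. 0)" by (rule xv.koszul_zero)
  ultimately show "\<exists>y\<in>kchains n (Suc p) (ideal_part n P (e - 1)). koszul xv n y = z" by blast
qed

text \<open>The witness is the Koszul boundary of \<open>x\<^sup>w e\<^sub>1 \<and> \<dots> \<and> e\<^sub>M\<close>, where \<open>w\<close> is a socle monomial.\<close>

lemma ideal_not_exact:
  assumes w: "w \<in> expos n" "w \<notin> P" "total_degree w + 1 = R" and M: "1 \<le> M" "M \<le> n" "keys w \<subseteq> {..M}"
    and P: "\<And>l. l \<in> {1..M} \<Longrightarrow> w + ev l \<in> P"
  shows "\<not> koszul_exact xv n (ideal_part n P :: int \<Rightarrow> (nat \<Rightarrow> 'k::field mpoly) set) (M - 1) (int R)"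
proof
  assume ex: "koszul_exact xv n (ideal_part n P :: int \<Rightarrow> (nat \<Rightarrow> 'k mpoly) set) (M - 1) (int R)"
  let ?w = "(\<lambda>k. if k = 0 then monomial w else 0) :: nat \<Rightarrow> 'k mpoly"
  define y0 where "y0 T = (if T = {1..M} then ?w else 0)" for T :: "nat set"
  have w_homog: "?w \<in> homog n 1 (\<lambda>_. 0) (int R - 1)"
    by (rule homogI) (use w in \<open>auto simp: monomial_def lookup_single when_def split: if_splits\<close>)
  have y0: "y0 \<in> kchains n M (homog n 1 (\<lambda>_. 0) (int R - 1))"
    using M w_homog homog_0 by (intro chainsI) (auto simp: y0_def)
  let ?z = "koszul xv n y0"
  have z: "?z \<in> kchains n (M - 1) (homog n 1 (\<lambda>_. 0) (int R))"
    using homog.koszul_chains[of y0 n "M - 1" "1" "\<lambda>_. 0" "int R - 1"] y0 M by simp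
  \<comment> \<open>The coefficient w of \<open>y0\<close> is outside P, but each w x_l with l <= M
    is in P: only the boundary of \<open>y0\<close> has coefficients in the ideal.\<close>
  have zP: "lookup (?z T 0) m = 0" if "m \<notin> P" for T m
  proof -
    have "signed i T (if 0 < lookup m i then lookup (y0 (insert i T) 0) (m - ev i) else 0) = 0"
      if "i \<in> {1..n} - T" for i
    proof (rule ccontr)
      assume nz: "signed i T (if 0 < lookup m i then lookup (y0 (insert i T) 0) (m - ev i) else 0) \<noteq> 0"
      then have i: "0 < lookup m i" and yi: "lookup (y0 (insert i T) 0) (m - ev i) \<noteq> 0"
        by (auto split: if_splits)
      then have "insert i T = {1..M}" and wm: "w = m - ev i"
        by (auto simp: y0_def monomial_def lookup_single when_def split: if_splits)
      then have "i \<in> {1..M}" by blast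
      moreover have "w + ev i = m" using expo_split[OF i] wm by (simp add: add.commute)
      ultimately show False using P \<open>m \<notin> P\<close> by metis
    qed
    then show ?thesis unfolding lookup_koszul by (rule sum.neutral[OF ballI])
  qed
  have "?z \<in> kchains n (M - 1) (ideal_part n P (int R))"
  proof (rule chainsI)
    fix T :: "nat set"
    assume "T \<subseteq> {1..n}" "card T = M - 1"
    then have zh: "?z T \<in> homog n 1 (\<lambda>_. 0) (int R)" by (rule chains_memD[OF z])
    have "keys (?z T 0) \<subseteq> P" using zP[of _ T] by (auto simp: in_keys_iff)
    then show "?z T \<in> ideal_part n P (int R)" using zh homog_free_module[OF zh] by (simp add: ideal_vecs_def)
  qed (use chains_zeroD[OF z] in blast)
  moreover have "\<forall>T. koszul xv n ?z T = 0" using xv.koszul_koszul[OF y0] by blast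
  ultimately obtain y where y: "y \<in> kchains n M (ideal_part n P (int R - 1))" "koszul xv n y = ?z"
    using ex M unfolding koszul_exact_def by fastforce
  \<comment> \<open>The coefficient of w x_M at this set separates the two boundaries. No variable
    beyond x_M divides w x_M, so only the summand of M counts: it contributes the coefficient of w,
    which is 1 for \<open>y0\<close> and 0 for any y with coefficients in the ideal.\<close>
  let ?T = "{1..M - 1}" and ?m = "w + ev M"
  have T: "insert M ?T = {1..M}" using M by auto
  have yw: "lookup (y T 0) w = 0" for T
  proof -
    have "y T \<in> ideal_part n P (int R - 1)"
    proof (rule chains_mem[OF y(1)])
      show "0 \<in> ideal_part n P (int R - 1)" using homog_0 free_module_0 by (simp add: ideal_vecs_def)
    qed
    then show ?thesis using w(2) by (auto simp: ideal_vecs_def in_keys_iff)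
  qed
  have key0: "lookup ?m i = 0" if "M < i" for i
    using that M(3) by (auto simp: lookup_add lookup_single in_keys_iff subset_iff)
  have mM: "?m - ev M = w" by simp
  have "lookup (koszul xv n y ?T 0) ?m = 0" unfolding lookup_koszul
  proof (rule sum.neutral, rule ballI)
    fix i assume i: "i \<in> {1..n} - ?T"
    then have "M \<le> i" by auto
    then consider "i = M" | "M < i" by linarith
    then show "signed i ?T (if 0 < lookup ?m i then lookup (y (insert i ?T) 0) (?m - ev i) else 0) = 0"
    proof cases
      case 1 then show ?thesis by (simp add: yw)
    next
      case 2 then show ?thesis using key0[of i] by simp
    qed
  qed
  moreover have "lookup (?z ?T 0) ?m = 1"
  proof -
    have "lookup (?z ?T 0) ?m = (\<Sum>i\<in>{1..n} - ?T. if i = M then 1 else 0)" unfolding lookup_koszul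
    proof (rule sum.cong[OF refl])
      fix i assume i: "i \<in> {1..n} - ?T"
      then have "M \<le> i" by auto
      then consider "i = M" | "M < i" by linarith
      then show "signed i ?T (if 0 < lookup ?m i then lookup (y0 (insert i ?T) 0) (?m - ev i) else 0)
          = (if i = M then 1 else 0)"
      proof cases
        case 1
        have "signed M ?T x = x" for x :: 'k by (rule signed_top) auto
        moreover have "lookup (y0 {1..M} 0) w = 1" by (simp add: y0_def monomial_def)
        moreover have "0 < lookup ?m M" by (simp add: lookup_add)
        ultimately show ?thesis unfolding 1 T mM by simp
      next
        case 2 then show ?thesis using key0[of i] by simp
      qed
    qed
    also have "\<dots> = 1" using M by simp
    finally show ?thesis .
  qed
  ultimately show False unfolding y(2) by simp
qed


section \<open>Minimal free resolutions and regularity\<close>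

definition scal :: "'k::field \<Rightarrow> (nat \<Rightarrow> 'k mpoly) \<Rightarrow> nat \<Rightarrow> 'k mpoly" where
  "scal c v = smul (Poly_Mapping.single 0 c) v"

interpretation scal: vector_space "scal :: 'k::field \<Rightarrow> (nat \<Rightarrow> 'k mpoly) \<Rightarrow> nat \<Rightarrow> 'k mpoly"
  by standard (simp_all add: scal_def smul_def fun_eq_iff distrib_left distrib_right single_add
      mult_single mult.assoc[symmetric])

context vector_space
begin

text \<open>B is a basis of V modulo U, lifted to V. It is applied to a graded piece V and the part
  U generated from one degree below, so that B consists of minimal generators.\<close>

lemma complement_basis:
  assumes U: "subspace U" "U \<subseteq> V" and V: "subspace V" "V \<subseteq> span S" and fin: "finite S"
  shows "\<exists>B. finite B \<and> B \<subseteq> V \<and> (\<forall>v\<in>V. \<exists>c. v - (\<Sum>b\<in>B. scale (c b) b) \<in> U) \<and>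
    (\<forall>c b. (\<Sum>b\<in>B. scale (c b) b) \<in> U \<longrightarrow> b \<in> B \<longrightarrow> c b = 0)"
proof -
  obtain B0 where B0: "B0 \<subseteq> U" "independent B0" "U \<subseteq> span B0"
    using maximal_independent_subset[of U] by blast
  have "B0 \<subseteq> V" using B0 U by blast
  from maximal_independent_subset_extend[OF this B0(2)] obtain B1 where
    B1: "B0 \<subseteq> B1" "B1 \<subseteq> V" "independent B1" "V \<subseteq> span B1" by blast
  have fin1: "finite B1" using independent_span_bound[OF fin B1(3)] B1(2) V(2) by blast
  have fin0: "finite B0" using fin1 B1(1) finite_subset by blast
  define B where "B = B1 - B0"
  have split: "(\<Sum>b\<in>B1. f b) = (\<Sum>b\<in>B0. f b) + (\<Sum>b\<in>B. f b)" for f :: "'b \<Rightarrow> 'b"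
    unfolding B_def using sum.subset_diff[OF B1(1) fin1, of f] by (simp add: add.commute)
  show ?thesis
  proof (intro exI[of _ B] conjI ballI allI impI)
    show "finite B" "B \<subseteq> V" using fin1 B1 by (auto simp: B_def)
    show "\<exists>c. v - (\<Sum>b\<in>B. scale (c b) b) \<in> U" if "v \<in> V" for v
    proof -
      have "v \<in> span B1" using that B1 by blast
      then obtain c where "v = (\<Sum>b\<in>B1. scale (c b) b)" using span_finite[OF fin1] by auto
      then have "v - (\<Sum>b\<in>B. scale (c b) b) = (\<Sum>b\<in>B0. scale (c b) b)" using split by simp
      also have "\<dots> \<in> U" using B0(1) by (intro subspace_sum U subspace_scale) auto
      finally show ?thesis by blast
    qed
    show "c b = 0" if "(\<Sum>b\<in>B. scale (c b) b) \<in> U" "b \<in> B" for c b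
    proof -
      have "(\<Sum>b\<in>B. scale (c b) b) \<in> span B0" using that B0 by blast
      then obtain c' where c': "(\<Sum>b\<in>B. scale (c b) b) = (\<Sum>b\<in>B0. scale (c' b) b)"
        using span_finite[OF fin0] by auto
      let ?c = "\<lambda>b. if b \<in> B then c b else - c' b"
      have "(\<Sum>b\<in>B1. scale (?c b) b) = (\<Sum>b\<in>B0. scale (?c b) b) + (\<Sum>b\<in>B. scale (?c b) b)"
        by (rule split)
      also have "(\<Sum>b\<in>B0. scale (?c b) b) = (\<Sum>b\<in>B0. - scale (c' b) b)"
        by (intro sum.cong) (auto simp: B_def)
      also have "(\<Sum>b\<in>B. scale (?c b) b) = (\<Sum>b\<in>B. scale (c b) b)" by (intro sum.cong) auto
      finally have "(\<Sum>b\<in>B1. scale (?c b) b) = 0" using c' by (simp add: sum_negf)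
      moreover have "b \<in> B1" using that(2) by (simp add: B_def)
      ultimately have "dependent B1" if "?c b \<noteq> 0"
        unfolding dependent_finite[OF fin1] using that by (intro exI[of _ ?c] conjI bexI[of _ b])
      then show ?thesis using B1(3) that(2) by auto
    qed
  qed
qed

end

section \<open>Finite-dimensional graded pieces and existence of minimal covers\<close>

lemma finite_expos_degree: "finite {m \<in> expos n. total_degree m = t}"
proof (rule finite_imageD)
  let ?f = "\<lambda>m. restrict (lookup m) {1..n}"
  have "?f ` {m \<in> expos n. total_degree m = t} \<subseteq> {1..n} \<rightarrow>\<^sub>E {..t}"
  proof (rule image_subsetI)
    fix m assume m: "m \<in> {m \<in> expos n. total_degree m = t}"
    have "lookup m i \<le> t" for i
    proof (cases "i \<in> keys m")
      case True
      then have "lookup m i \<le> (\<Sum>i\<in>keys m. lookup m i)" by (intro member_le_sum) auto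
      then show ?thesis using m by (simp add: total_degree_def)
    qed (simp add: in_keys_iff)
    then show "?f m \<in> {1..n} \<rightarrow>\<^sub>E {..t}" by auto
  qed
  then show "finite (?f ` {m \<in> expos n. total_degree m = t})"
    by (rule finite_subset) (auto intro: finite_PiE)
  show "inj_on ?f {m \<in> expos n. total_degree m = t}"
  proof (rule inj_onI)
    fix a b assume a: "a \<in> {m \<in> expos n. total_degree m = t}" and b: "b \<in> {m \<in> expos n. total_degree m = t}"
      and eq: "?f a = ?f b"
    show "a = b"
    proof (rule poly_mapping_eqI)
      fix i
      show "lookup a i = lookup b i"
      proof (cases "i \<in> {1..n}")
        case True then show ?thesis using fun_cong[OF eq, of i] by simp
      next
        case False
        then have "i \<notin> keys a" "i \<notin> keys b" using a b by (auto simp: expos_def)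
        then show ?thesis by (simp add: in_keys_iff)
      qed
    qed
  qed
qed

lemma homog_finite_span:
  "\<exists>S. finite S \<and> (homog n r sh e :: (nat \<Rightarrow> 'k::field mpoly) set) \<subseteq> scal.span S"
proof -
  define I where "I = (SIGMA k:{..<r}. {m \<in> expos n. total_degree m = nat (e - int (sh k))})"
  define b where "b x = (\<lambda>k. if k = fst x then monomial (snd x) else 0 :: 'k mpoly)" for x :: "nat \<times> expo"
  have fin: "finite I" unfolding I_def by (intro finite_SigmaI finite_expos_degree) auto
  have "homog n r sh e \<subseteq> scal.span (b ` I)"
  proof
    fix v :: "nat \<Rightarrow> 'k mpoly" assume v: "v \<in> homog n r sh e"
    have "v = (\<Sum>x\<in>I. scal (lookup (v (fst x)) (snd x)) (b x))"
    proof (intro ext poly_mapping_eqI)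
      fix k m
      have "lookup ((\<Sum>x\<in>I. scal (lookup (v (fst x)) (snd x)) (b x)) k) m
          = (\<Sum>x\<in>I. if x = (k, m) then lookup (v k) m else 0)"
        unfolding sum_apply lookup_sum
        by (intro sum.cong refl)
          (auto simp: scal_def smul_apply b_def monomial_def mult_single lookup_single when_def)
      also have "\<dots> = (if (k, m) \<in> I then lookup (v k) m else 0)" using fin by simp
      also have "\<dots> = lookup (v k) m"
        using homogD[OF v, of k m] by (cases "lookup (v k) m = 0") (auto simp: I_def)
      finally show "lookup (v k) m = lookup ((\<Sum>x\<in>I. scal (lookup (v (fst x)) (snd x)) (b x)) k) m" by simp
    qed
    also have "\<dots> \<in> scal.span (b ` I)"
      by (intro scal.span_sum scal.span_scale scal.span_base imageI)
    finally show "v \<in> scal.span (b ` I)" .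
  qed
  then show ?thesis using fin by blast
qed

lemma lookup_scal: "lookup (scal c v k) m = c * lookup (v k) m"
  using lookup_single_times[of 0 c "v k" m] by (simp add: scal_def smul_apply)

lemma homog_scal:
  assumes "v \<in> homog n r sh e"
  shows "scal c v \<in> homog n r sh e"
proof (rule homogI)
  fix k m assume "lookup (scal c v k) m \<noteq> 0"
  then have "lookup (v k) m \<noteq> 0" by (simp add: lookup_scal)
  then show "m \<in> expos n \<and> int (sh k + total_degree m) = e" using homogD(2,3)[OF assms, of k m] by simp
qed (simp add: scal_def smul_apply homog_outside[OF assms])

interpretation scal_hom: koszul_hom xv xv "scal c" for c
  by standard (simp_all add: scal_def smul_def fun_eq_iff distrib_left mult.left_commute)

text \<open>In each degree a basis modulo \<open>M e\<close>, the part generated from degree e - 1,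
  is lifted, as in the graded Nakayama lemma. Exactness at p = 0 above R says that
  \<open>M e\<close> is everything there, so finitely many generators suffice; this does the work of
  a Noetherian argument.\<close>

lemma minimal_cover_exists:
  fixes Z :: "(nat \<Rightarrow> 'k::field mpoly) set"
  assumes Z: "graded_submodule n r sh Z"
    and bounded: "\<And>e. int R < e \<Longrightarrow> koszul_exact xv n (\<lambda>e. Z \<inter> homog n r sh e) 0 e"
  obtains c sh' A where "hmatrix n r sh c sh' A" "mat_apply r c A ` free_module n c = Z"
    "\<forall>v\<in>free_module n c. mat_apply r c A v = 0 \<longrightarrow> (\<forall>l<c. lookup (v l) 0 = 0)"
proof -
  define H where "H e = Z \<inter> homog n r sh e" for e
  have H_eq: "(\<lambda>e. Z \<inter> homog n r sh e) = H" by (simp add: H_def fun_eq_iff)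
  interpret H: koszul_graded xv n H using gs_koszul_graded[OF Z] unfolding H_eq .
  define M where "M e = {koszul xv n y {} |y. y \<in> kchains n 1 (H (e - 1))}" for e
  have H_scal: "scal a v \<in> H e" if "v \<in> H e" for a v e
  proof -
    have "scal a v \<in> Z"
      unfolding scal_def using that by (intro gs_smul[OF Z] poly_carrier_single zero_expos) (simp add: H_def)
    then show ?thesis using that by (simp add: H_def homog_scal)
  qed
  have H_sub: "scal.subspace (H e)" for e
    by (rule scal.subspaceI) (auto intro: H.G_add H_scal)
  have M_sub: "scal.subspace (M e)" for e
  proof (rule scal.subspaceI)
    have "(\<lambda>T. 0) \<in> kchains n 1 (H (e - 1))" by (rule chainsI) auto
    moreover have "koszul xv n (\<lambda>T. 0 :: nat \<Rightarrow> 'k mpoly) {} = 0" by (simp add: xv.koszul_zero)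
    ultimately show "0 \<in> M e" unfolding M_def mem_Collect_eq by metis
    show "v + w \<in> M e" if vw: "v \<in> M e" "w \<in> M e" for v w
    proof -
      obtain y z where y: "y \<in> kchains n 1 (H (e - 1))" "v = koszul xv n y {}"
        and z: "z \<in> kchains n 1 (H (e - 1))" "w = koszul xv n z {}"
        using vw unfolding M_def by blast
      have "(\<lambda>T. y T + z T) \<in> kchains n 1 (H (e - 1))"
        using y(1) z(1) H.G_add unfolding kchains_def by (auto split: if_splits)
      moreover have "v + w = koszul xv n (\<lambda>T. y T + z T) {}" using y(2) z(2) by (simp add: xv.koszul_add)
      ultimately show ?thesis unfolding M_def by blast
    qed
    show "scal a v \<in> M e" if v: "v \<in> M e" for a v
    proof -
      obtain y where y: "y \<in> kchains n 1 (H (e - 1))" "v = koszul xv n y {}"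
        using v unfolding M_def by blast
      have "(\<lambda>T. scal a (y T)) \<in> kchains n 1 (H (e - 1))"
        using y(1) H_scal unfolding kchains_def by (auto split: if_splits)
      moreover have "scal a v = koszul xv n (\<lambda>T. scal a (y T)) {}" using y(2) by (simp add: scal_hom.f_koszul)
      ultimately show ?thesis unfolding M_def by blast
    qed
  qed
  have M_H: "M e \<subseteq> H e" for e
  proof
    fix v assume "v \<in> M e"
    then obtain y where y: "y \<in> kchains n (Suc 0) (H (e - 1))" "v = koszul xv n y {}"
      unfolding M_def by auto
    have "koszul xv n y \<in> kchains n 0 (H e)" using H.koszul_chains[OF y(1)] by simp
    then show "v \<in> H e" using chains_mem y(2) H.G_0 by blast
  qed
  have "\<exists>B. finite B \<and> B \<subseteq> H e \<and> (\<forall>v\<in>H e. \<exists>a. v - (\<Sum>b\<in>B. scal (a b) b) \<in> M e) \<and>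
      (\<forall>a b. (\<Sum>b\<in>B. scal (a b) b) \<in> M e \<longrightarrow> b \<in> B \<longrightarrow> a b = 0)" for e
  proof -
    obtain S where S: "finite S" "(homog n r sh e :: (nat \<Rightarrow> 'k mpoly) set) \<subseteq> scal.span S"
      using homog_finite_span by blast
    have HS: "H e \<subseteq> scal.span S" using S(2) by (auto simp: H_def)
    show ?thesis by (rule scal.complement_basis[OF M_sub M_H H_sub HS S(1)])
  qed
  then have "\<exists>B. \<forall>e. finite (B e) \<and> B e \<subseteq> H e \<and> (\<forall>v\<in>H e. \<exists>a. v - (\<Sum>b\<in>B e. scal (a b) b) \<in> M e) \<and>
      (\<forall>a b. (\<Sum>b\<in>B e. scal (a b) b) \<in> M e \<longrightarrow> b \<in> B e \<longrightarrow> a b = 0)"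
    by (intro choice allI)
  then obtain B where B': "\<forall>e. finite (B e) \<and> B e \<subseteq> H e \<and>
      (\<forall>v\<in>H e. \<exists>a. v - (\<Sum>b\<in>B e. scal (a b) b) \<in> M e) \<and>
      (\<forall>a b. (\<Sum>b\<in>B e. scal (a b) b) \<in> M e \<longrightarrow> b \<in> B e \<longrightarrow> a b = 0)" ..
  have B_fin: "finite (B e)" and B_H: "B e \<subseteq> H e" for e
    using spec[OF B', of e] by auto
  have B_span: "\<exists>a. v - (\<Sum>b\<in>B e. scal (a b) b) \<in> M e" if "v \<in> H e" for e v
    using spec[OF B', of e] that by simp
  have B_indep: "a b = 0" if "(\<Sum>b\<in>B e. scal (a b) b) \<in> M e" "b \<in> B e" for e a b
    using spec[OF B', of e] that by simp
  \<comment> \<open>Each basis element keeps its degree as a tag, which gives the shifts of the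
    cover.\<close>
  define S where "S = (SIGMA e:{0..int R}. B e)"
  define c where "c = card S"
  have finS: "finite S" unfolding S_def using B_fin by (intro finite_SigmaI) auto
  obtain h where h: "bij_betw h {0..<c} S" using ex_bij_betw_nat_finite[OF finS] unfolding c_def by blast
  define deg where "deg l = fst (h l)" for l
  define b where "b l = snd (h l)" for l
  define sh' where "sh' l = nat (deg l)" for l
  define A where "A k l = b l k" for k l
  let ?F = "mat_apply r c A"
  have hl: "h l \<in> S" if "l < c" for l using bij_betwE[OF h] that by auto
  have deg: "int (sh' l) = deg l" "b l \<in> B (deg l)" "0 \<le> deg l" "deg l \<le> int R" if "l < c" for l
    using hl[OF that] by (auto simp: S_def deg_def b_def sh'_def)
  have bH: "b l \<in> H (deg l)" if "l < c" for l using deg(2)[OF that] B_H by blast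
  have bh: "b l \<in> homog n r sh (deg l)" if "l < c" for l using bH[OF that] by (simp add: H_def)
  have hA: "hmatrix n r sh c sh' A"
    unfolding hmatrix_def A_def
  proof (intro allI impI conjI ballI)
    fix k l m assume "k < r" "l < c"
    show "b l k \<in> poly_carrier n" by (rule free_moduleD[OF homog_free_module[OF bh[OF \<open>l < c\<close>]]])
    assume "m \<in> keys (b l k)"
    then have "int (sh k + total_degree m) = int (sh' l)"
      using homogD(3)[OF bh[OF \<open>l < c\<close>], of k m] deg(1)[OF \<open>l < c\<close>] by (simp add: in_keys_iff)
    then show "sh k + total_degree m = sh' l" by linarith
  qed
  have F_eq: "?F v = (\<Sum>l<c. smul (v l) (b l))" for v
  proof
    fix k
    show "?F v k = (\<Sum>l<c. smul (v l) (b l)) k"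
    proof (cases "k < r")
      case False
      then have "b l k = 0" if "l < c" for l using homog_outside[OF bh[OF that]] by simp
      then show ?thesis using False by (simp add: mat_apply_def sum_apply smul_apply)
    qed (simp add: mat_apply_def sum_apply smul_apply A_def mult.commute)
  qed
  have F_Z: "?F v \<in> Z" if "v \<in> free_module n c" for v
    unfolding F_eq using that bH by (intro gs_sum[OF Z] gs_smul[OF Z] free_moduleD) (auto simp: H_def)
  let ?I = "?F ` free_module n c"
  note I = mat_image_gs[OF hA]
  have b_I: "scal a (b l) \<in> ?I" if "l < c" for a l
  proof -
    have "b l = ?F (unit_vec l)"
      unfolding mat_apply_unit_vec[OF that] using homog_outside[OF bh[OF that]] by (auto simp: A_def)
    then have "b l \<in> ?I" using homog_free_module[OF unit_vec_homog[OF that, of n sh']] by blast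
    then show ?thesis unfolding scal_def
      by (intro gs_smul[OF I] poly_carrier_single zero_expos)
  qed
  have B_I: "scal a x \<in> ?I" if x: "x \<in> B e" "0 \<le> e" "e \<le> int R" for a x e
  proof -
    have "(e, x) \<in> h ` {0..<c}" using h x by (auto simp: bij_betw_def S_def)
    then obtain l where "l < c" "b l = x" by (auto simp: b_def) (metis snd_conv)
    then show ?thesis using b_I by blast
  qed
  \<comment> \<open>Induction on the degree: up to R, z agrees with a combination of chosen
    generators modulo \<open>M\<close>; above R it lies in \<open>M\<close> itself; and
    \<open>M\<close> comes from the preceding degree.\<close>
  have H_I: "H (int t) \<subseteq> ?I" for t
  proof (induction t rule: less_induct)
    case (less t)
    have M_I: "M (int t) \<subseteq> ?I"
    proof
      fix v assume "v \<in> M (int t)"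
      then obtain y where y: "y \<in> kchains n 1 (H (int t - 1))" "v = koszul xv n y {}"
        unfolding M_def by blast
      have "H (int t - 1) \<subseteq> ?I"
      proof (cases t)
        case 0
        then have "H (int t - 1) \<subseteq> {0}" using homog_negative by (force simp: H_def)
        then show ?thesis using gs_0[OF I] by blast
      qed (use less in auto)
      then have "y {i} \<in> ?I" for i using chains_mem[OF y(1) H.G_0] by blast
      then have "xv i (y {i}) \<in> ?I" if "i \<in> {1..n}" for i using gs_xv[OF I that] by blast
      moreover have "v = (\<Sum>i\<in>{1..n}. xv i (y {i}))" unfolding y(2) koszul_def by (simp add: signed_def)
      ultimately show "v \<in> ?I" using gs_sum[OF I, of "{1..n}" "\<lambda>i. xv i (y {i})"] by simp
    qed
    show ?case
    proof
      fix z assume z: "z \<in> H (int t)"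
      show "z \<in> ?I"
      proof (cases "t \<le> R")
        case True
        obtain a where a: "z - (\<Sum>x\<in>B (int t). scal (a x) x) \<in> M (int t)" using B_span[OF z] by blast
        have "(\<Sum>x\<in>B (int t). scal (a x) x) \<in> ?I"
          by (rule gs_sum[OF I]) (use B_I[of _ "int t"] True in auto)
        then have "(z - (\<Sum>x\<in>B (int t). scal (a x) x)) + (\<Sum>x\<in>B (int t). scal (a x) x) \<in> ?I"
          using a M_I by (intro gs_add[OF I]) auto
        then show ?thesis by simp
      next
        case False
        have "koszul_exact xv n H 0 (int t)" using bounded[of "int t"] False unfolding H_eq by simp
        then obtain y where "y \<in> kchains n 1 (H (int t - 1))" "koszul xv n y {} = z"
          using z unfolding xv.koszul_exact_0_iff[OF H.G_0] by blast
        then have "z \<in> M (int t)" unfolding M_def by blast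
        then show ?thesis using M_I by blast
      qed
    qed
  qed
  have H_I': "H e \<subseteq> ?I" for e
  proof (cases "0 \<le> e")
    case True
    then show ?thesis using H_I[of "nat e"] by simp
  next
    case False
    then have "H e \<subseteq> {0}" using homog_negative by (force simp: H_def)
    then show ?thesis using gs_0[OF I] by blast
  qed
  have img: "?I = Z"
  proof
    show "?I \<subseteq> Z" using F_Z by blast
    show "Z \<subseteq> ?I"
    proof
      fix z assume z: "z \<in> Z"
      obtain E where E: "finite E" "z = (\<Sum>e\<in>E. hcomp sh e z)" using hcomp_decompose[OF gs_free[OF Z z]] .
      have "hcomp sh e z \<in> H e" for e
        using gs_hcomp[OF Z z] hcomp_homog[OF gs_free[OF Z z]] by (simp add: H_def)
      then have "(\<Sum>e\<in>E. hcomp sh e z) \<in> ?I" using H_I' by (intro gs_sum[OF I]) blast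
      then show "z \<in> ?I" using E(2) by simp
    qed
  qed
  \<comment> \<open>Let w be the component of degree \<open>deg l0\<close> of a kernel vector and w0
    its constant part. Then w - w0 lies in (x_1, ..., x_n) F, so the image of w0 lies in
    \<open>M e\<close>. This image is a combination of the chosen basis of that degree, and
    independence modulo \<open>M e\<close> makes w0 vanish.\<close>
  have minimal: "lookup (v l0) 0 = 0" if v: "v \<in> free_module n c" "?F v = 0" and l0: "l0 < c" for v l0
  proof -
    define e where "e = deg l0"
    define w where "w = hcomp sh' e v"
    have wh: "w \<in> homog n c sh' e" unfolding w_def by (rule hcomp_homog[OF v(1)])
    have Fw: "?F w = 0" unfolding w_def mat_hcomp[OF hA v(1)] v(2) by simp
    have wl: "lookup (w l0) 0 = lookup (v l0) 0" using deg(1)[OF l0] by (simp add: w_def lookup_hcomp e_def)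
    define w0 :: "nat \<Rightarrow> 'k mpoly" where "w0 l = Poly_Mapping.single 0 (lookup (w l) 0)" for l
    have w0_nz: "deg l = e" if "l < c" "lookup (w l) 0 \<noteq> 0" for l
      using homogD(3)[OF wh that(2)] deg(1)[OF that(1)] by simp
    have w0h: "w0 \<in> homog n c sh' e"
    proof (rule homogI)
      fix l m assume l: "l < c" "lookup (w0 l) m \<noteq> 0"
      then have "m = 0" "lookup (w l) 0 \<noteq> 0" by (auto simp: w0_def lookup_single when_def split: if_splits)
      then show "m \<in> expos n \<and> int (sh' l + total_degree m) = e" using homogD[OF wh, of l 0] by simp
    qed (simp add: w0_def homog_outside[OF wh])
    have "w - w0 \<in> homog n c sh' e" by (rule homog.G_diff[OF wh w0h])
    then obtain y where y: "y \<in> kchains n 1 (homog n c sh' (e - 1))" "koszul xv n y {} = w - w0"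
      using homog_maximal_ideal[of "w - w0" n c sh' e] by (auto simp: w0_def lookup_minus)
    have "(\<lambda>T. ?F (y T)) \<in> kchains n 1 (H (e - 1))"
    proof (rule chainsI)
      fix T assume T: "T \<subseteq> {1..n}" "card T = 1"
      have yT: "y T \<in> homog n c sh' (e - 1)" by (rule chains_memD[OF y(1) T])
      show "?F (y T) \<in> H (e - 1)"
        using mat_homog[OF hA yT] F_Z[OF homog_free_module[OF yT]] by (simp add: H_def)
    qed (use chains_zeroD[OF y(1)] in auto)
    moreover have "koszul xv n (\<lambda>T. ?F (y T)) {} = - ?F w0"
      unfolding mat.f_koszul[symmetric] y(2) mat.f_diff Fw by simp
    ultimately have "- ?F w0 \<in> M e" unfolding M_def by force
    then have "?F w0 \<in> M e" using scal.subspace_neg[OF M_sub] by fastforce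
    define a where "a x = (lookup (w (inv_into {0..<c} h (e, x))) 0)" for x
    have "?F w0 = (\<Sum>l\<in>{0..<c}. scal (lookup (w l) 0) (b l))"
      unfolding F_eq w0_def scal_def by (simp add: lessThan_atLeast0)
    also have "\<dots> = (\<Sum>l\<in>{l\<in>{0..<c}. deg l = e}. scal (lookup (w l) 0) (b l))"
      by (rule sum.mono_neutral_right) (use w0_nz in force)+
    also have "\<dots> = (\<Sum>x\<in>B e. scal (a x) x)"
    proof (rule sum.reindex_bij_witness[where j = b and i = "\<lambda>x. inv_into {0..<c} h (e, x)"])
      have inj: "inj_on h {0..<c}" and im: "h ` {0..<c} = S" using h by (auto simp: bij_betw_def)
      show "inv_into {0..<c} h (e, b l) = l" if "l \<in> {l\<in>{0..<c}. deg l = e}" for l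
      proof -
        have "(e, b l) = h l" using that by (auto simp: deg_def b_def)
        then show ?thesis using inv_into_f_f[OF inj] that by simp
      qed
      then show "scal (a (b l)) (b l) = scal (lookup (w l) 0) (b l)" if "l \<in> {l\<in>{0..<c}. deg l = e}" for l
        using that by (simp add: a_def)
      show "b l \<in> B e" if "l \<in> {l\<in>{0..<c}. deg l = e}" for l using deg(2) that by auto
      have eS: "(e, x) \<in> h ` {0..<c}" if "x \<in> B e" for x
        unfolding im S_def using that deg(3,4)[OF l0] by (simp add: e_def)
      show "b (inv_into {0..<c} h (e, x)) = x" if "x \<in> B e" for x
        using f_inv_into_f[OF eS[OF that]] by (simp add: b_def)
      show "inv_into {0..<c} h (e, x) \<in> {l\<in>{0..<c}. deg l = e}" if "x \<in> B e" for x
        using f_inv_into_f[OF eS[OF that]] inv_into_into[OF eS[OF that]] by (simp add: deg_def)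
    qed
    finally have "a (b l0) = 0" using \<open>?F w0 \<in> M e\<close> B_indep[where e = e and a = a and b = "b l0"] deg(2)[OF l0] by (simp add: e_def)
    moreover have "inv_into {0..<c} h (e, b l0) = l0"
    proof -
      have "(e, b l0) = h l0" by (simp add: e_def deg_def b_def)
      then show ?thesis using inv_into_f_f[of h "{0..<c}" l0] h l0 by (simp add: bij_betw_def)
    qed
    ultimately show ?thesis using wl by (simp add: a_def)
  qed
  show ?thesis using that[OF hA img] minimal by blast
qed

section \<open>Chains of syzygies\<close>

abbreviation chain_map ::
    "(nat \<Rightarrow> nat) \<Rightarrow> (nat \<Rightarrow> nat \<Rightarrow> nat \<Rightarrow> 'k::field mpoly) \<Rightarrow> nat \<Rightarrow> (nat \<Rightarrow> 'k mpoly) \<Rightarrow> nat \<Rightarrow> 'k mpoly"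
  where "chain_map rk A i \<equiv> mat_apply (rk i) (rk (Suc i)) (A i)"

text \<open>Minimality is imposed on kernels and not on matrix entries: the map of index 0 will be
  the augmentation, whose entries may have constant terms.\<close>

definition min_chain :: "nat \<Rightarrow> (nat \<Rightarrow> nat) \<Rightarrow> (nat \<Rightarrow> nat \<Rightarrow> nat) \<Rightarrow> (nat \<Rightarrow> nat \<Rightarrow> nat \<Rightarrow> 'k::field mpoly) \<Rightarrow> bool" where
  "min_chain n rk sh A \<longleftrightarrow> (\<forall>i. hmatrix n (rk i) (sh i) (rk (Suc i)) (sh (Suc i)) (A i) \<and>
     {v \<in> free_module n (rk (Suc i)). chain_map rk A i v = 0} =
       chain_map rk A (Suc i) ` free_module n (rk (Suc (Suc i))) \<and>
     (\<forall>v\<in>free_module n (rk (Suc i)). chain_map rk A i v = 0 \<longrightarrow>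
       (\<forall>l<rk (Suc i). lookup (v l) 0 = 0)))"

context
  fixes n :: nat and rk :: "nat \<Rightarrow> nat" and sh :: "nat \<Rightarrow> nat \<Rightarrow> nat"
    and A :: "nat \<Rightarrow> nat \<Rightarrow> nat \<Rightarrow> 'k::field mpoly"
  assumes chain: "min_chain n rk sh A"
begin

definition syzygies :: "nat \<Rightarrow> (nat \<Rightarrow> 'k mpoly) set" where
  "syzygies i = chain_map rk A i ` free_module n (rk (Suc i))"

text \<open>Each step trades one syzygy module for one homological degree, that is, Tor_p(Syz_i) =
  Tor_(p+i)(Syz_0).\<close>

lemma syzygies_shift:
  "koszul_exact xv n (\<lambda>e. syzygies i \<inter> homog n (rk i) (sh i) e) p (e + int i)
   \<longleftrightarrow> koszul_exact xv n (\<lambda>e. syzygies 0 \<inter> homog n (rk 0) (sh 0) e) (p + i) e"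
proof (induction i arbitrary: p e)
  case (Suc i)
  have h: "hmatrix n (rk i) (sh i) (rk (Suc i)) (sh (Suc i)) (A i)"
    and k: "{v \<in> free_module n (rk (Suc i)). chain_map rk A i v = 0} = syzygies (Suc i)"
    and m: "\<forall>v\<in>free_module n (rk (Suc i)). chain_map rk A i v = 0 \<longrightarrow>
      (\<forall>l<rk (Suc i). lookup (v l) 0 = 0)"
    using chain by (auto simp: min_chain_def syzygies_def)
  have step: "koszul_exact xv n (\<lambda>e. syzygies (Suc i) \<inter> homog n (rk (Suc i)) (sh (Suc i)) e) p (e + int i + 1)
     \<longleftrightarrow> koszul_exact xv n (\<lambda>e. syzygies i \<inter> homog n (rk i) (sh i) e) (Suc p) (e + int i)"
    using exact_shift[OF h m, of p "e + int i"] unfolding k syzygies_def[of i] by blast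
  have eq: "e + int i + 1 = e + int (Suc i)" by simp
  show ?case using step[unfolded eq] Suc[of "Suc p" e] by simp
qed simp

text \<open>The degrees of basis elements at index i + 1 are those of minimal generators of the i-th
  syzygies; shifted back, they depend only on the image of the first map and not on the
  chain.\<close>

lemma chain_degrees:
  "(\<exists>l<rk (Suc i). sh (Suc i) l = j)
   \<longleftrightarrow> \<not> koszul_exact xv n (\<lambda>e. syzygies 0 \<inter> homog n (rk 0) (sh 0) e) i (int j - int i)"
proof -
  have h: "hmatrix n (rk i) (sh i) (rk (Suc i)) (sh (Suc i)) (A i)"
    and m: "\<forall>v\<in>free_module n (rk (Suc i)). chain_map rk A i v = 0 \<longrightarrow>
      (\<forall>l<rk (Suc i). lookup (v l) 0 = 0)"
    using chain by (auto simp: min_chain_def)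
  have "(\<exists>l<rk (Suc i). int (sh (Suc i) l) = int j)
     \<longleftrightarrow> \<not> koszul_exact xv n (\<lambda>e. syzygies i \<inter> homog n (rk i) (sh i) e) 0 (int j)"
    using exact_0_degrees[OF h m, of "int j"] unfolding syzygies_def by blast
  then show ?thesis using syzygies_shift[of i 0 "int j - int i"] by simp
qed

end

text \<open>The vanishing bound passes to syzygies, growing by 1 with each step, so covers can be
  taken repeatedly. It has to be known for all p at once, because every shift consumes one
  homological degree.\<close>

lemma min_chain_exists:
  fixes Z :: "(nat \<Rightarrow> 'k::field mpoly) set"
  assumes Z: "graded_submodule n r sh Z"
    and bounded: "\<And>p e. int R < e \<Longrightarrow> koszul_exact xv n (\<lambda>e. Z \<inter> homog n r sh e) p e"
  obtains rk shs A where "min_chain n rk shs A" "rk 0 = r" "shs 0 = sh"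
    "Z = mat_apply (rk 0) (rk 1) (A 0 :: nat \<Rightarrow> nat \<Rightarrow> 'k mpoly) ` free_module n (rk 1)"
proof -
  \<comment> \<open>A state holds the rank and shifts of a free module, the submodule to be covered
    next, and the matrix into the preceding module, which is a dummy at the start.\<close>
  define P where "P i x \<longleftrightarrow> (case x of (c, s, Y, B) \<Rightarrow> graded_submodule n c s Y \<and>
      (\<forall>p e. int (R + i) < e \<longrightarrow> koszul_exact xv n (\<lambda>e. Y \<inter> homog n c s e) p e) \<and>
      (i = 0 \<longrightarrow> c = r \<and> s = sh \<and> Y = Z))"
    for i :: nat and x :: "nat \<times> (nat \<Rightarrow> nat) \<times> (nat \<Rightarrow> 'k mpoly) set \<times> (nat \<Rightarrow> nat \<Rightarrow> 'k mpoly)"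
  define Q where "Q x y \<longleftrightarrow> (case x of (c, s, Y, B) \<Rightarrow> case y of (c', s', Y', B') \<Rightarrow>
      hmatrix n c s c' s' B' \<and> mat_apply c c' B' ` free_module n c' = Y \<and>
      Y' = {v \<in> free_module n c'. mat_apply c c' B' v = 0} \<and>
      (\<forall>v\<in>free_module n c'. mat_apply c c' B' v = 0 \<longrightarrow> (\<forall>l<c'. lookup (v l) 0 = 0)))"
    for x y :: "nat \<times> (nat \<Rightarrow> nat) \<times> (nat \<Rightarrow> 'k mpoly) set \<times> (nat \<Rightarrow> nat \<Rightarrow> 'k mpoly)"
  have "P 0 (r, sh, Z, \<lambda>_ _. 0)" using Z bounded by (simp add: P_def)
  moreover have "\<exists>y. P (Suc i) y \<and> Q x y" if Px: "P i x" for i x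
  proof -
    obtain c s Y B where x: "x = (c, s, Y, B)" by (cases x) auto
    have Y: "graded_submodule n c s Y"
      and bd: "\<And>p e. int (R + i) < e \<Longrightarrow> koszul_exact xv n (\<lambda>e. Y \<inter> homog n c s e) p e"
      using Px by (auto simp: P_def x)
    obtain c' s' B' where *: "hmatrix n c s c' s' B'" "mat_apply c c' B' ` free_module n c' = Y"
      "\<forall>v\<in>free_module n c'. mat_apply c c' B' v = 0 \<longrightarrow> (\<forall>l<c'. lookup (v l) 0 = 0)"
      using minimal_cover_exists[OF Y, of "R + i"] bd by blast
    let ?Y = "{v \<in> free_module n c'. mat_apply c c' B' v = 0}"
    have "graded_submodule n c' s' ?Y" by (rule mat_kernel_gs[OF *(1)])
    moreover have "koszul_exact xv n (\<lambda>e. ?Y \<inter> homog n c' s' e) p e" if "int (R + Suc i) < e" for p e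
    proof -
      have "koszul_exact xv n (\<lambda>e. Y \<inter> homog n c s e) (Suc p) (e - 1)" using that by (intro bd) simp
      then show ?thesis using exact_shift[OF *(1,3), of p "e - 1"] *(2) by simp
    qed
    ultimately have "P (Suc i) (c', s', ?Y, B')" by (simp add: P_def)
    moreover have "Q x (c', s', ?Y, B')" using * by (auto simp: Q_def x)
    ultimately show ?thesis by blast
  qed
  ultimately obtain f where f: "\<And>i. P i (f i)" "\<And>i. Q (f i) (f (Suc i))"
    using dependent_nat_choice[of P "\<lambda>i x y. Q x y"] by metis
  define rk where "rk i = fst (f i)" for i
  define shs where "shs i = fst (snd (f i))" for i
  define Y where "Y i = fst (snd (snd (f i)))" for i
  define A where "A i = snd (snd (snd (f (Suc i))))" for i
  have fi: "f i = (rk i, shs i, Y i, snd (snd (snd (f i))))" for i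
    by (simp add: rk_def shs_def Y_def)
  have Qi: "hmatrix n (rk i) (shs i) (rk (Suc i)) (shs (Suc i)) (A i)"
    "chain_map rk A i ` free_module n (rk (Suc i)) = Y i"
    "Y (Suc i) = {v \<in> free_module n (rk (Suc i)). chain_map rk A i v = 0}"
    "\<forall>v\<in>free_module n (rk (Suc i)). chain_map rk A i v = 0 \<longrightarrow>
       (\<forall>l<rk (Suc i). lookup (v l) 0 = 0)" for i
    using f(2)[of i] unfolding Q_def rk_def shs_def Y_def A_def by (auto simp: case_prod_unfold)
  have "rk 0 = r" "shs 0 = sh" "Y 0 = Z" using f(1)[of 0] fi[of 0] by (auto simp: P_def case_prod_unfold rk_def shs_def Y_def)
  moreover have "min_chain n rk shs A" unfolding min_chain_def using Qi by (metis (no_types, lifting))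
  ultimately show ?thesis using that[of rk shs A] Qi(2)[of 0] by simp
qed

section \<open>Resolutions of monomial ideals\<close>

lemma ideal_vecs_eq:
  assumes "P \<subseteq> expos n"
  shows "ideal_vecs n P = (\<lambda>p k. if k = 0 then p else 0 :: 'k::field mpoly) ` {p. keys p \<subseteq> P}"
proof (intro equalityI subsetI)
  fix v :: "nat \<Rightarrow> 'k mpoly" assume v: "v \<in> ideal_vecs n P"
  then have "v = (\<lambda>k. if k = 0 then v 0 else 0)"
    using free_module_outside[of v n 1] by (auto simp: ideal_vecs_def fun_eq_iff)
  then show "v \<in> (\<lambda>p k. if k = 0 then p else 0) ` {p. keys p \<subseteq> P}"
    using v by (auto simp: ideal_vecs_def)
next
  fix v :: "nat \<Rightarrow> 'k mpoly" assume "v \<in> (\<lambda>p k. if k = 0 then p else 0) ` {p. keys p \<subseteq> P}"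
  then show "v \<in> ideal_vecs n P"
    using assms by (auto simp: ideal_vecs_def poly_carrier_def intro!: free_moduleI)
qed

definition ideal_of :: "expo set \<Rightarrow> 'k::field mpoly set" where
  "ideal_of P = {p. keys p \<subseteq> P}"

text \<open>Placing the polynomial ring in front of a resolution turns the augmentation into the matrix of
  index \<open>0\<close>.\<close>

definition ext_rk :: "(nat \<Rightarrow> nat) \<Rightarrow> nat \<Rightarrow> nat" where
  "ext_rk rk i = (case i of 0 \<Rightarrow> 1 | Suc i \<Rightarrow> rk i)"

definition ext_sh :: "(nat \<Rightarrow> nat \<Rightarrow> nat) \<Rightarrow> nat \<Rightarrow> nat \<Rightarrow> nat" where
  "ext_sh sh i = (case i of 0 \<Rightarrow> \<lambda>_. 0 | Suc i \<Rightarrow> sh i)"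

definition ext_mat :: "(nat \<Rightarrow> 'k) \<Rightarrow> (nat \<Rightarrow> nat \<Rightarrow> nat \<Rightarrow> 'k) \<Rightarrow> nat \<Rightarrow> nat \<Rightarrow> nat \<Rightarrow> 'k" where
  "ext_mat g A i = (case i of 0 \<Rightarrow> \<lambda>_. g | Suc i \<Rightarrow> A i)"

lemma mat_apply_augmentation:
  "mat_apply (Suc 0) c (\<lambda>_. g) v = (\<lambda>k. if k = 0 then (\<Sum>l<c. g l * v l) else 0)"
  by (auto simp: mat_apply_def)

lemma lookup_mat_apply_0:
  assumes "\<And>k l. k < r \<Longrightarrow> l < c \<Longrightarrow> lookup (A k l) 0 = 0"
  shows "lookup (mat_apply r c A v k) 0 = 0"
  using assms by (auto simp: mat_apply_def lookup_sum lookup_mult_0 intro!: sum.neutral)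

text \<open>Every kernel is the image of the next matrix, whose entries have no constant terms; this
  turns entrywise minimality into the kernel form.\<close>

lemma resolution_min_chain:
  assumes res: "minimal_graded_free_resolution n (ideal_of P :: 'k::field mpoly set) rk sh g A" and P: "P \<subseteq> expos n"
  shows "min_chain n (ext_rk rk) (ext_sh sh) (ext_mat g A)"
    and "ideal_vecs n P = mat_apply (ext_rk rk 0) (ext_rk rk 1) (ext_mat g A 0) ` free_module n (ext_rk rk 1)"
proof -
  note r = res[unfolded minimal_graded_free_resolution_def]
  have g: "g l \<in> poly_carrier n" "m \<in> keys (g l) \<Longrightarrow> total_degree m = sh 0 l" if "l < rk 0" for l m
    using r that by (auto simp: carrier_poly_ring)
  have A: "A i k l \<in> poly_carrier n" "m \<in> keys (A i k l) \<Longrightarrow> sh i k + total_degree m = sh (Suc i) l"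
    "lookup (A i k l) 0 = 0" if "k < rk i" "l < rk (Suc i)" for i k l m
    using r that by (auto simp: carrier_poly_ring)
  have im: "(\<lambda>v. \<Sum>l<rk 0. g l * v l) ` free_module n (rk 0) = ideal_of P" using r by blast
  have ker0: "{v \<in> free_module n (rk 0). (\<Sum>l<rk 0. g l * v l) = 0} =
       mat_apply (rk 0) (rk 1) (A 0) ` free_module n (rk 1)" using r by blast
  have ker: "{v \<in> free_module n (rk (Suc i)). chain_map rk A i v = 0} =
       chain_map rk A (Suc i) ` free_module n (rk (Suc (Suc i)))" for i
    using r unfolding zero_fun_def by blast
  have kernel: "{v \<in> free_module n (ext_rk rk (Suc i)). chain_map (ext_rk rk) (ext_mat g A) i v = 0} =
       chain_map rk A i ` free_module n (rk (Suc i))" for i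
  proof (cases i)
    case 0
    have "mat_apply (Suc 0) (rk 0) (\<lambda>_. g) v = 0 \<longleftrightarrow> (\<Sum>l<rk 0. g l * v l) = 0" for v
      by (auto simp: mat_apply_augmentation fun_eq_iff)
    then show ?thesis using ker0 0 by (simp add: ext_rk_def ext_mat_def)
  qed (use ker in \<open>simp add: ext_rk_def ext_mat_def\<close>)
  show "min_chain n (ext_rk rk) (ext_sh sh) (ext_mat g A)"
    unfolding min_chain_def
  proof (intro allI conjI ballI impI)
    fix i
    show "hmatrix n (ext_rk rk i) (ext_sh sh i) (ext_rk rk (Suc i)) (ext_sh sh (Suc i)) (ext_mat g A i)"
      using g A by (cases i) (auto simp: hmatrix_def ext_rk_def ext_sh_def ext_mat_def)
    show "{v \<in> free_module n (ext_rk rk (Suc i)). chain_map (ext_rk rk) (ext_mat g A) i v = 0} =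
       chain_map (ext_rk rk) (ext_mat g A) (Suc i) ` free_module n (ext_rk rk (Suc (Suc i)))"
      unfolding kernel by (simp add: ext_rk_def ext_mat_def)
    fix v l assume "v \<in> free_module n (ext_rk rk (Suc i))"
      "chain_map (ext_rk rk) (ext_mat g A) i v = 0"
    then obtain w where "v = chain_map rk A i w" using kernel[of i] by blast
    then show "lookup (v l) 0 = 0" using A(3) by (simp add: lookup_mat_apply_0)
  qed
  have "mat_apply (Suc 0) (rk 0) (\<lambda>_. g) ` free_module n (rk 0)
      = (\<lambda>p k. if k = 0 then p else 0) ` (\<lambda>v. \<Sum>l<rk 0. g l * v l) ` free_module n (rk 0)"
    unfolding image_image by (intro image_cong refl) (simp add: mat_apply_augmentation fun_eq_iff)
  then show "ideal_vecs n P = mat_apply (ext_rk rk 0) (ext_rk rk 1) (ext_mat g A 0) ` free_module n (ext_rk rk 1)"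
    unfolding im ideal_vecs_eq[OF P] ideal_of_def by (simp add: ext_rk_def ext_mat_def)
qed

lemma resolution_degrees:
  assumes "minimal_graded_free_resolution n (ideal_of P :: 'k::field mpoly set) rk sh g A" "P \<subseteq> expos n"
  shows "(\<exists>k<rk i. sh i k = j)
    \<longleftrightarrow> \<not> koszul_exact xv n (ideal_part n P :: int \<Rightarrow> (nat \<Rightarrow> 'k mpoly) set) i (int j - int i)"
  using chain_degrees[OF resolution_min_chain(1)[OF assms], of i j] resolution_min_chain(2)[OF assms]
  by (simp add: syzygies_def[OF resolution_min_chain(1)[OF assms]] ext_rk_def ext_sh_def)

lemma resolution_exists:
  assumes P: "up_closed n P" and R: "\<And>m. m \<in> P \<Longrightarrow> R < total_degree m \<Longrightarrow> m - ev (Max (keys m)) \<in> P"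
  shows "\<exists>rk sh g A. minimal_graded_free_resolution n (ideal_of P :: 'k::field mpoly set) rk sh g A"
proof -
  have Pn: "P \<subseteq> expos n" using P by (simp add: up_closed_def)
  have gs: "graded_submodule n 1 (\<lambda>_. 0) (ideal_vecs n P :: (nat \<Rightarrow> 'k mpoly) set)"
    by (rule ideal_vecs_gs[OF P])
  have bounded: "koszul_exact xv n (ideal_part n P :: int \<Rightarrow> (nat \<Rightarrow> 'k mpoly) set) p e" if "int R < e" for p e
    by (rule ideal_exact_above[OF R that])
  obtain rk sh and A :: "nat \<Rightarrow> nat \<Rightarrow> nat \<Rightarrow> 'k mpoly" where ch: "min_chain n rk sh A"
    and rk0: "rk 0 = 1" and sh0: "sh 0 = (\<lambda>_. 0)"
    and im: "ideal_vecs n P = mat_apply (rk 0) (rk 1) (A 0) ` free_module n (rk 1)"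
    by (rule min_chain_exists[where R = R, OF gs], rule bounded, assumption, rule that)
  have h: "A i k l \<in> poly_carrier n" "m \<in> keys (A i k l) \<Longrightarrow> sh i k + total_degree m = sh (Suc i) l"
    if "k < rk i" "l < rk (Suc i)" for i k l m
    using ch that unfolding min_chain_def hmatrix_def by blast+
  have ker: "{v \<in> free_module n (rk (Suc i)). chain_map rk A i v = 0} =
       chain_map rk A (Suc i) ` free_module n (rk (Suc (Suc i)))" for i
    using ch unfolding min_chain_def by blast
  \<comment> \<open>A column of this matrix lies in the kernel of the preceding map, so the kernel
    form of minimality removes its constant terms.\<close>
  have const: "lookup (A (Suc i) k l) 0 = 0" if "k < rk (Suc i)" "l < rk (Suc (Suc i))" for i k l
  proof -
    let ?v = "chain_map rk A (Suc i) (unit_vec l)"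
    have "?v \<in> chain_map rk A (Suc i) ` free_module n (rk (Suc (Suc i)))"
      by (rule imageI[OF homog_free_module[OF unit_vec_homog[OF that(2), of n "\<lambda>_. 0"]]])
    then have "lookup (?v k) 0 = 0" using ch that(1) unfolding ker[symmetric] min_chain_def by blast
    then show ?thesis using that(1) unfolding mat_apply_unit_vec[OF that(2)] by simp
  qed
  have A0: "mat_apply (rk 0) c (A 0) v = (\<lambda>k. if k = 0 then (\<Sum>l<c. A 0 0 l * v l) else 0)" for c v
    by (auto simp: mat_apply_def rk0 fun_eq_iff)
  have "minimal_graded_free_resolution n (ideal_of P :: 'k mpoly set) (\<lambda>i. rk (Suc i)) (\<lambda>i. sh (Suc i)) (A 0 0) (\<lambda>i. A (Suc i))"
    unfolding minimal_graded_free_resolution_def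
  proof (intro conjI allI impI ballI)
    fix l assume l: "l < rk (Suc 0)"
    show "A 0 0 l \<in> carrier (poly_ring n)" using h(1)[of 0 0 l] l by (simp add: rk0 carrier_poly_ring)
    show "total_degree m = sh (Suc 0) l" if "m \<in> keys (A 0 0 l)" for m
      using h(2)[of 0 0 l m] l that by (simp add: rk0 sh0)
  next
    fix i k l assume kl: "k < rk (Suc i)" "l < rk (Suc (Suc i))"
    show "A (Suc i) k l \<in> carrier (poly_ring n)" using h(1)[OF kl] by (simp add: carrier_poly_ring)
    show "sh (Suc i) k + total_degree m = sh (Suc (Suc i)) l" if "m \<in> keys (A (Suc i) k l)" for m
      using h(2)[OF kl that] .
    show "lookup (A (Suc i) k l) 0 = 0" by (rule const[OF kl])
  next
    show "(\<lambda>v. \<Sum>l<rk (Suc 0). A 0 0 l * v l) ` free_module n (rk (Suc 0)) = ideal_of P"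
    proof -
      have "inj (\<lambda>p k. if k = (0::nat) then p else (0 :: 'k mpoly))" by (rule injI) (metis (full_types))
      moreover have "(\<lambda>p k. if k = 0 then p else 0) ` (\<lambda>v. \<Sum>l<rk (Suc 0). A 0 0 l * v l) ` free_module n (rk (Suc 0))
          = (\<lambda>p k. if k = (0::nat) then p else (0 :: 'k mpoly)) ` ideal_of P"
        using im unfolding ideal_vecs_eq[OF Pn] ideal_of_def image_image by (simp add: A0)
      ultimately show ?thesis by (simp add: inj_image_eq_iff)
    qed
    show "{v \<in> free_module n (rk (Suc 0)). (\<Sum>l<rk (Suc 0). A 0 0 l * v l) = 0} =
       mat_apply (rk (Suc 0)) (rk (Suc 1)) (A (Suc 0)) ` free_module n (rk (Suc 1))"
    proof -
      have "mat_apply (rk 0) (rk (Suc 0)) (A 0) v = 0 \<longleftrightarrow> (\<Sum>l<rk (Suc 0). A 0 0 l * v l) = 0" for v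
        by (auto simp: A0 fun_eq_iff)
      then show ?thesis using ker[of 0] by simp
    qed
  next
    fix i
    show "{v \<in> free_module n (rk (Suc (Suc i))). chain_map rk A (Suc i) v = (\<lambda>_. 0)} =
       chain_map rk A (Suc (Suc i)) ` free_module n (rk (Suc (Suc (Suc i))))"
      using ker[of "Suc i"] unfolding zero_fun_def .
  qed
  then show ?thesis by blast
qed

text \<open>Since \<open>betti\<close> is a choice over resolutions, it carries information only
  once a resolution exists. Whichever one is chosen, the degrees that occur are governed by Koszul
  exactness.\<close>

lemma betti_nonzero_iff:
  assumes P: "up_closed n P" and R: "\<And>m. m \<in> P \<Longrightarrow> R < total_degree m \<Longrightarrow> m - ev (Max (keys m)) \<in> P"
  shows "betti n (ideal_of P :: 'k::field mpoly set) i j \<noteq> 0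
    \<longleftrightarrow> \<not> koszul_exact xv n (ideal_part n P :: int \<Rightarrow> (nat \<Rightarrow> 'k mpoly) set) i (int j - int i)"
proof -
  let ?B = "\<lambda>b. \<exists>rk sh g A. minimal_graded_free_resolution n (ideal_of P :: 'k mpoly set) rk sh g A \<and>
    b = card {k. k < rk i \<and> sh i k = j}"
  have "\<exists>b. ?B b" using resolution_exists[OF P R] by blast
  then have "?B (betti n (ideal_of P :: 'k mpoly set) i j)" unfolding betti_def by (rule someI_ex)
  then obtain rk sh g A where res: "minimal_graded_free_resolution n (ideal_of P :: 'k mpoly set) rk sh g A"
    and b: "betti n (ideal_of P :: 'k mpoly set) i j = card {k. k < rk i \<and> sh i k = j}" by blast
  have "card {k. k < rk i \<and> sh i k = j} \<noteq> 0 \<longleftrightarrow> (\<exists>k<rk i. sh i k = j)" by auto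
  also have "\<dots> \<longleftrightarrow> \<not> koszul_exact xv n (ideal_part n P :: int \<Rightarrow> (nat \<Rightarrow> 'k mpoly) set) i (int j - int i)"
    using P by (intro resolution_degrees[OF res]) (simp add: up_closed_def)
  finally show ?thesis unfolding b .
qed

lemma regularity_ideal_of:
  assumes P: "up_closed n P" and R: "\<And>m. m \<in> P \<Longrightarrow> R < total_degree m \<Longrightarrow> m - ev (Max (keys m)) \<in> P"
    and m: "m \<in> P" "total_degree m = R" "m \<noteq> 0" "m - ev (Max (keys m)) \<notin> P"
  shows "regularity n (ideal_of P :: 'k::field mpoly set) = int R"
proof -
  let ?E = "\<lambda>i e. koszul_exact xv n (ideal_part n P :: int \<Rightarrow> (nat \<Rightarrow> 'k mpoly) set) i e"
  define M where "M = Max (keys m)"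
  have keys_ne: "keys m \<noteq> {}" using m(3) by simp
  have M_in: "M \<in> keys m" unfolding M_def using keys_ne by (intro Max_in) auto
  have M_ge: "i \<le> M" if "i \<in> keys m" for i unfolding M_def using that by simp
  have mn: "m \<in> expos n" using P m(1) by (auto simp: up_closed_def)
  then have Mn: "1 \<le> M" "M \<le> n" using M_in by (auto simp: expos_def)
  define w where "w = m - ev M"
  have wm: "w + ev M = m" unfolding w_def using expo_split[of m M] M_in by (simp add: in_keys_iff add.commute)
  have wk: "keys w \<subseteq> keys m" by (auto simp: w_def in_keys_iff lookup_minus)
  have "\<not> ?E (M - 1) (int R)"
  proof (rule ideal_not_exact)
    show "w \<in> expos n" using wk mn by (auto simp: expos_def)
    show "w \<notin> P" using m(4) by (simp add: w_def M_def)
    show "total_degree w + 1 = R" using total_degree_add[of w "ev M"] wm m(2) by simp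
    show "keys w \<subseteq> {..M}" using wk M_ge by auto
    \<comment> \<open>Here m x_l has degree above R and the same last variable x_M as m, so the
      hypothesis allows division by x_M, which leaves w x_l.\<close>
    show "w + ev l \<in> P" if l: "l \<in> {1..M}" for l
    proof -
      have "m + ev l \<in> P" using P m(1) ev_expos[of l n] l Mn by (auto simp: up_closed_def)
      moreover have "R < total_degree (m + ev l)" using m(2) by (simp add: total_degree_add)
      moreover have "Max (keys (m + ev l)) = M"
      proof (rule Max_eqI)
        show "M \<in> keys (m + ev l)" using M_in by (simp add: in_keys_iff lookup_add)
        show "y \<le> M" if "y \<in> keys (m + ev l)" for y
          using that keys_add[of m "ev l"] M_ge l by auto
      qed simp
      ultimately have "m + ev l - ev M \<in> P" using R by metis
      moreover have "m + ev l = w + ev l + ev M" unfolding wm[symmetric] by (simp add: add_ac)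
      ultimately show ?thesis by (simp only: add_diff_cancel_right')
    qed
  qed (use Mn in auto)
  let ?S = "{int j - int i | i j. betti n (ideal_of P :: 'k mpoly set) i j \<noteq> 0}"
  have nz: "betti n (ideal_of P :: 'k mpoly set) i j \<noteq> 0 \<longleftrightarrow> \<not> ?E i (int j - int i)" for i j
    by (rule betti_nonzero_iff[OF P R])
  have S: "e \<in> ?S \<longleftrightarrow> (\<exists>i j. e = int j - int i \<and> \<not> ?E i (int j - int i))" for e
    unfolding nz by blast
  have S_bounds: "0 \<le> e \<and> e \<le> int R" if e: "e \<in> ?S" for e
  proof -
    obtain i j where "e = int j - int i" "\<not> ?E i (int j - int i)" using e unfolding S by blast
    then have "\<not> ?E i e" by simp
    then have "\<not> int R < e" "\<not> e < 0"
      using ideal_exact_above[of P R e, OF R] ideal_exact_negative[of e n P] by blast+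
    then show ?thesis by simp
  qed
  have "int R \<in> ?S" unfolding S using \<open>\<not> ?E (M - 1) (int R)\<close>
    by (intro exI[of _ "M - 1"] exI[of _ "R + (M - 1)"]) auto
  moreover have "?S \<subseteq> {0..int R}"
    by (rule subsetI) (simp only: atLeastAtMost_iff S_bounds)
  then have "finite ?S" by (rule finite_subset) simp
  ultimately show ?thesis unfolding regularity_def
    using S_bounds by (intro Max_eqI) (simp_all only: S_bounds)
qed


section \<open>The combinatorics of \<open>\<^bold>d\<close>-decompositions\<close>

text \<open>Levels above s act as d = infinity: they let a monotone level function ignore all
  variables from some point on.\<close>

definition d_floor :: "(nat \<Rightarrow> nat) \<Rightarrow> nat \<Rightarrow> nat \<Rightarrow> nat \<Rightarrow> nat" where
  "d_floor d s J x = (if J \<le> s then d J * (x div d J) else 0)"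

text \<open>Each J gives a necessary condition for v to be divisible by a monomial reached from a,
  as a move takes a piece to a smaller index and hence to a finer level.\<close>

definition d_dominates :: "(nat \<Rightarrow> nat) \<Rightarrow> nat \<Rightarrow> nat \<Rightarrow> (nat \<Rightarrow> nat) \<Rightarrow> (nat \<Rightarrow> nat) \<Rightarrow> bool" where
  "d_dominates d s n a v \<longleftrightarrow>
     (\<forall>J. mono J \<longrightarrow> (\<Sum>l=1..n. d_floor d s (J l) (a l)) \<le> (\<Sum>l=1..n. d_floor d s (J l) (v l)))"

lemma dvd_gap_nat:
  fixes a b m :: nat
  assumes "m dvd a" "m dvd b" "a < b"
  shows "a + m \<le> b"
proof -
  obtain x y where "a = m * x" "b = m * y" using assms by (auto elim!: dvdE)
  then have "m * Suc x \<le> m * y" using assms(3) by (intro mult_le_mono2) (auto intro: Suc_leI)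
  then show ?thesis using \<open>a = m * x\<close> \<open>b = m * y\<close> by simp
qed

lemma mod_diff_nat:
  fixes a b m :: nat
  assumes "a \<le> b" "a mod m \<le> b mod m"
  shows "(b - a) mod m = b mod m - a mod m"
proof (cases "m = 0")
  case False
  have "b - a = m * (b div m - a div m) + (b mod m - a mod m)"
  proof -
    have "m * (a div m) \<le> m * (b div m)" using assms(1) by (intro mult_le_mono2 div_le_mono)
    moreover have "m * (b div m) + b mod m = b" "m * (a div m) + a mod m = a" by simp_all
    ultimately show ?thesis using assms(2) unfolding diff_mult_distrib2 by linarith
  qed
  moreover have "b mod m - a mod m < m" using False by (simp add: less_imp_diff_less)
  ultimately show ?thesis by simp
qed (use assms in simp)

lemma d_decomposition_d_coeff:
  assumes "d_sequence d s"
  shows "d_decomposition d s a (d_coeff d s a)"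
  unfolding d_coeff_def by (rule theI'[OF d_decomposition_unique[OF assms]])

lemma d_coeff_eqI:
  assumes "d_sequence d s" "d_decomposition d s a c"
  shows "d_coeff d s a = c"
  using d_decomposition_unique[OF assms(1), of a] d_decomposition_d_coeff[OF assms(1), of a] assms(2) by blast

section \<open>Digits and rounding\<close>

locale d_seq =
  fixes d :: "nat \<Rightarrow> nat" and s :: nat
  assumes d_seq: "d_sequence d s"
begin

abbreviation fl :: "nat \<Rightarrow> nat \<Rightarrow> nat" where "fl \<equiv> d_floor d s"
abbreviation dig :: "nat \<Rightarrow> nat \<Rightarrow> nat" where "dig \<equiv> d_coeff d s"

lemmas d_pos = d_sequence_pos[OF d_seq]
lemmas d_dvd = d_sequence_dvd[OF d_seq]

lemma d_0 [simp]: "d 0 = 1"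
  using d_seq by (simp add: d_sequence_def)

lemma d_mono: "J \<le> J' \<Longrightarrow> J' \<le> s \<Longrightarrow> d J \<le> d J'"
  using d_dvd[of J' J] d_pos[of J'] by (auto intro: dvd_imp_le)

lemma d_ge_1: "J \<le> s \<Longrightarrow> 1 \<le> d J"
  using d_pos[of J] by linarith

lemma fl_zero [simp]: "fl J 0 = 0"
  by (simp add: d_floor_def)

lemma fl_le: "fl J x \<le> x"
  by (simp add: d_floor_def)

lemma fl_high: "s < J \<Longrightarrow> fl J x = 0"
  by (simp add: d_floor_def)

lemma fl_add_mod: "J \<le> s \<Longrightarrow> fl J x + x mod d J = x"
  by (simp add: d_floor_def)

lemma less_fl: "J \<le> s \<Longrightarrow> x < fl J x + d J"
  using fl_add_mod[of J x] mod_less_divisor[OF d_pos[of J], of x] by linarith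

lemma fl_mono: "x \<le> y \<Longrightarrow> fl J x \<le> fl J y"
  by (simp add: d_floor_def div_le_mono)

lemma dvd_fl: "J \<le> J' \<Longrightarrow> J \<le> s \<Longrightarrow> d J dvd fl J' x"
  using d_dvd[of J' J] by (auto simp: d_floor_def)

lemma dvd_le_fl:
  assumes "J \<le> s" "d J dvd y" "y \<le> x"
  shows "y \<le> fl J x"
  using fl_mono[OF assms(3), of J] assms by (auto simp: d_floor_def)

lemma fl_anti:
  assumes "J \<le> J'"
  shows "fl J' x \<le> fl J x"
proof (cases "J' \<le> s")
  case True
  then show ?thesis using assms by (intro dvd_le_fl dvd_fl fl_le) auto
qed (simp add: fl_high)

lemma fl_superadd: "fl J x + fl J y \<le> fl J (x + y)"
proof (cases "J \<le> s")
  case True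
  then show ?thesis by (intro dvd_le_fl dvd_add dvd_fl add_mono fl_le) auto
qed (simp add: fl_high)

text \<open>The strict inequality from fl J x <= x < fl J' x + d J' is between multiples of
  \<open>d J\<close>, hence improves by \<open>d J\<close>. This is the exchange rate between levels
  behind the constants in D_q.\<close>

lemma fl_gap:
  assumes "J \<le> J'" "J' \<le> s"
  shows "fl J x + d J \<le> fl J' x + d J'"
proof (rule dvd_gap_nat)
  show "d J dvd fl J x" "d J dvd fl J' x + d J'" using assms by (auto intro!: dvd_add dvd_fl d_dvd)
  show "fl J x < fl J' x + d J'" using fl_le[of J x] less_fl[OF assms(2), of x] by linarith
qed

lemma fl_fl_add:
  assumes "t \<le> J" "t \<le> s" "c < d t"
  shows "fl J (fl t x + c) = fl J x"
proof (cases "J \<le> s")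
  case True
  obtain r where r: "d J = d t * r" using d_dvd[OF True assms(1)] by (auto elim: dvdE)
  have "(fl t x + c) div d t = x div d t" using assms(2,3) by (simp add: d_floor_def)
  then show ?thesis using True by (simp add: d_floor_def r div_mult2_eq)
qed (simp add: fl_high)

lemma fl_sub:
  assumes "J \<le> j" "j \<le> s" "d j \<le> x"
  shows "fl J (x - d j) + d j = fl J x"
proof -
  obtain r where r: "d j = d J * r" using d_dvd[OF assms(2,1)] by (auto elim: dvdE)
  obtain y where y: "x = y + r * d J" using assms(3) r by (metis le_add_diff_inverse2 mult.commute)
  have "x div d J = y div d J + r" using d_pos[of J] assms(1,2) by (simp add: y)
  then show ?thesis using assms(1,2) by (simp add: d_floor_def r y algebra_simps)
qed

lemma fl_sub_le:
  assumes "j \<le> J" "J \<le> s" "d j \<le> x"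
  shows "fl J x \<le> fl J (x - d j) + d J"
proof -
  have "fl J x - d J \<le> fl J (x - d j)"
    using assms fl_le[of J x] d_mono[of j J]
    by (intro dvd_le_fl dvd_diff_nat dvd_fl diff_le_mono2 diff_le_mono le_trans[OF diff_le_mono[OF fl_le[of J x]]]) auto
  then show ?thesis by linarith
qed

lemma dig_sum: "(\<Sum>t\<le>s. dig a t * d t) = a"
  using d_decomposition_d_coeff[OF d_seq, of a] by (simp add: d_decomposition_def)

lemma dig_less: "t < s \<Longrightarrow> dig a t < d (Suc t) div d t"
  using d_decomposition_d_coeff[OF d_seq, of a] by (simp add: d_decomposition_def)

lemma dig_high: "s < t \<Longrightarrow> dig a t = 0"
  using d_decomposition_d_coeff[OF d_seq, of a] by (simp add: d_decomposition_def)

lemma dig_0 [simp]: "dig 0 t = 0"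
proof -
  have "dig 0 = (\<lambda>_. 0)"
  proof (rule d_coeff_eqI[OF d_seq])
    have "0 < d (Suc t) div d t" if "t < s" for t
      using d_dvd[of "Suc t" t] d_pos[of "Suc t"] that by (auto elim: dvdE)
    then show "d_decomposition d s 0 (\<lambda>_. 0)" by (simp add: d_decomposition_def)
  qed
  then show ?thesis by simp
qed

lemma mod_eq_dig_sum: "J \<le> s \<Longrightarrow> x mod d J = (\<Sum>j<J. dig x j * d j)"
  by (rule d_decomposition_mod[OF d_seq d_decomposition_d_coeff[OF d_seq]])

lemma fl_eq_dig_sum:
  assumes "J \<le> s"
  shows "fl J x = (\<Sum>j=J..s. dig x j * d j)"
proof -
  have "{..s} = {..<J} \<union> {J..s}" using assms by auto
  then have "(\<Sum>j\<le>s. dig x j * d j) = (\<Sum>j<J. dig x j * d j) + (\<Sum>j=J..s. dig x j * d j)"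
    by (simp add: sum.union_disjoint ivl_disj_int)
  then show ?thesis using dig_sum[of x] mod_eq_dig_sum[OF assms, of x] fl_add_mod[OF assms, of x]
    by linarith
qed

text \<open>For t below b digit by digit, b - t is formed without borrowing, so the remainders
  modulo \<open>d J\<close> add up and rounding respects the splitting.\<close>

lemma fl_split_d_le:
  assumes "d_le d s t b"
  shows "fl J b = fl J t + fl J (b - t)"
proof (cases "J \<le> s")
  case True
  have le: "t \<le> b" by (rule d_le_imp_le[OF d_seq assms])
  have "t mod d J \<le> b mod d J" unfolding mod_eq_dig_sum[OF True]
    by (intro sum_mono mult_le_mono1) (use assms True in \<open>auto simp: d_le_def\<close>)
  then show ?thesis using mod_diff_nat[OF le, of "d J"] le fl_add_mod[OF True, of b]
      fl_add_mod[OF True, of t] fl_add_mod[OF True, of "b - t"] by linarith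
qed (simp add: fl_high)

lemma dig_sum_no_carry:
  assumes "\<And>t. t < s \<Longrightarrow> (\<Sum>l\<in>A. dig (c l) t) < d (Suc t) div d t"
  shows "dig (\<Sum>l\<in>A. c l) t = (\<Sum>l\<in>A. dig (c l) t)"
proof -
  have "dig (\<Sum>l\<in>A. c l) = (\<lambda>t. \<Sum>l\<in>A. dig (c l) t)"
  proof (rule d_coeff_eqI[OF d_seq], unfold d_decomposition_def, intro conjI allI impI)
    have "(\<Sum>l\<in>A. c l) = (\<Sum>l\<in>A. \<Sum>t\<le>s. dig (c l) t * d t)" by (simp add: dig_sum)
    also have "\<dots> = (\<Sum>t\<le>s. \<Sum>l\<in>A. dig (c l) t * d t)" by (rule sum.swap)
    finally show "(\<Sum>l\<in>A. c l) = (\<Sum>t\<le>s. (\<Sum>l\<in>A. dig (c l) t) * d t)" by (simp add: sum_distrib_right)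
  qed (use assms dig_high in auto)
  then show ?thesis by simp
qed

lemma dig_add_single:
  assumes j: "j \<le> s" and nc: "j < s \<Longrightarrow> Suc (dig x j) < d (Suc j) div d j"
  shows "dig (x + d j) = (dig x)(j := Suc (dig x j))"
proof (rule d_coeff_eqI[OF d_seq], unfold d_decomposition_def, intro conjI allI impI)
  have "(\<Sum>t\<le>s. ((dig x)(j := Suc (dig x j))) t * d t) = (\<Sum>t\<le>s. dig x t * d t + (if t = j then d j else 0))"
    by (intro sum.cong) auto
  also have "\<dots> = x + d j" using j by (simp add: sum.distrib dig_sum)
  finally show "x + d j = (\<Sum>t\<le>s. ((dig x)(j := Suc (dig x j))) t * d t)" by simp
qed (use assms dig_less dig_high in auto)

section \<open>Dominance is preserved by moves\<close>

abbreviation dom :: "nat \<Rightarrow> (nat \<Rightarrow> nat) \<Rightarrow> (nat \<Rightarrow> nat) \<Rightarrow> bool" where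
  "dom \<equiv> d_dominates d s"

lemma domD: "dom n a v \<Longrightarrow> mono J \<Longrightarrow> (\<Sum>l=1..n. fl (J l) (a l)) \<le> (\<Sum>l=1..n. fl (J l) (v l))"
  by (simp add: d_dominates_def)

lemma dom_up: "dom n a v \<Longrightarrow> (\<And>l. l \<in> {1..n} \<Longrightarrow> v l \<le> w l) \<Longrightarrow> dom n a w"
  unfolding d_dominates_def by (meson fl_mono le_trans sum_mono)

lemma sum_upd:
  fixes f :: "nat \<Rightarrow> 'b \<Rightarrow> 'c::comm_monoid_add"
  assumes "finite A" "i \<in> A"
  shows "(\<Sum>l\<in>A. f l ((v(i := x)) l)) = f i x + (\<Sum>l\<in>A - {i}. f l (v l))"
proof -
  have "(\<Sum>l\<in>A - {i}. f l ((v(i := x)) l)) = (\<Sum>l\<in>A - {i}. f l (v l))" by (intro sum.cong) auto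
  then show ?thesis using assms by (simp add: sum.remove[of A i])
qed

lemma sum_upd2:
  fixes f :: "nat \<Rightarrow> 'b \<Rightarrow> 'c::comm_monoid_add"
  assumes "finite A" "i \<in> A" "j \<in> A" "i \<noteq> j"
  shows "(\<Sum>l\<in>A. f l ((v(i := x, j := y)) l)) = f i x + f j y + (\<Sum>l\<in>A - {i, j}. f l (v l))"
proof -
  have "A - {j} - {i} = A - {i, j}" by auto
  then show ?thesis using sum_upd[of A j f "v(i := x)" y] sum_upd[of "A - {j}" i f v x] assms
    by (simp add: add_ac del: fun_upd_apply)
qed

text \<open>Taking t away at i costs exactly its rounding at level \<open>J i\<close>. At j it is
  rounded at a level that is no coarser, and rounding is superadditive, so at least this much is
  gained back.\<close>

lemma dom_move:
  assumes dom: "dom n a v" and ij: "1 \<le> j" "j < i" "i \<le> n" and t: "d_le d s t (v i)"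
  shows "dom n a (v(i := v i - t, j := v j + t))"
  unfolding d_dominates_def
proof (intro allI impI)
  fix J :: "nat \<Rightarrow> nat" assume J: "mono J"
  have "(\<Sum>l=1..n. fl (J l) (v l)) = (\<Sum>l=1..n. fl (J l) ((v(i := v i, j := v j)) l))" by simp
  also have "\<dots> = fl (J i) (v i) + fl (J j) (v j) + (\<Sum>l\<in>{1..n} - {i, j}. fl (J l) (v l))"
    using ij by (intro sum_upd2) auto
  also have "fl (J i) (v i) = fl (J i) t + fl (J i) (v i - t)" by (rule fl_split_d_le[OF t])
  also have "fl (J i) t \<le> fl (J j) t" using J ij by (intro fl_anti) (auto simp: mono_def)
  finally have "(\<Sum>l=1..n. fl (J l) (v l))
      \<le> fl (J i) (v i - t) + fl (J j) (v j + t) + (\<Sum>l\<in>{1..n} - {i, j}. fl (J l) (v l))"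
    using fl_superadd[of "J j" "v j" t] by linarith
  also have "\<dots> = (\<Sum>l=1..n. fl (J l) ((v(i := v i - t, j := v j + t)) l))"
    using ij by (intro sum_upd2[symmetric]) auto
  finally show "(\<Sum>l=1..n. fl (J l) (a l)) \<le> (\<Sum>l=1..n. fl (J l) ((v(i := v i - t, j := v j + t)) l))"
    using domD[OF dom J] by linarith
qed

section \<open>Distribution of pieces: sufficiency of dominance\<close>

lemma ex_top:
  assumes "0 < x"
  obtains j where "j \<le> s" "d j \<le> x" "\<And>J. j < J \<Longrightarrow> J \<le> s \<Longrightarrow> x < d J"
proof -
  let ?j = "Max {j. j \<le> s \<and> d j \<le> x}"
  have fin: "finite {j. j \<le> s \<and> d j \<le> x}" by simp
  have ne: "{j. j \<le> s \<and> d j \<le> x} \<noteq> {}" using assms by (auto intro!: exI[of _ 0])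
  have "?j \<in> {j. j \<le> s \<and> d j \<le> x}" using Max_in[OF fin ne] .
  moreover have "x < d J" if "?j < J" "J \<le> s" for J
    using Max_ge[OF fin, of J] that by (intro leI notI | simp add: not_le[symmetric])+
  ultimately show ?thesis using that by blast
qed

lemma fl_const_sum:
  fixes i n :: nat
  assumes "i \<in> {1..n}" "\<And>l. 1 \<le> l \<Longrightarrow> l < i \<Longrightarrow> a l = 0"
  shows "(\<Sum>l=1..n. fl (J l) (a l)) = fl (J i) (a i) + (\<Sum>l\<in>{i<..n}. fl (J l) (a l))"
proof -
  have eq: "{1..n} = {1..<i} \<union> ({i} \<union> {i<..n})" using assms(1) by auto
  have "(\<Sum>l=1..n. fl (J l) (a l)) = (\<Sum>l\<in>{1..<i}. fl (J l) (a l)) + (\<Sum>l\<in>{i} \<union> {i<..n}. fl (J l) (a l))"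
    unfolding eq by (rule sum.union_disjoint) auto
  also have "(\<Sum>l\<in>{1..<i}. fl (J l) (a l)) = 0" using assms(2) by simp
  finally show ?thesis by simp
qed

lemma sum_split_at:
  fixes f :: "nat \<Rightarrow> 'c::comm_monoid_add"
  assumes "i \<in> {1..n}"
  shows "(\<Sum>l=1..n. f l) = (\<Sum>l=1..i. f l) + (\<Sum>l\<in>{i<..n}. f l)"
proof -
  have eq: "{1..n} = {1..i} \<union> {i<..n}" using assms by auto
  show ?thesis unfolding eq by (rule sum.union_disjoint) auto
qed

text \<open>Below i there is nothing to dominate, so raising the levels there to \<open>J i\<close>
  keeps the left side and can only lower the right side. The worst level functions are constant on
  {1..i}.\<close>

lemma dom_constI:
  assumes i: "i \<in> {1..n}" and a0: "\<And>l. 1 \<le> l \<Longrightarrow> l < i \<Longrightarrow> a l = 0"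
    and le: "\<And>g J. mono J \<Longrightarrow> J i = g \<Longrightarrow>
      fl g (a i) + (\<Sum>l\<in>{i<..n}. fl (J l) (a l)) \<le> (\<Sum>l=1..i. fl g (v l)) + (\<Sum>l\<in>{i<..n}. fl (J l) (v l))"
  shows "dom n a v"
  unfolding d_dominates_def
proof (intro allI impI)
  fix J :: "nat \<Rightarrow> nat" assume J: "mono J"
  have "(\<Sum>l=1..n. fl (J l) (a l)) = fl (J i) (a i) + (\<Sum>l\<in>{i<..n}. fl (J l) (a l))"
    by (rule fl_const_sum[OF i a0])
  also have "\<dots> \<le> (\<Sum>l=1..i. fl (J i) (v l)) + (\<Sum>l\<in>{i<..n}. fl (J l) (v l))"
    by (rule le[OF J refl])
  also have "\<dots> \<le> (\<Sum>l=1..i. fl (J l) (v l)) + (\<Sum>l\<in>{i<..n}. fl (J l) (v l))"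
    using J by (intro add_right_mono sum_mono fl_anti) (auto simp: mono_def)
  also have "\<dots> = (\<Sum>l=1..n. fl (J l) (v l))" by (rule sum_split_at[OF i, symmetric])
  finally show "(\<Sum>l=1..n. fl (J l) (a l)) \<le> (\<Sum>l=1..n. fl (J l) (v l))" .
qed

lemma dom_constD:
  assumes dom: "dom n a v" and i: "i \<in> {1..n}" and a0: "\<And>l. 1 \<le> l \<Longrightarrow> l < i \<Longrightarrow> a l = 0"
    and J: "mono J" and g: "g \<le> J i"
  shows "fl g (a i) + (\<Sum>l\<in>{i<..n}. fl (J l) (a l)) \<le> (\<Sum>l=1..i. fl g (v l)) + (\<Sum>l\<in>{i<..n}. fl (J l) (v l))"
proof -
  let ?J = "\<lambda>l. if l \<le> i then g else J l"
  have mono: "mono ?J" using J g by (auto simp: mono_def intro: order_trans)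
  have "fl g (a i) + (\<Sum>l\<in>{i<..n}. fl (J l) (a l)) = fl (?J i) (a i) + (\<Sum>l\<in>{i<..n}. fl (?J l) (a l))"
    by simp
  also have "\<dots> = (\<Sum>l=1..n. fl (?J l) (a l))" by (rule fl_const_sum[OF i a0, symmetric])
  also have "\<dots> \<le> (\<Sum>l=1..n. fl (?J l) (v l))" by (rule domD[OF dom mono])
  also have "\<dots> = (\<Sum>l=1..i. fl (?J l) (v l)) + (\<Sum>l\<in>{i<..n}. fl (?J l) (v l))"
    by (rule sum_split_at[OF i])
  also have "\<dots> = (\<Sum>l=1..i. fl g (v l)) + (\<Sum>l\<in>{i<..n}. fl (J l) (v l))"
    by (intro arg_cong2[of _ _ _ _ "(+)"] sum.cong) auto
  finally show ?thesis .
qed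

text \<open>The largest piece \<open>d j\<close> of \<open>a i\<close> is put at a position \<open>l \<le> i\<close> where it breaks as small a
  unit \<open>d h\<close> of \<open>v l\<close> as possible.\<close>

lemma dom_piece:
  assumes dom: "dom n a v" and i: "i \<in> {1..n}" and a0: "\<And>l. 1 \<le> l \<Longrightarrow> l < i \<Longrightarrow> a l = 0"
    and j: "j \<le> s" "d j \<le> a i" "\<And>J. j < J \<Longrightarrow> J \<le> s \<Longrightarrow> a i < d J"
  obtains l where "l \<in> {1..i}" "d j \<le> v l" "dom n (a(i := a i - d j)) (v(l := v l - d j))"
proof -
  \<comment> \<open>\<open>ok h\<close> says that some v l with l <= i has a nonzero digit between
    levels j and h, so \<open>d j\<close> can be split off there by breaking a unit of level at most
    h.\<close>
  define ok where "ok h \<longleftrightarrow> j \<le> h \<and> h \<le> s \<and> (\<exists>l\<in>{1..i}. fl (Suc h) (v l) < fl j (v l))" for h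
  have top0: "fl g (a i) = 0" if "j < g" for g
  proof (cases "g \<le> s")
    case True
    then show ?thesis using j(3)[OF that] by (simp add: d_floor_def)
  qed (simp add: fl_high)
  have flj: "d j \<le> fl j (a i)" using j by (intro dvd_le_fl) auto
  have "ok s"
  proof -
    \<comment> \<open>Level s + 1 silences all variables after i, so that a full piece
      \<open>d j\<close> has to be visible among the first i.\<close>
    let ?J = "\<lambda>l. if l \<le> i then j else Suc s"
    have "mono ?J" using j by (auto simp: mono_def)
    then have "fl j (a i) + (\<Sum>l\<in>{i<..n}. fl (?J l) (a l))
        \<le> (\<Sum>l=1..i. fl j (v l)) + (\<Sum>l\<in>{i<..n}. fl (?J l) (v l))"
      by (intro dom_constD[OF dom i a0]) auto
    then have "d j \<le> (\<Sum>l=1..i. fl j (v l))" using flj by (simp add: fl_high)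
    then have "(\<Sum>l=1..i. fl j (v l)) \<noteq> 0" using d_pos[OF j(1)] by linarith
    then obtain l where "l \<in> {1..i}" "fl j (v l) \<noteq> 0" by (meson sum.neutral)
    then show ?thesis using j(1) by (auto simp: ok_def fl_high intro!: bexI[of _ l])
  qed
  define h where "h = (LEAST h. ok h)"
  have "ok h" unfolding h_def by (rule LeastI[of ok, OF \<open>ok s\<close>])
  then obtain l where h: "j \<le> h" "h \<le> s" and l: "l \<in> {1..i}" and hl: "fl (Suc h) (v l) < fl j (v l)"
    unfolding ok_def by blast
  have least: "fl g (v l') = fl j (v l')" if "j \<le> g" "g \<le> h" "l' \<in> {1..i}" for g l'
  proof (cases "g = j")
    case False
    then have "\<not> ok (g - 1)" using that not_less_Least[of "g - 1" ok] by (auto simp: h_def)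
    then have "fl j (v l') \<le> fl (Suc (g - 1)) (v l')" using that False h by (auto simp: ok_def not_less)
    then have "fl j (v l') \<le> fl g (v l')" using that False by simp
    then show ?thesis using fl_anti[OF that(1), of "v l'"] by simp
  qed simp
  have vl: "d j \<le> v l"
  proof -
    have "0 < fl j (v l)" using hl by simp
    then have "d j \<le> fl j (v l)" using dvd_fl[of j j "v l"] j(1) by (intro dvd_imp_le) auto
    then show ?thesis using fl_le[of j "v l"] by simp
  qed
  have "dom n (a(i := a i - d j)) (v(l := v l - d j))"
  proof (rule dom_constI[OF i])
    fix g and J :: "nat \<Rightarrow> nat" assume J: "mono J" "J i = g"
    let ?a = "a(i := a i - d j)" and ?v = "v(l := v l - d j)"
    let ?A = "\<Sum>l\<in>{i<..n}. fl (J l) (a l)" and ?V = "\<Sum>l\<in>{i<..n}. fl (J l) (v l)"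
    let ?R = "\<Sum>l'\<in>{1..i} - {l}. fl g (v l')"
    have A: "(\<Sum>l\<in>{i<..n}. fl (J l) (?a l)) = ?A" by (intro sum.cong) auto
    have V: "(\<Sum>l\<in>{i<..n}. fl (J l) (?v l)) = ?V" using l by (intro sum.cong) auto
    have S: "(\<Sum>l=1..i. fl g (?v l)) = fl g (v l - d j) + ?R"
      using l by (intro sum_upd[of _ _ "\<lambda>_. fl g"]) auto
    have S0: "(\<Sum>l=1..i. fl g (v l)) = fl g (v l) + ?R" using l by (intro sum.remove) auto
    have D: "fl g (a i) + ?A \<le> fl g (v l) + ?R + ?V"
      using dom_constD[OF dom i a0 J(1), of g] J(2) S0 by simp
    \<comment> \<open>For g <= j both sides lose \<open>d j\<close>. For g > h removing
      \<open>d j\<close> does not change v l rounded at level g. For j < g <= h all roundings of v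
      at level g agree with those at level j, where the piece of \<open>a i\<close> makes the
      inequality strict; divisibility by \<open>d g\<close> enlarges the slack to
      \<open>d g\<close>, and no more than that is lost.\<close>
    have "fl g (a i - d j) + ?A \<le> fl g (v l - d j) + ?R + ?V"
    proof (cases "g \<le> j")
      case True
      then show ?thesis using D fl_sub[OF True j(1,2)] fl_sub[OF True j(1) vl] by linarith
    next
      case False
      have a_top: "fl g (a i - d j) = 0" "fl g (a i) = 0"
        using top0[of g] False fl_mono[of "a i - d j" "a i" g] by auto
      show ?thesis
      proof (cases "g \<le> s")
        case True
        show ?thesis
        proof (cases "h < g")
          case True
          then have lt: "fl g (v l) < fl j (v l)" using hl fl_anti[of "Suc h" g "v l"] by simp
          have "fl g (v l) \<le> v l - d j"
          proof -
            have "d j dvd fl g (v l)" using False j(1) by (intro dvd_fl) auto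
            then have "fl g (v l) + d j \<le> fl j (v l)" using dvd_gap_nat[OF _ dvd_fl lt] j(1) by simp
            then show ?thesis using fl_le[of j "v l"] by linarith
          qed
          then have "fl g (v l) \<le> fl g (v l - d j)" using \<open>g \<le> s\<close> by (intro dvd_le_fl dvd_fl) auto
          then show ?thesis using D a_top by linarith
        next
          case g_h: False
          have eq: "fl g (v l') = fl j (v l')" if "l' \<in> {1..i}" for l'
            using least[of g l'] that False g_h by simp
          have "fl j (a i) + ?A \<le> (\<Sum>l=1..i. fl j (v l)) + ?V"
            using dom_constD[OF dom i a0 J(1), of j] J(2) False by simp
          also have "(\<Sum>l=1..i. fl j (v l)) = (\<Sum>l=1..i. fl g (v l))" using eq by (intro sum.cong) auto
          finally have "?A < fl g (v l) + ?R + ?V" using S0 flj d_pos[OF j(1)] by linarith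
          moreover have "d g dvd ?A" "d g dvd fl g (v l) + ?R + ?V"
            using J \<open>g \<le> s\<close> by (auto intro!: dvd_sum dvd_add dvd_fl simp: mono_def)
          ultimately have "?A + d g \<le> fl g (v l) + ?R + ?V" by (intro dvd_gap_nat)
          moreover have "fl g (v l) \<le> fl g (v l - d j) + d g"
            using False \<open>g \<le> s\<close> vl by (intro fl_sub_le) auto
          ultimately show ?thesis using a_top by linarith
        qed
      qed (use D a_top in \<open>simp add: fl_high\<close>)
    qed
    then show "fl g (?a i) + (\<Sum>l\<in>{i<..n}. fl (J l) (?a l))
        \<le> (\<Sum>l=1..i. fl g (?v l)) + (\<Sum>l\<in>{i<..n}. fl (J l) (?v l))"
      unfolding A V S by simp
  qed (use a0 in auto)
  then show ?thesis using that l vl by blast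
qed

text \<open>Induction on \<open>a i\<close>, placing one largest piece at a time. The digits of the
  parts add up to those of \<open>a i\<close> without carry, which is what later makes each transfer
  a legal move.\<close>

lemma dom_distribute:
  assumes "dom n a v" "i \<in> {1..n}" "\<And>l. 1 \<le> l \<Longrightarrow> l < i \<Longrightarrow> a l = 0"
  shows "\<exists>c. (\<forall>l. l \<notin> {1..i} \<longrightarrow> c l = 0) \<and> (\<forall>t. (\<Sum>l=1..i. dig (c l) t) = dig (a i) t) \<and>
    (\<forall>l. c l \<le> v l) \<and> dom n (a(i := 0)) (\<lambda>l. v l - c l)"
  using assms
proof (induction "a i" arbitrary: a v rule: less_induct)
  case less
  show ?case
  proof (cases "a i = 0")
    case True
    then have "a(i := 0) = a" by auto
    then show ?thesis using less.prems True by (intro exI[of _ "\<lambda>_. 0"]) auto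
  next
    case False
    then obtain j where j: "j \<le> s" "d j \<le> a i" "\<And>J. j < J \<Longrightarrow> J \<le> s \<Longrightarrow> a i < d J"
      using ex_top[of "a i"] by blast
    obtain l where l: "l \<in> {1..i}" "d j \<le> v l" "dom n (a(i := a i - d j)) (v(l := v l - d j))"
      using dom_piece[OF less.prems j] by blast
    let ?x = "a i - d j"
    \<comment> \<open>As \<open>d j\<close> is the largest piece that fits, \<open>a i\<close> is
      below \<open>d (Suc j)\<close>; putting the piece back therefore causes no carry.\<close>
    have nc: "Suc (dig ?x j) < d (Suc j) div d j" if "j < s"
    proof -
      have "dig ?x j * d j \<le> ?x" using dig_sum[of ?x] j(1)
        by (metis atMost_iff finite_atMost member_le_sum zero_le)
      then have "Suc (dig ?x j) * d j \<le> a i" using j(2) by simp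
      also have "\<dots> < d (Suc j)" using j(3)[of "Suc j"] that by simp
      also have "\<dots> = d (Suc j) div d j * d j" using d_dvd[of "Suc j" j] that by simp
      finally show ?thesis by (simp only: mult_less_cancel2)
    qed
    have dig_a: "dig (a i) = (dig ?x)(j := Suc (dig ?x j))"
      using dig_add_single[OF j(1) nc] j(2) by simp
    have "(a(i := ?x)) i < a i" using d_pos[OF j(1)] j(2) by simp
    from less.hyps[OF this l(3) less.prems(2)] less.prems(3)
    obtain c where c0: "\<forall>l. l \<notin> {1..i} \<longrightarrow> c l = 0" and c1: "\<forall>t. (\<Sum>l=1..i. dig (c l) t) = dig ?x t"
      and c2: "\<forall>l'. c l' \<le> (v(l := v l - d j)) l'"
      and c3: "dom n (a(i := 0)) (\<lambda>l'. (v(l := v l - d j)) l' - c l')" by auto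
    let ?c = "c(l := c l + d j)"
    have "dig (c l) j \<le> dig ?x j" using c1 l(1) member_le_sum[of l "{1..i}" "\<lambda>l. dig (c l) j"] by force
    then have nc': "j < s \<Longrightarrow> Suc (dig (c l) j) < d (Suc j) div d j" using nc by linarith
    have dig_c: "dig (c l + d j) = (dig (c l))(j := Suc (dig (c l) j))"
      by (rule dig_add_single[OF j(1) nc'])
    have "(\<Sum>l'=1..i. dig (?c l') t) = dig (a i) t" for t
    proof -
      have "(\<Sum>l'=1..i. dig (?c l') t) = (\<Sum>l'=1..i. dig (c l') t + (if l' = l \<and> t = j then 1 else 0))"
        by (intro sum.cong refl) (auto simp: dig_c)
      also have "\<dots> = dig ?x t + (if t = j then 1 else 0)"
        using l(1) c1 by (auto simp: sum.distrib)
      finally show ?thesis by (simp add: dig_a)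
    qed
    moreover have "?c l' \<le> v l'" for l' using c2[rule_format, of l'] l(2) by (cases "l' = l") auto
    moreover have "(\<lambda>l'. (v(l := v l - d j)) l' - c l') = (\<lambda>l'. v l' - ?c l')" by (auto simp: fun_eq_iff)
    ultimately show ?thesis using c0 c3 l(1) by (intro exI[of _ ?c]) auto
  qed
qed

text \<open>The parts are moved from i to 1, 2, ... in turn. Without carries, each part is digitwise
  below what still remains at i, so every step is allowed.\<close>

lemma move_pieces:
  assumes move: "\<And>w i j t. Q w \<Longrightarrow> 1 \<le> j \<Longrightarrow> j < i \<Longrightarrow> i \<le> n \<Longrightarrow> d_le d s t (w i)
      \<Longrightarrow> Q (w(i := w i - t, j := w j + t))"
    and Q: "Q w" and i: "i \<in> {1..n}"
    and c: "\<And>t. (\<Sum>l=1..i. dig (c l) t) = dig (w i) t"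
    and "k < i"
  shows "Q (\<lambda>l. if l \<in> {1..k} then w l + c l else if l = i then (\<Sum>l=Suc k..i. c l) else w l)"
  using \<open>k < i\<close>
proof (induction k)
  case 0
  have "dig (\<Sum>l=1..i. c l) t = dig (w i) t" for t
  proof -
    have "(\<Sum>l=1..i. dig (c l) t) < d (Suc t) div d t" if "t < s" for t
      unfolding c by (rule dig_less[OF that])
    then show ?thesis unfolding c[of t, symmetric] by (rule dig_sum_no_carry)
  qed
  then have "(\<Sum>l=1..i. c l) = w i" by (subst (1 2) dig_sum[symmetric]) (simp only:)
  then have "(\<lambda>l. if l \<in> {1..0} then w l + c l else if l = i then (\<Sum>l=Suc 0..i. c l) else w l) = w"
    by auto
  then show ?case using Q by simp
next
  case (Suc k)
  let ?w = "\<lambda>k l. if l \<in> {1..k} then w l + c l else if l = i then (\<Sum>l=Suc k..i. c l) else w l"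
  have w_i: "?w k i = (\<Sum>l=Suc k..i. c l)" using Suc.prems by simp
  have sum: "(\<Sum>l=Suc k..i. f l) = f (Suc k) + (\<Sum>l=Suc (Suc k)..i. f l)" for f :: "nat \<Rightarrow> nat"
    using Suc.prems by (intro sum.atLeast_Suc_atMost) auto
  have le: "(\<Sum>l=Suc k..i. dig (c l) t) \<le> dig (w i) t" for t
    unfolding c[symmetric] by (rule sum_mono2) auto
  have "dig (\<Sum>l=Suc k..i. c l) t = (\<Sum>l=Suc k..i. dig (c l) t)" for t
    by (rule dig_sum_no_carry) (use le le_less_trans dig_less in blast)
  then have "d_le d s (c (Suc k)) (?w k i)" unfolding w_i d_le_def by (simp add: sum)
  then have "Q ((?w k)(i := ?w k i - c (Suc k), Suc k := ?w k (Suc k) + c (Suc k)))"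
    using Suc i by (intro move) auto
  also have "(?w k)(i := ?w k i - c (Suc k), Suc k := ?w k (Suc k) + c (Suc k)) = ?w (Suc k)"
    unfolding w_i sum using Suc.prems by (auto simp: fun_eq_iff)
  finally show ?case .
qed

text \<open>The variables of u are treated in increasing order. After k of them the placed pieces c
  satisfy c <= v, and v - c still dominates the untreated rest, which vanishes up to k, as the
  distribution step requires. Later, Q is membership of a monomial in a given d-fixed ideal.\<close>

lemma dom_reachable:
  assumes move: "\<And>w i j t. Q w \<Longrightarrow> 1 \<le> j \<Longrightarrow> j < i \<Longrightarrow> i \<le> n \<Longrightarrow> d_le d s t (w i)
      \<Longrightarrow> Q (w(i := w i - t, j := w j + t))"
    and Q: "Q u" and dom: "dom n u v" and u: "\<And>l. l \<notin> {1..n} \<Longrightarrow> u l = 0"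
  shows "\<exists>w. Q w \<and> (\<forall>l. w l \<le> v l)"
proof -
  have "\<exists>c. (\<forall>l. l \<notin> {1..k} \<longrightarrow> c l = 0) \<and> (\<forall>l. c l \<le> v l) \<and>
      dom n (\<lambda>l. if l \<le> k then 0 else u l) (\<lambda>l. v l - c l) \<and> Q (\<lambda>l. if l \<le> k then c l else u l)"
    if "k \<le> n" for k
    using that
  proof (induction k)
    case 0
    have "(\<lambda>l. if l \<le> 0 then 0 else u l) = u" using u by auto
    then show ?case using dom Q by (intro exI[of _ "\<lambda>_. 0"]) auto
  next
    case (Suc k)
    let ?u = "\<lambda>k l. if l \<le> k then 0 else u l"
    obtain c where c: "\<And>l. l \<notin> {1..k} \<Longrightarrow> c l = 0" "\<And>l. c l \<le> v l"
      "dom n (?u k) (\<lambda>l. v l - c l)" "Q (\<lambda>l. if l \<le> k then c l else u l)"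
      using Suc by auto
    obtain b where b: "\<forall>l. l \<notin> {1..Suc k} \<longrightarrow> b l = 0"
      "\<forall>t. (\<Sum>l=1..Suc k. dig (b l) t) = dig (?u k (Suc k)) t"
      "\<forall>l. b l \<le> v l - c l" "dom n ((?u k)(Suc k := 0)) (\<lambda>l. v l - c l - b l)"
      using dom_distribute[OF c(3), of "Suc k"] Suc.prems by auto
    have "(?u k)(Suc k := 0) = ?u (Suc k)" by auto
    moreover have "(\<lambda>l. v l - c l - b l) = (\<lambda>l. v l - (c l + b l))" by auto
    moreover have "c l + b l \<le> v l" for l using b(3)[rule_format, of l] c(2)[of l] by linarith
    moreover have "Q (\<lambda>l. if l \<le> Suc k then c l + b l else u l)"
    proof -
      let ?w = "\<lambda>l. if l \<le> k then c l else u l"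
      have "Q (\<lambda>l. if l \<in> {1..k} then ?w l + b l else if l = Suc k then (\<Sum>l=Suc k..Suc k. b l) else ?w l)"
        by (rule move_pieces[where Q = Q]) (use move b(2) c(4) Suc.prems in auto)
      also have "(\<lambda>l. if l \<in> {1..k} then ?w l + b l else if l = Suc k then (\<Sum>l=Suc k..Suc k. b l) else ?w l)
          = (\<lambda>l. if l \<le> Suc k then c l + b l else u l)"
        using b(1) c(1) by (auto simp: fun_eq_iff le_Suc_eq)
      finally show ?thesis .
    qed
    ultimately show ?case using b c by (intro exI[of _ "\<lambda>l. c l + b l"]) auto
  qed
  from this[of n] obtain c where "\<forall>l. c l \<le> v l" "Q (\<lambda>l. if l \<le> n then c l else u l)" by auto
  then show ?thesis using u by (intro exI[of _ "\<lambda>l. if l \<le> n then c l else u l"]) auto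
qed

text \<open>If \<open>J\<close> is the top index of \<open>a k\<close>, this is the number \<open>D\<^sub>q\<close> with \<open>i\<^sub>q = k\<close>.\<close>

definition reg_term :: "(nat \<Rightarrow> nat) \<Rightarrow> nat \<Rightarrow> nat \<Rightarrow> nat" where
  "reg_term a k J = (\<Sum>l=1..k. fl J (a l)) + (k - 1) * (d J - 1)"

text \<open>Raising the level from J to t lowers each rounded exponent by at most d t - d J. With
  \<open>a 1 = 0\<close> only k - 1 exponents are affected, and the second summand compensates
  exactly this loss.\<close>

lemma reg_term_mono:
  assumes "a 1 = 0" "1 \<le> k" "J \<le> t" "t \<le> s"
  shows "reg_term a k J \<le> reg_term a k t"
proof -
  have eq: "(\<Sum>l=1..k. fl J' (a l)) = (\<Sum>l=2..k. fl J' (a l))" for J'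
    using assms(1,2) by (simp add: sum.atLeast_Suc_atMost numeral_2_eq_2)
  have "(\<Sum>l=2..k. fl J (a l)) \<le> (\<Sum>l=2..k. fl t (a l) + (d t - d J))"
  proof (rule sum_mono)
    fix l
    show "fl J (a l) \<le> fl t (a l) + (d t - d J)"
      using fl_gap[OF assms(3,4), of "a l"] d_mono[OF assms(3,4)] by linarith
  qed
  also have "\<dots> = (\<Sum>l=2..k. fl t (a l)) + (k - 1) * (d t - d J)"
    by (simp add: sum.distrib)
  finally have *: "(\<Sum>l=1..k. fl J (a l)) \<le> (\<Sum>l=1..k. fl t (a l)) + (k - 1) * (d t - d J)"
    unfolding eq .
  have "d t - 1 = (d t - d J) + (d J - 1)"
    using d_mono[OF assms(3,4)] d_ge_1[of J] assms(3,4) by linarith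
  then have "(k - 1) * (d t - 1) = (k - 1) * (d t - d J) + (k - 1) * (d J - 1)"
    by (simp add: algebra_simps)
  then show ?thesis using * by (simp add: reg_term_def)
qed

section \<open>Largest degree of a monomial minimal in its last variable\<close>

lemma sum_upto_Max:
  fixes f :: "nat \<Rightarrow> nat"
  assumes m: "m \<in> {1..n}" "f m > 0"
  obtains k where "k \<in> {m..n}" "f k > 0" "(\<Sum>l=1..n. f l) = (\<Sum>l=1..k. f l)"
proof -
  let ?S = "{l\<in>{1..n}. f l > 0}"
  have fin: "finite ?S" and mS: "m \<in> ?S" using m by auto
  have "Max ?S \<in> ?S" using fin mS by (intro Max_in) auto
  moreover have "m \<le> Max ?S" using fin mS by simp
  moreover have "(\<Sum>l=1..n. f l) = (\<Sum>l=1..Max ?S. f l)"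
  proof (rule sum.mono_neutral_right)
    show "\<forall>l\<in>{1..n} - {1..Max ?S}. f l = 0"
    proof (intro ballI, rule ccontr)
      fix l assume l: "l \<in> {1..n} - {1..Max ?S}" "f l \<noteq> 0"
      then have "l \<le> Max ?S" using fin by (intro Max_ge) auto
      then show False using l by auto
    qed
  qed (use \<open>Max ?S \<in> ?S\<close> in auto)
  ultimately show ?thesis using that by auto
qed

text \<open>A level function violated after division by x_m shows that v exceeds the demand of a by
  less than D = d (J m) after rounding. The rest of the degree of v consists of remainders, each
  smaller than its unit.\<close>

lemma dom_minimal_bound:
  assumes a1: "a 1 = 0" and dom: "dom n a v" and m: "m \<in> {1..n}" "0 < v m"
    and above: "\<And>l. m < l \<Longrightarrow> v l = 0" and not_dom: "\<not> dom n a (v(m := v m - 1))"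
  obtains k J where "k \<in> {1..n}" "J \<le> s" "0 < fl J (a k)" "(\<Sum>l=1..n. v l) \<le> reg_term a k J"
proof -
  let ?v = "v(m := v m - 1)"
  obtain J where J: "mono J" and lt: "(\<Sum>l=1..n. fl (J l) (?v l)) < (\<Sum>l=1..n. fl (J l) (a l))"
    using not_dom by (auto simp: d_dominates_def not_le)
  define A where "A = (\<Sum>l=1..n. fl (J l) (a l))"
  define B where "B = (\<Sum>l=1..n. fl (J l) (v l))"
  define R where "R = (\<Sum>l\<in>{1..n} - {m}. fl (J l) (v l))"
  define D where "D = d (J m)"
  have AB: "A \<le> B" unfolding A_def B_def by (rule domD[OF dom J])
  have B: "B = fl (J m) (v m) + R" unfolding B_def R_def using m by (intro sum.remove) auto
  have B': "(\<Sum>l=1..n. fl (J l) (?v l)) = fl (J m) (v m - 1) + R"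
    unfolding R_def using m by (intro sum_upd) auto
  have ne: "fl (J m) (v m - 1) \<noteq> fl (J m) (v m)" using lt AB B B' A_def by auto
  then have Jm: "J m \<le> s" using fl_high[of "J m"] by (metis not_le)
  \<comment> \<open>Lowering \<open>v m\<close> by 1 changes its rounding, which happens only at
    multiples of D. So x_m itself carries no remainder.\<close>
  have "D dvd v m"
  proof (rule ccontr)
    assume "\<not> D dvd v m"
    then have "v m div D = (v m - 1) div D" using m(2)
      by (cases "v m") (auto simp: div_Suc dvd_eq_mod_eq_0)
    then show False using ne Jm by (simp add: d_floor_def D_def)
  qed
  then have flm: "fl (J m) (v m) = v m" using Jm by (simp add: d_floor_def D_def)
  have "D \<le> v m" using \<open>D dvd v m\<close> m(2) by (rule dvd_imp_le)
  then have "v m - D \<le> fl (J m) (v m - 1)" 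
    using \<open>D dvd v m\<close> Jm d_pos[OF Jm] by (intro dvd_le_fl) (auto simp: D_def)
  then have "B < A + D" using lt B B' flm \<open>D \<le> v m\<close> unfolding A_def by linarith
  have Jle: "J 1 \<le> J l" if "1 \<le> l" for l using J that by (simp add: mono_def)
  have J1: "J 1 \<le> s" using Jle[of m] Jm m by simp
  \<comment> \<open>All terms are multiples of the finest unit \<open>d (J 1)\<close>. The gain of
    \<open>d (J 1)\<close> over the strict inequality is later spent on the remainder of
    x_1.\<close>
  have BA: "B + d (J 1) \<le> A + D"
  proof (rule dvd_gap_nat)
    show "d (J 1) dvd B" "d (J 1) dvd A + D" unfolding A_def B_def D_def
      using Jle J1 Jm m by (auto intro!: dvd_sum dvd_add dvd_fl d_dvd)
  qed (fact \<open>B < A + D\<close>)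
  define rem where "rem l = v l - fl (J l) (v l)" for l
  have v_sum: "(\<Sum>l=1..n. v l) = B + (\<Sum>l\<in>{1..<m}. rem l)"
  proof -
    have "(\<Sum>l=1..n. v l) = (\<Sum>l=1..n. fl (J l) (v l) + rem l)" by (simp add: rem_def fl_le)
    also have "\<dots> = B + (\<Sum>l=1..n. rem l)" by (simp add: B_def sum.distrib)
    also have "(\<Sum>l=1..n. rem l) = (\<Sum>l\<in>{1..<m}. rem l)"
      using m above flm by (intro sum.mono_neutral_right) (auto simp: rem_def not_less le_less)
    finally show ?thesis .
  qed
  have Jl_m: "J l \<le> J m" if "l \<le> m" for l using J that by (simp add: mono_def)
  have rem_le: "rem l \<le> d (J l) - 1" if "l \<le> m" for l
    using less_fl[of "J l" "v l"] Jl_m[OF that] Jm by (simp add: rem_def)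
  have ar: "fl (J l) (a l) + rem l \<le> fl (J m) (a l) + (D - 1)" if "l \<le> m" for l
    using fl_gap[OF Jl_m[OF that] Jm, of "a l"] rem_le[OF that] d_ge_1[of "J l"] Jl_m[OF that] Jm
    unfolding D_def by linarith
  \<comment> \<open>Passing from level \<open>J l\<close> to \<open>J m\<close> absorbs the
    remainder at the price of D - 1 for each variable before m. For x_1, where a vanishes, the
    remainder is at most d (J 1) - 1; this saves one D - 1 and pays for the summand D on the
    left.\<close>
  have key: "A + (\<Sum>l\<in>{1..<m}. rem l) + D \<le> (\<Sum>l=1..n. fl (J m) (a l)) + (m - 1) * (D - 1) + d (J 1)"
  proof -
    have split: "(\<Sum>l=1..n. f l) = (\<Sum>l\<in>{1..<m}. f l) + (\<Sum>l=m..n. f l)" for f :: "nat \<Rightarrow> nat"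
    proof -
      have eq: "{1..n} = {1..<m} \<union> {m..n}" using m by auto
      show ?thesis unfolding eq by (rule sum.union_disjoint) auto
    qed
    have high: "(\<Sum>l=m..n. fl (J l) (a l)) \<le> (\<Sum>l=m..n. fl (J m) (a l))"
      using J by (intro sum_mono fl_anti) (simp add: mono_def)
    show ?thesis
    proof (cases "m = 1")
      case True
      then show ?thesis using high split[of "\<lambda>l. fl (J l) (a l)"] split[of "\<lambda>l. fl (J m) (a l)"]
        by (simp add: A_def D_def)
    next
      case False
      then have m2: "2 \<le> m" using m by auto
      have eq: "{1..<m} = insert 1 {2..<m}" using m2 by auto
      have "(\<Sum>l\<in>{1..<m}. fl (J l) (a l) + rem l) = rem 1 + (\<Sum>l\<in>{2..<m}. fl (J l) (a l) + rem l)"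
        unfolding eq using a1 by simp
      also have "\<dots> \<le> (d (J 1) - 1) + (\<Sum>l\<in>{2..<m}. fl (J m) (a l) + (D - 1))"
        by (intro add_mono sum_mono ar rem_le) (use m in auto)
      also have "\<dots> = (d (J 1) - 1) + ((\<Sum>l\<in>{2..<m}. fl (J m) (a l)) + (m - 2) * (D - 1))"
        by (simp add: sum.distrib)
      also have "(\<Sum>l\<in>{2..<m}. fl (J m) (a l)) = (\<Sum>l\<in>{1..<m}. fl (J m) (a l))"
        unfolding eq using a1 by simp
      finally have low: "(\<Sum>l\<in>{1..<m}. fl (J l) (a l)) + (\<Sum>l\<in>{1..<m}. rem l)
          \<le> (d (J 1) - 1) + ((\<Sum>l\<in>{1..<m}. fl (J m) (a l)) + (m - 2) * (D - 1))"
        by (simp add: sum.distrib)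
      have "m - 1 = Suc (m - 2)" using m2 by simp
      then have "(m - 1) * (D - 1) = (m - 2) * (D - 1) + (D - 1)" by simp
      moreover have "1 \<le> D" "1 \<le> d (J 1)" unfolding D_def using d_ge_1 Jm J1 by auto
      ultimately show ?thesis
        using low high split[of "\<lambda>l. fl (J l) (a l)"] split[of "\<lambda>l. fl (J m) (a l)"]
        unfolding A_def by linarith
    qed
  qed
  have bound: "(\<Sum>l=1..n. v l) \<le> (\<Sum>l=1..n. fl (J m) (a l)) + (m - 1) * (D - 1)"
    using key BA v_sum by linarith
  \<comment> \<open>Otherwise a has no demand from m on, and setting the levels there above s would
    show that v satisfies the violated inequality even after the division.\<close>
  have "\<exists>l\<in>{m..n}. 0 < fl (J m) (a l)"
  proof (rule ccontr)
    assume no: "\<not> ?thesis"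
    let ?J = "\<lambda>l. if l < m then J l else max (J l) (Suc s)"
    have mono: "mono ?J"
    proof (rule monoI)
      fix x y :: nat assume "x \<le> y"
      then show "?J x \<le> ?J y" using monoD[OF J \<open>x \<le> y\<close>] by auto
    qed
    have a0: "fl (J l) (a l) = 0" if "l \<in> {m..n}" for l
      using no that fl_anti[of "J m" "J l" "a l"] J by (auto simp: mono_def)
    have "A = (\<Sum>l=1..n. fl (?J l) (a l))"
      unfolding A_def using a0 by (intro sum.cong) (auto simp: fl_high)
    also have "\<dots> \<le> (\<Sum>l=1..n. fl (?J l) (v l))" by (rule domD[OF dom mono])
    also have "\<dots> \<le> (\<Sum>l=1..n. fl (J l) (?v l))"
      by (intro sum_mono) (auto simp: fl_high)
    finally show False using lt A_def by simp
  qed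
  then obtain l where l: "l \<in> {m..n}" "0 < fl (J m) (a l)" by blast
  then have "l \<in> {1..n}" using m by auto
  from sum_upto_Max[of l n "\<lambda>l. fl (J m) (a l)", OF this l(2)] obtain k where
    k: "k \<in> {l..n}" "0 < fl (J m) (a k)" "(\<Sum>l=1..n. fl (J m) (a l)) = (\<Sum>l=1..k. fl (J m) (a l))" .
  have "(m - 1) * (D - 1) \<le> (k - 1) * (D - 1)" using k l by (intro mult_le_mono1) auto
  then have "(\<Sum>l=1..n. v l) \<le> reg_term a k (J m)" using bound k(3) unfolding reg_term_def D_def by linarith
  then show ?thesis using that[of k "J m"] k l m Jm by auto
qed

text \<open>Maximality of (q, t) serves twice: it excludes demand at level t beyond q, and it bounds
  the demand at all finer levels.\<close>

lemma dom_extremal: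
  assumes a1: "a 1 = 0" and q: "q \<in> {1..n}" and t: "t \<le> s" and pos: "0 < fl t (a q)"
    and max: "\<And>k J. k \<in> {1..n} \<Longrightarrow> J \<le> s \<Longrightarrow> 0 < fl J (a k) \<Longrightarrow> reg_term a k J \<le> reg_term a q t"
  obtains v where "dom n a v" "0 < v q" "\<And>l. l \<notin> {1..q} \<Longrightarrow> v l = 0"
    "(\<Sum>l=1..n. v l) = reg_term a q t" "\<not> dom n a (v(q := v q - 1))"
proof -
  \<comment> \<open>Chosen to make the preceding estimates sharp: each variable before q carries the
    largest remainder invisible at level t, and x_q carries none.\<close>
  define v where "v l = (if l \<in> {1..<q} then fl t (a l) + (d t - 1) else if l = q then fl t (a q) else 0)" for l
  have dt: "1 \<le> d t" by (rule d_ge_1[OF t])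
  \<comment> \<open>A later variable with a nonzero rounding would enlarge the sum and the factor k
    - 1 does not shrink, against maximality.\<close>
  have beyond: "fl t (a l) = 0" if "l \<in> {q<..n}" for l
  proof (rule ccontr)
    assume "fl t (a l) \<noteq> 0"
    then have le: "reg_term a l t \<le> reg_term a q t" using that t q by (intro max) auto
    have "(\<Sum>k=1..l. fl t (a k)) = (\<Sum>k=1..q. fl t (a k)) + (\<Sum>k\<in>{q<..l}. fl t (a k))"
      using that q by (intro sum_split_at) auto
    moreover have "fl t (a l) \<le> (\<Sum>k\<in>{q<..l}. fl t (a k))"
      using that by (intro member_le_sum) auto
    moreover have "(q - 1) * (d t - 1) \<le> (l - 1) * (d t - 1)" using that by (intro mult_le_mono1) auto
    ultimately show False using le \<open>fl t (a l) \<noteq> 0\<close> unfolding reg_term_def by linarith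
  qed
  have a_le_v: "a l \<le> v l" if "l \<in> {1..<q}" for l
    using that less_fl[OF t, of "a l"] dt by (simp add: v_def)
  have eq_q: "{1..q} = insert q {1..<q}" using q by auto
  have total: "(\<Sum>l=1..n. v l) = reg_term a q t"
  proof -
    have "(\<Sum>l=1..n. v l) = (\<Sum>l=1..q. v l)"
      using q by (intro sum.mono_neutral_right) (auto simp: v_def)
    also have "\<dots> = fl t (a q) + (\<Sum>l\<in>{1..<q}. fl t (a l) + (d t - 1))"
      unfolding eq_q by (simp add: v_def)
    also have "\<dots> = (\<Sum>l=1..q. fl t (a l)) + (q - 1) * (d t - 1)"
      unfolding eq_q by (simp add: sum.distrib)
    finally show ?thesis by (simp add: reg_term_def)
  qed
  have dom: "dom n a v" unfolding d_dominates_def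
  proof (intro allI impI)
    fix J :: "nat \<Rightarrow> nat" assume J: "mono J"
    show "(\<Sum>l=1..n. fl (J l) (a l)) \<le> (\<Sum>l=1..n. fl (J l) (v l))"
    proof (cases "t \<le> J q")
      case True
      show ?thesis
      proof (rule sum_mono)
        fix l assume l: "l \<in> {1..n}"
        consider "l < q" | "l = q" | "q < l" by linarith
        then show "fl (J l) (a l) \<le> fl (J l) (v l)"
        proof cases
          case 1
          then show ?thesis using a_le_v l by (intro fl_mono) auto
        next
          case 2
          then show ?thesis using fl_fl_add[OF True t, of 0 "a q"] dt by (simp add: v_def)
        next
          case 3
          then have "t \<le> J l" using True J by (meson le_trans less_imp_le monoD)
          then show ?thesis using beyond[of l] fl_anti[of t "J l" "a l"] 3 l by auto
        qed
      qed
    next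
      case False
      define K where "K = J q"
      have K: "K < t" "K \<le> s" using False t by (auto simp: K_def)
      have dK: "1 \<le> d K" "d K \<le> d t" using K t d_ge_1 d_mono by auto
      \<comment> \<open>Maximality, applied at the last variable with demand at level K, bounds the
        total demand at level K. The termwise comparison after it transfers this bound from the
        constant level K to J.\<close>
      have "(\<Sum>l=1..n. fl K (a l)) \<le> (\<Sum>l=1..q. fl t (a l)) + (q - 1) * (d t - d K)"
      proof -
        have "0 < fl K (a q)" using pos fl_anti[of K t "a q"] K by simp
        from sum_upto_Max[of q n "\<lambda>l. fl K (a l)", OF q this] obtain k where
          k: "k \<in> {q..n}" "0 < fl K (a k)" "(\<Sum>l=1..n. fl K (a l)) = (\<Sum>l=1..k. fl K (a l))" .
        have "reg_term a k K \<le> reg_term a q t" using k q K by (intro max) auto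
        moreover have "(q - 1) * (d K - 1) \<le> (k - 1) * (d K - 1)" using k by (intro mult_le_mono1) auto
        moreover have "(q - 1) * (d t - 1) = (q - 1) * (d t - d K) + (q - 1) * (d K - 1)"
        proof -
          have "d t - 1 = (d t - d K) + (d K - 1)" using dK by simp
          then show ?thesis by (simp add: algebra_simps)
        qed
        ultimately show ?thesis using k(3) unfolding reg_term_def by linarith
      qed
      moreover have "(\<Sum>l=1..n. fl (J l) (a l)) + ((\<Sum>l=1..q. fl t (a l)) + (q - 1) * (d t - d K))
          \<le> (\<Sum>l=1..n. fl K (a l)) + (\<Sum>l=1..n. fl (J l) (v l))"
      proof -
        \<comment> \<open>On {1..n} this is v rounded at level K, because d t - 1 rounds to d t - d
          K.\<close>
        define b where "b l = (if l < q then fl t (a l) + (d t - d K) else if l = q then fl t (a q) else 0)" for l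
        have "(\<Sum>l=1..n. b l) = (\<Sum>l=1..q. b l)"
          using q by (intro sum.mono_neutral_right) (auto simp: b_def)
        also have "\<dots> = fl t (a q) + (\<Sum>l\<in>{1..<q}. fl t (a l) + (d t - d K))"
          unfolding eq_q by (simp add: b_def)
        also have "\<dots> = (\<Sum>l=1..q. fl t (a l)) + (q - 1) * (d t - d K)"
          unfolding eq_q by (simp add: sum.distrib)
        finally have b: "(\<Sum>l=1..n. b l) = (\<Sum>l=1..q. fl t (a l)) + (q - 1) * (d t - d K)" .
        have "(\<Sum>l=1..n. fl (J l) (a l) + b l) \<le> (\<Sum>l=1..n. fl K (a l) + fl (J l) (v l))"
        proof (rule sum_mono)
          fix l assume l: "l \<in> {1..n}"
          consider "l < q" | "l = q" | "q < l" by linarith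
          then show "fl (J l) (a l) + b l \<le> fl K (a l) + fl (J l) (v l)"
          proof cases
            case 1
            have JK: "J l \<le> K" using 1 J by (simp add: K_def mono_def)
            have "d (J l) \<le> d t" "1 \<le> d (J l)" using JK K t d_ge_1[of "J l"] by (auto intro: d_mono)
            have "fl t (a l) + (d t - d (J l)) \<le> fl (J l) (v l)"
            proof (rule dvd_le_fl)
              show "d (J l) dvd fl t (a l) + (d t - d (J l))"
                using JK K t by (intro dvd_add dvd_fl dvd_diff_nat d_dvd) auto
              show "fl t (a l) + (d t - d (J l)) \<le> v l" using 1 l \<open>1 \<le> d (J l)\<close> by (simp add: v_def)
            qed (use JK K in simp)
            then show ?thesis
              using 1 fl_gap[OF JK K(2), of "a l"] \<open>d (J l) \<le> d t\<close> dK by (simp add: b_def)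
          next
            case 2
            have "fl t (a q) \<le> fl K (v q)" using K t by (intro dvd_le_fl dvd_fl) (auto simp: v_def)
            then show ?thesis using 2 by (simp add: b_def K_def)
          next
            case 3
            then show ?thesis using fl_anti[of K "J l" "a l"] J by (simp add: b_def K_def mono_def)
          qed
        qed
        then show ?thesis using b by (simp add: sum.distrib)
      qed
      ultimately show ?thesis by linarith
    qed
  qed
  have not_dom: "\<not> dom n a (v(q := v q - 1))"
  proof
    assume *: "dom n a (v(q := v q - 1))"
    \<comment> \<open>At these levels v meets the demand with equality, since its remainders are
      invisible; lowering the multiple \<open>v q\<close> of \<open>d t\<close> breaks the
      inequality.\<close>
    let ?J = "\<lambda>l. if l \<le> q then t else Suc s"
    have mono: "mono ?J" using t by (auto simp: mono_def)
    have eq: "(\<Sum>l=1..n. fl (?J l) (f l)) = fl t (f q) + (\<Sum>l\<in>{1..<q}. fl t (f l))" for f :: "nat \<Rightarrow> nat"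
    proof -
      have "(\<Sum>l=1..n. fl (?J l) (f l)) = (\<Sum>l=1..q. fl (?J l) (f l))"
        using q by (intro sum.mono_neutral_right) (auto simp: fl_high)
      then show ?thesis unfolding eq_q by simp
    qed
    have "fl t (v l) = fl t (a l)" if "l \<in> {1..<q}" for l
      using that fl_fl_add[of t t "d t - 1" "a l"] t dt by (simp add: v_def)
    moreover have "fl t (fl t (a q) - 1) < fl t (a q)" using pos fl_le[of t "fl t (a q) - 1"] by linarith
    ultimately show False using domD[OF * mono] unfolding eq by (simp add: v_def)
  qed
  have "v l = 0" if "l \<notin> {1..q}" for l using that q by (auto simp: v_def)
  moreover have "0 < v q" using pos by (simp add: v_def)
  ultimately show ?thesis using that[of v] dom total not_dom by blast
qed

end


section \<open>Principal \<open>\<^bold>d\<close>-fixed ideals\<close>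

lemma keys_uminus_mpoly: "keys (- p) = keys p" for p :: "'k::field mpoly"
  by (auto simp: in_keys_iff)

lemma ideal_of_ideal:
  assumes P: "up_closed n P"
  shows "ideal (ideal_of P :: 'k::field mpoly set) (poly_ring n)"
proof -
  let ?R = "poly_ring n :: 'k mpoly ring"
  interpret cring ?R by (rule cring_poly_ring)
  have Pn: "P \<subseteq> expos n" using P by (simp add: up_closed_def)
  have sub: "(ideal_of P :: 'k mpoly set) \<subseteq> poly_carrier n"
    using Pn by (auto simp: ideal_of_def poly_carrier_def)
  have mult: "p * q \<in> ideal_of P" if "p \<in> ideal_of P" "q \<in> poly_carrier n" for p q :: "'k mpoly"
  proof -
    have "a + b \<in> P" if "a \<in> keys p" "b \<in> keys q" for a b
      using P \<open>p \<in> ideal_of P\<close> poly_carrierD[OF \<open>q \<in> poly_carrier n\<close>] that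
      by (auto simp: up_closed_def ideal_of_def)
    then show ?thesis using keys_mult[of p q] by (auto simp: ideal_of_def)
  qed
  show ?thesis
  proof (rule idealI)
    show "ring ?R" by (rule ring_axioms)
    show "subgroup (ideal_of P) (add_monoid ?R)"
    proof
      show "ideal_of P \<subseteq> carrier (add_monoid ?R)" using sub by (simp add: carrier_poly_ring)
      show "\<one>\<^bsub>add_monoid ?R\<^esub> \<in> ideal_of P" by (simp add: poly_ring_def ideal_of_def)
      show "p \<otimes>\<^bsub>add_monoid ?R\<^esub> q \<in> ideal_of P" if "p \<in> ideal_of P" "q \<in> ideal_of P" for p q
        using that keys_add[of p q] by (auto simp: poly_ring_def ideal_of_def)
      show "inv\<^bsub>add_monoid ?R\<^esub> p \<in> ideal_of P" if "p \<in> ideal_of P" for p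
      proof -
        have "p \<in> poly_carrier n" using that sub by blast
        then have "- p \<in> carrier ?R" "p \<in> carrier ?R" using poly_carrier_uminus by (auto simp: carrier_poly_ring)
        then have "\<ominus>\<^bsub>?R\<^esub> p = - p" by (intro minus_equality) (auto simp: poly_ring_def)
        then show ?thesis using that unfolding a_inv_def by (simp add: ideal_of_def keys_uminus_mpoly)
      qed
    qed
    show "q \<otimes>\<^bsub>?R\<^esub> p \<in> ideal_of P" "p \<otimes>\<^bsub>?R\<^esub> q \<in> ideal_of P" if "p \<in> ideal_of P" "q \<in> carrier ?R" for p q
      using mult[OF that(1), of q] that(2) by (auto simp: poly_ring_def poly_carrier_def mult.commute)
  qed
qed

lemma poly_sum_monomials: "p = (\<Sum>m\<in>keys p. Poly_Mapping.single 0 (lookup p m) * monomial m)" for p :: "'k::field mpoly"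
proof (rule poly_mapping_eqI)
  fix m
  have "lookup (\<Sum>m\<in>keys p. Poly_Mapping.single 0 (lookup p m) * monomial m) m
      = (\<Sum>m'\<in>keys p. if m' = m then lookup p m else 0)"
    by (auto simp: lookup_sum monomial_def mult_single lookup_single when_def intro!: sum.cong)
  then show "lookup p m = lookup (\<Sum>m\<in>keys p. Poly_Mapping.single 0 (lookup p m) * monomial m) m"
    by (simp add: in_keys_iff)
qed

lemma ideal_of_subset:
  assumes J: "ideal J (poly_ring n :: 'k::field mpoly ring)" and mon: "\<And>m. m \<in> P \<Longrightarrow> monomial m \<in> J"
  shows "ideal_of P \<subseteq> J"
proof
  interpret ideal J "poly_ring n :: 'k mpoly ring" by (rule J)
  fix p :: "'k mpoly" assume p: "p \<in> ideal_of P"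
  have add: "a + b \<in> J" if "a \<in> J" "b \<in> J" for a b
    using additive_subgroup.a_closed[OF is_additive_subgroup that] by (simp add: poly_ring_def)
  have zero: "0 \<in> J" using additive_subgroup.zero_closed[OF is_additive_subgroup] by (simp add: poly_ring_def)
  have "(\<Sum>m\<in>A. Poly_Mapping.single 0 (lookup p m) * monomial m) \<in> J" if "A \<subseteq> keys p" for A
    using that
  proof (induction A rule: infinite_finite_induct)
    case (insert m A)
    have "m \<in> P" using insert.prems p by (auto simp: ideal_of_def)
    moreover have "Poly_Mapping.single 0 (lookup p m) \<in> carrier (poly_ring n)"
      unfolding carrier_poly_ring by (rule poly_carrier_single[OF zero_expos])
    ultimately have "Poly_Mapping.single 0 (lookup p m) * monomial m \<in> J"
      using I_l_closed[OF mon] by (simp add: poly_ring_def)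
    then show ?case using insert by (simp add: add)
  qed (auto simp: zero)
  from this[OF subset_refl] show "p \<in> J" by (simp add: poly_sum_monomials[symmetric])
qed

lemma monomial_in_ideal_of [simp]: "monomial m \<in> (ideal_of P :: 'k::field mpoly set) \<longleftrightarrow> m \<in> P"
  by (simp add: ideal_of_def monomial_def)

lemma ideal_of_genideal:
  assumes P: "up_closed n P"
  shows "ideal_of P = genideal (poly_ring n) (monomial ` P :: 'k::field mpoly set)"
proof
  show "ideal_of P \<subseteq> genideal (poly_ring n) (monomial ` P :: 'k mpoly set)"
    unfolding genideal_def
  proof (rule Inter_greatest)
    fix J :: "'k mpoly set" assume "J \<in> {J. ideal J (poly_ring n) \<and> monomial ` P \<subseteq> J}"
    then show "ideal_of P \<subseteq> J" by (intro ideal_of_subset[of J n]) auto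
  qed
  show "genideal (poly_ring n) (monomial ` P :: 'k mpoly set) \<subseteq> ideal_of P"
    unfolding genideal_def using ideal_of_ideal[OF P] by (intro Inter_lower) auto
qed

lemma lookup_move:
  assumes "t \<le> lookup v i" "i \<noteq> j"
  shows "lookup (v - Poly_Mapping.single i t + Poly_Mapping.single j t) = (lookup v)(i := lookup v i - t, j := lookup v j + t)"
  using assms by (auto simp: fun_eq_iff lookup_add lookup_minus lookup_single when_def)

lemma move_expos:
  assumes "v \<in> expos n" "j \<in> {1..n}"
  shows "v - Poly_Mapping.single i t + Poly_Mapping.single j t \<in> expos n"
proof -
  have "keys (v - Poly_Mapping.single i t + Poly_Mapping.single j t) \<subseteq> insert j (keys v)"
    by (auto simp: in_keys_iff lookup_add lookup_minus lookup_single when_def split: if_splits)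
  then show ?thesis using assms by (auto simp: expos_def)
qed

section \<open>The principal ideal as a dominance ideal\<close>

context d_seq
begin

definition dom_set :: "nat \<Rightarrow> expo \<Rightarrow> expo set" where
  "dom_set n u = {m \<in> expos n. dom n (lookup u) (lookup m)}"

lemma dom_set_up_closed: "up_closed n (dom_set n u)"
  unfolding up_closed_def dom_set_def
  by (auto intro: expos_add elim!: dom_up simp: lookup_add)

lemma dom_set_d_fixed: "d_fixed n d s (ideal_of (dom_set n u) :: 'k::field mpoly set)"
  unfolding d_fixed_def
proof (intro conjI ballI impI allI)
  show "monomial_ideal n (ideal_of (dom_set n u) :: 'k mpoly set)"
    unfolding monomial_ideal_def ideal_of_genideal[OF dom_set_up_closed]
    by (intro exI[of _ "dom_set n u"]) (auto simp: dom_set_def)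
  fix v i j t assume v: "v \<in> expos n" "monomial v \<in> (ideal_of (dom_set n u) :: 'k mpoly set)"
    and ij: "1 \<le> j \<and> j < i \<and> i \<le> n \<and> d_le d s t (lookup v i)"
  have t: "t \<le> lookup v i" using d_le_imp_le[OF d_seq] ij by blast
  have "dom n (lookup u) (lookup (v - Poly_Mapping.single i t + Poly_Mapping.single j t))"
    unfolding lookup_move[OF t, of j] using ij v
    by (subst lookup_move[OF t]) (auto intro!: dom_move simp: dom_set_def)
  then show "monomial (v - Poly_Mapping.single i t + Poly_Mapping.single j t) \<in> (ideal_of (dom_set n u) :: 'k mpoly set)"
    using move_expos[OF v(1), of j] ij by (simp add: dom_set_def)
qed

text \<open>The dominance ideal is one of the intersected ideals. Conversely, a d-fixed ideal
  containing u contains everything reached from u by moves, and each dominating monomial is a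
  multiple of such a monomial.\<close>

lemma principal_d_fixed_eq:
  assumes u: "u \<in> expos n"
  shows "principal_d_fixed n d s u = (ideal_of (dom_set n u) :: 'k::field mpoly set)"
proof
  have "u \<in> dom_set n u" using u by (simp add: dom_set_def d_dominates_def)
  then show "principal_d_fixed n d s u \<subseteq> (ideal_of (dom_set n u) :: 'k mpoly set)"
    unfolding principal_d_fixed_def using dom_set_d_fixed by (intro Inter_lower) auto
  show "(ideal_of (dom_set n u) :: 'k mpoly set) \<subseteq> principal_d_fixed n d s u"
    unfolding principal_d_fixed_def
  proof (rule Inter_greatest)
    fix I :: "'k mpoly set" assume I: "I \<in> {I. d_fixed n d s I \<and> monomial u \<in> I}"
    then have fixed: "d_fixed n d s I" and uI: "monomial u \<in> I" by auto
    interpret R: cring "poly_ring n :: 'k mpoly ring" by (rule cring_poly_ring)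
    obtain M where M: "M \<subseteq> expos n" "I = genideal (poly_ring n) (monomial ` M)"
      using fixed by (auto simp: d_fixed_def monomial_ideal_def)
    have "monomial ` M \<subseteq> carrier (poly_ring n :: 'k mpoly ring)"
      unfolding carrier_poly_ring using M(1) by (auto simp: monomial_def intro!: poly_carrier_single)
    then have ideal: "ideal I (poly_ring n)" unfolding M(2) by (rule R.genideal_ideal)
    show "ideal_of (dom_set n u) \<subseteq> I"
    proof (rule ideal_of_subset[OF ideal])
      fix v assume v: "v \<in> dom_set n u"
      \<comment> \<open>Reachability is phrased for exponent functions, so membership in I is
        transported along \<open>lookup\<close>; this Q is closed under moves because I is
        d-fixed.\<close>
      define Q where "Q w \<longleftrightarrow> (\<exists>m\<in>expos n. lookup m = w \<and> monomial m \<in> I)" for w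
      have "\<exists>w. Q w \<and> (\<forall>l. w l \<le> lookup v l)"
      proof (rule dom_reachable)
        show "Q (lookup u)" using u uI by (auto simp: Q_def)
        show "dom n (lookup u) (lookup v)" using v by (simp add: dom_set_def)
        show "lookup u l = 0" if "l \<notin> {1..n}" for l using u that by (auto simp: expos_def in_keys_iff)
        fix w i j t assume "Q w" and ij: "1 \<le> j" "j < i" "i \<le> n" and t: "d_le d s t (w i)"
        then obtain m where m: "m \<in> expos n" "lookup m = w" "monomial m \<in> I" by (auto simp: Q_def)
        have "monomial (m - Poly_Mapping.single i t + Poly_Mapping.single j t) \<in> I"
          using fixed m ij t unfolding d_fixed_def by blast
        moreover have "lookup (m - Poly_Mapping.single i t + Poly_Mapping.single j t) = w(i := w i - t, j := w j + t)"
          using lookup_move[of t m i j] d_le_imp_le[OF d_seq t] ij m(2) by simp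
        ultimately show "Q (w(i := w i - t, j := w j + t))"
          unfolding Q_def using move_expos[OF m(1), of j] ij by (intro bexI[of _ "m - Poly_Mapping.single i t + Poly_Mapping.single j t"]) auto
      qed
      then obtain m where m: "m \<in> expos n" "monomial m \<in> I" "\<And>l. lookup m l \<le> lookup v l"
        by (auto simp: Q_def)
      have "v - m \<in> expos n" using v by (auto simp: dom_set_def expos_def in_keys_iff lookup_minus)
      then have "monomial (v - m) \<in> carrier (poly_ring n :: 'k mpoly ring)"
        unfolding carrier_poly_ring monomial_def by (rule poly_carrier_single)
      then have "monomial (v - m) * monomial m \<in> I"
        using ideal.I_l_closed[OF ideal m(2)] by (simp add: poly_ring_def)
      moreover have "v - m + m = v" using m(3) by (intro poly_mapping_eqI) (simp add: lookup_add lookup_minus)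
      ultimately show "monomial v \<in> I" by (simp add: monomial_def mult_single)
    qed
  qed
qed

section \<open>Regularity of principal d-fixed ideals\<close>

lemma lookup_sub_ev: "lookup (m - ev i) = (lookup m)(i := lookup m i - 1)"
  by (auto simp: fun_eq_iff lookup_minus lookup_single when_def)

lemma total_degree_expos: "m \<in> expos n \<Longrightarrow> total_degree m = (\<Sum>l=1..n. lookup m l)"
  by (rule total_degree_eq) (auto simp: expos_def)

lemma sub_ev_expos: "m \<in> expos n \<Longrightarrow> m - ev i \<in> expos n"
  by (auto simp: expos_def in_keys_iff lookup_minus subset_iff)

lemma regularity_principal:
  assumes u: "u \<in> expos n" "lookup u 1 = 0" and q: "q \<in> {1..n}" and t: "t \<le> s" "0 < fl t (lookup u q)"
    and max: "\<And>k J. k \<in> {1..n} \<Longrightarrow> J \<le> s \<Longrightarrow> 0 < fl J (lookup u k)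
      \<Longrightarrow> reg_term (lookup u) k J \<le> reg_term (lookup u) q t"
  shows "regularity n (principal_d_fixed n d s u :: 'k::field mpoly set) = int (reg_term (lookup u) q t)"
proof -
  let ?a = "lookup u" let ?R = "reg_term (lookup u) q t"
  obtain v where v: "dom n ?a v" "0 < v q" "\<And>l. l \<notin> {1..q} \<Longrightarrow> v l = 0"
    "(\<Sum>l=1..n. v l) = ?R" "\<not> dom n ?a (v(q := v q - 1))"
    using dom_extremal[OF u(2) q t max] by blast
  define m where "m = (\<Sum>l=1..q. Poly_Mapping.single l (v l))"
  have lm: "lookup m = v"
  proof
    fix l
    have "lookup m l = (\<Sum>i=1..q. if i = l then v l else 0)"
      by (auto simp: m_def lookup_sum lookup_single when_def intro!: sum.cong)
    then show "lookup m l = v l" using v(3)[of l] by simp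
  qed
  have keys_m: "keys m \<subseteq> {1..q}"
  proof (rule subsetI, rule ccontr)
    fix l assume "l \<in> keys m" "l \<notin> {1..q}"
    then show False using v(3)[of l] by (simp add: in_keys_iff lm del: atLeastAtMost_iff)
  qed
  have mn: "m \<in> expos n" using keys_m q by (auto simp: expos_def)
  have qm: "q \<in> keys m" using v(2) by (simp add: in_keys_iff lm)
  have Max_m: "Max (keys m) = q" using qm keys_m by (intro Max_eqI) auto
  show ?thesis unfolding principal_d_fixed_eq[OF u(1)]
  proof (rule regularity_ideal_of[OF dom_set_up_closed])
    show "m \<in> dom_set n u" using mn v(1) by (simp add: dom_set_def lm)
    show "total_degree m = ?R" using total_degree_expos[OF mn] v(4) by (simp add: lm)
    show "m \<noteq> 0" using qm by auto
    show "m - ev (Max (keys m)) \<notin> dom_set n u"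
      using v(5) unfolding Max_m by (simp add: dom_set_def lookup_sub_ev lm)
    fix x assume x: "x \<in> dom_set n u" "?R < total_degree x"
    define M where "M = Max (keys x)"
    have xn: "x \<in> expos n" and xd: "dom n ?a (lookup x)" using x(1) by (auto simp: dom_set_def)
    have "keys x \<noteq> {}" using x(2) by (auto simp: total_degree_def)
    then have M: "M \<in> keys x" unfolding M_def by (intro Max_in) auto
    have "dom n ?a ((lookup x)(M := lookup x M - 1))"
    proof (rule ccontr)
      assume nd: "\<not> ?thesis"
      have "M \<in> {1..n}" using M xn unfolding expos_def by blast
      moreover have "0 < lookup x M" using M by (simp add: in_keys_iff)
      moreover have "lookup x l = 0" if "M < l" for l
      proof (rule ccontr)
        assume "lookup x l \<noteq> 0"
        then have "l \<le> M" unfolding M_def by (intro Max_ge) (auto simp: in_keys_iff)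
        then show False using that by simp
      qed
      ultimately obtain k J where "k \<in> {1..n}" "J \<le> s" "0 < fl J (?a k)" "(\<Sum>l=1..n. lookup x l) \<le> reg_term ?a k J"
        by (rule dom_minimal_bound[OF u(2) xd _ _ _ nd])
      then show False using max[of k J] x(2) total_degree_expos[OF xn] by simp
    qed
    then show "x - ev (Max (keys x)) \<in> dom_set n u"
      using sub_ev_expos[OF xn] unfolding M_def by (simp add: dom_set_def lookup_sub_ev)
  qed
qed

lemma top_index:
  assumes "0 < a"
  shows "top_index d s a \<le> s" "d_coeff d s a (top_index d s a) \<noteq> 0"
    "\<And>j. d_coeff d s a j \<noteq> 0 \<Longrightarrow> j \<le> top_index d s a"
proof -
  let ?S = "{j. j \<le> s \<and> dig a j \<noteq> 0}"
  have fin: "finite ?S" by simp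
  have "?S \<noteq> {}"
  proof
    assume "?S = {}"
    then have "(\<Sum>t\<le>s. dig a t * d t) = 0" by (intro sum.neutral) auto
    then show False using dig_sum[of a] assms by simp
  qed
  then have "top_index d s a \<in> ?S" unfolding top_index_def using Max_in[OF fin] by blast
  then show "top_index d s a \<le> s" "dig a (top_index d s a) \<noteq> 0" by auto
  show "j \<le> top_index d s a" if "dig a j \<noteq> 0" for j
  proof -
    have "j \<le> s" using dig_high[of j a] that by (cases "s < j") auto
    then show ?thesis unfolding top_index_def using that by (intro Max_ge fin) simp
  qed
qed

text \<open>Determines which levels compete in the maximum for a given variable; together with
  \<open>reg_term_mono\<close> it singles out the top index s_q.\<close>

lemma fl_pos_iff:
  assumes "0 < a" "J \<le> s"
  shows "0 < fl J a \<longleftrightarrow> J \<le> top_index d s a"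
proof
  assume "0 < fl J a"
  then have "(\<Sum>j=J..s. dig a j * d j) \<noteq> 0"
    unfolding fl_eq_dig_sum[OF assms(2)] by (rule gr_implies_not0)
  then obtain j where "j \<in> {J..s}" "dig a j * d j \<noteq> 0" by (rule sum.not_neutral_contains_not_neutral)
  then show "J \<le> top_index d s a" using top_index(3)[OF assms(1), of j] by auto
next
  let ?t = "top_index d s a"
  assume "J \<le> ?t"
  then have "dig a ?t * d ?t \<le> (\<Sum>j=J..s. dig a j * d j)"
    using top_index(1)[OF assms(1)] by (intro member_le_sum) auto
  moreover have "0 < dig a ?t * d ?t" using top_index(1,2)[OF assms(1)] d_pos by simp
  ultimately show "0 < fl J a" using fl_eq_dig_sum[OF assms(2), of a] by linarith
qed

lemma tail_sum_eq:
  assumes pos: "\<And>e. e \<in> {1..q} \<Longrightarrow> 0 < \<alpha> e" and t: "t \<le> s"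
  shows "tail_sum d s \<alpha> q t = (\<Sum>e=1..q. fl t (\<alpha> e))"
  unfolding tail_sum_def
proof (rule sum.cong[OF refl])
  fix e assume e: "e \<in> {1..q}"
  note ti = top_index[OF pos[OF e]]
  have "dig (\<alpha> e) j = 0" if "top_index d s (\<alpha> e) < j" for j
    using ti(3)[of j] that by (cases "dig (\<alpha> e) j = 0") auto
  then have "(\<Sum>j=t..top_index d s (\<alpha> e). dig (\<alpha> e) j * d j) = (\<Sum>j=t..s. dig (\<alpha> e) j * d j)"
    using ti(1) by (intro sum.mono_neutral_left) auto
  then show "(\<Sum>j=t..top_index d s (\<alpha> e). dig (\<alpha> e) j * d j) = fl t (\<alpha> e)"
    by (simp add: fl_eq_dig_sum[OF t])
qed

text \<open>Only the variables with index i_q have positive exponents in u, and a level that is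
  nonzero there is at most s_q. By monotonicity in the level, the maximum over all pairs of a
  variable and a level is reached at some (i_q, s_q), where its value is D_q.\<close>

lemma regularity_principal_D_num:
  fixes i \<alpha> :: "nat \<Rightarrow> nat"
  assumes r: "1 \<le> r" and i: "strict_mono_on {1..r} i" "2 \<le> i 1" "i r = n" and \<alpha>: "\<forall>q\<in>{1..r}. 0 < \<alpha> q"
  shows "regularity n (principal_d_fixed n d s (\<Sum>q=1..r. Poly_Mapping.single (i q) (\<alpha> q)) :: 'k::field mpoly set)
    = int (Max (D_num d s i \<alpha> ` {1..r}))"
proof -
  define u where "u = (\<Sum>q=1..r. Poly_Mapping.single (i q) (\<alpha> q))"
  have inj: "inj_on i {1..r}" using i(1) by (rule strict_mono_on_imp_inj_on)
  have mono: "i e \<le> i q" if "e \<in> {1..r}" "q \<in> {1..r}" "e \<le> q" for e q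
    using that i(1) by (cases "e = q") (auto simp: strict_mono_on_def intro: less_imp_le)
  have smono: "i e < i q" if "e \<in> {1..r}" "q \<in> {1..r}" "e < q" for e q
    using that i(1) by (auto simp: strict_mono_on_def)
  have range: "2 \<le> i q" "i q \<le> n" if "q \<in> {1..r}" for q
    using mono[of 1 q] mono[of q r] that i r by auto
  have u_i: "lookup u (i q) = \<alpha> q" if q: "q \<in> {1..r}" for q
  proof -
    have "lookup (Poly_Mapping.single (i e) (\<alpha> e)) (i q) = (if e = q then \<alpha> q else 0)" if "e \<in> {1..r}" for e
      using inj_onD[OF inj, of e q] that q by (cases "e = q") (auto simp: lookup_single when_def)
    then have "lookup u (i q) = (\<Sum>e=1..r. if e = q then \<alpha> q else 0)"
      unfolding u_def lookup_sum by (rule sum.cong[OF refl])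
    then show ?thesis using q by simp
  qed
  have u_0: "lookup u l = 0" if "l \<notin> i ` {1..r}" for l
    unfolding u_def lookup_sum using that by (intro sum.neutral) (auto simp: lookup_single when_def)
  have un: "u \<in> expos n"
  proof -
    have "l \<in> {1..n}" if "l \<in> keys u" for l
    proof -
      have "l \<in> i ` {1..r}" using that u_0[of l] by (auto simp: in_keys_iff)
      then obtain q where "q \<in> {1..r}" "l = i q" by blast
      then show ?thesis using range[of q] by auto
    qed
    then show ?thesis by (auto simp: expos_def)
  qed
  have u1: "lookup u 1 = 0" by (rule u_0) (use range in force)
  have D: "D_num d s i \<alpha> q = reg_term (lookup u) (i q) (top_index d s (\<alpha> q))" if q: "q \<in> {1..r}" for q
  proof -
    let ?t = "top_index d s (\<alpha> q)"
    have t: "?t \<le> s" using top_index(1) \<alpha> q by blast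
    have sub: "i ` {1..q} \<subseteq> {1..i q}" using range mono q by fastforce
    have "(\<Sum>l=1..i q. fl ?t (lookup u l)) = (\<Sum>l\<in>i ` {1..q}. fl ?t (lookup u l))"
    proof (rule sum.mono_neutral_right)
      show "\<forall>l\<in>{1..i q} - i ` {1..q}. fl ?t (lookup u l) = 0"
      proof
        fix l assume l: "l \<in> {1..i q} - i ` {1..q}"
        have "l \<notin> i ` {1..r}"
        proof
          assume "l \<in> i ` {1..r}"
          then obtain e where e: "e \<in> {1..r}" "l = i e" by blast
          then have "q < e" using l by (auto simp: not_le[symmetric])
          then show False using smono[OF q e(1)] l e(2) by auto
        qed
        then show "fl ?t (lookup u l) = 0" by (simp add: u_0)
      qed
    qed (use sub in auto)
    also have "\<dots> = (\<Sum>e=1..q. fl ?t (lookup u (i e)))"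
      using inj_on_subset[OF inj, of "{1..q}"] q by (simp add: sum.reindex)
    also have "\<dots> = (\<Sum>e=1..q. fl ?t (\<alpha> e))" using u_i q by (intro sum.cong) auto
    also have "\<dots> = tail_sum d s \<alpha> q ?t" using \<alpha> q by (intro tail_sum_eq[symmetric] t) auto
    finally show ?thesis by (simp add: D_num_def reg_term_def)
  qed
  let ?D = "D_num d s i \<alpha> ` {1..r}"
  have "Max ?D \<in> ?D" using r by (intro Max_in) auto
  then obtain q where q: "q \<in> {1..r}" "D_num d s i \<alpha> q = Max ?D" by (metis imageE)
  let ?t = "top_index d s (\<alpha> q)"
  have \<alpha>q: "0 < \<alpha> q" using \<alpha> q(1) by blast
  have "regularity n (principal_d_fixed n d s u :: 'k mpoly set) = int (reg_term (lookup u) (i q) ?t)"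
  proof (rule regularity_principal[OF un u1])
    show "i q \<in> {1..n}" using range[OF q(1)] by auto
    show "?t \<le> s" by (rule top_index(1)[OF \<alpha>q])
    show "0 < fl ?t (lookup u (i q))" using fl_pos_iff[OF \<alpha>q top_index(1)[OF \<alpha>q]] u_i[OF q(1)] by simp
    fix k J assume k: "k \<in> {1..n}" "J \<le> s" "0 < fl J (lookup u k)"
    then have "lookup u k \<noteq> 0" using fl_zero[of J] by (metis less_irrefl)
    then have "k \<in> i ` {1..r}" using u_0[of k] by metis
    then obtain e where e: "e \<in> {1..r}" "k = i e" by blast
    have \<alpha>e: "0 < \<alpha> e" using \<alpha> e(1) by blast
    have "J \<le> top_index d s (\<alpha> e)" using fl_pos_iff[OF \<alpha>e k(2)] k(3) u_i[OF e(1)] e(2) by simp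
    then have "reg_term (lookup u) k J \<le> reg_term (lookup u) k (top_index d s (\<alpha> e))"
      using k(1) by (intro reg_term_mono u1 top_index(1)[OF \<alpha>e]) auto
    also have "\<dots> = D_num d s i \<alpha> e" using D[OF e(1)] e(2) by simp
    also have "\<dots> \<le> D_num d s i \<alpha> q" unfolding q(2) using e(1) by (intro Max_ge) auto
    also have "\<dots> = reg_term (lookup u) (i q) ?t" by (rule D[OF q(1)])
    finally show "reg_term (lookup u) k J \<le> reg_term (lookup u) (i q) ?t" .
  qed
  then show ?thesis using D[OF q(1)] q(2) unfolding u_def by simp
qed

lemma regularity_principal_power:
  assumes n: "2 \<le> n" and a: "d_coeff d s a s \<noteq> 0"
  shows "regularity n (principal_d_fixed n d s (Poly_Mapping.single n a) :: 'k::field mpoly set)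
    = int (d_coeff d s a s * d s + (n - 1) * (d s - 1))"
proof -
  have a0: "0 < a" using a by (cases "a = 0") auto
  have top: "top_index d s a = s" using top_index(1)[OF a0] top_index(3)[OF a0 a] by simp
  have "regularity n (principal_d_fixed n d s (\<Sum>q=1..1::nat. Poly_Mapping.single n a) :: 'k mpoly set)
      = int (Max (D_num d s (\<lambda>_. n) (\<lambda>_. a) ` {1..1}))"
    using n a0 by (intro regularity_principal_D_num) (auto simp: strict_mono_on_def)
  then show ?thesis by (simp add: D_num_def tail_sum_def top)
qed

end

theorem theorem1p6p1:
  fixes n s r :: nat and d i \<alpha> :: "nat \<Rightarrow> nat"
  assumes "infinite (UNIV :: 'k::field set)"
    and "n \<ge> 2"
    and "d_sequence d s"
    and "r \<ge> 1"
    and "strict_mono_on {1..r} i"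
    and "2 \<le> i 1"
    and "i r = n"
    and "\<forall>q\<in>{1..r}. 0 < \<alpha> q"
  shows "regularity n (principal_d_fixed n d s (\<Sum>q=1..r. Poly_Mapping.single (i q) (\<alpha> q))
             :: 'k mpoly set) = int (Max (D_num d s i \<alpha> ` {1..r}))
       \<and> (\<forall>a. d_coeff d s a s \<noteq> 0 \<longrightarrow>
            regularity n (principal_d_fixed n d s (Poly_Mapping.single n a) :: 'k mpoly set)
              = int (d_coeff d s a s * d s + (n - 1) * (d s - 1)))"
proof -
  interpret d_seq d s by standard (rule assms(3))
  show ?thesis
    using regularity_principal_D_num[OF assms(4-8)] regularity_principal_power[OF assms(2)] by blast
qed

end
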